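(* Let $A_{-2}\ge 0$, $A_0,A_1,A_2\in\mathbb R$, $A_3\le 0$. Consider the evolution equation $$\big(1-A_{-2}\,\partial_x^2\big)u_t = iA_0u+A_1u_x+iA_2u_{xx}+A_3u_{xxx},\qquad x>0,\ t>0,$$ on the half-line with a sufficiently smooth and decaying initial datum $u(x,0)$, $x>0$, and with Dirichlet boundary datum $u(0,t)=g_0(t)$, $t>0$, that is infinitely smooth and asymptotically periodic in time, i.e. $g_0\in C^\infty(0,\infty)$ and $$g_0(t)\sim\sum_{n\in\mathbb Z}a_ne^{in\omega_0t},\quad t\to\infty,\qquad \omega_0\ge 0,\ a_n\in\mathbb C,$$ with the infinite sum being absolutely convergent. Assume further that the initial datum and the boundary datum $g_0$ satisfy the necessary compatibility conditions at the origin. Suppose that either $\{A_{-2}=0,\ A_3<0\}$ (local, third-order case) or $\{A_{-2}>0,\ A_3=0\}$ (nonlocal, second-order case), with $A_2/(\omega_0A_{-2})\notin\mathbb Z$ in the latter case. Then, under the assumption that the solution $u(x,t)$ and its boundary values $\partial_x^ju(0,t)$, $j\in\mathbb N$, are asymptotically time-periodic, the associated generalized Dirichlet-to-Neumann map satisfies to leading order the asymptotic formula $$\partial_x^ju(0,t)\sim i^j\sum_{n\in\mathbb Z}[k_0(n)]^j\,a_n\,e^{in\omega_0t},\qquad t\to\infty,\ j\in\mathbb N\cup\{0\},$$ where $k_0(n)$ is the unique solution of the equation $$A_3k^3+(A_2+n\omega_0A_{-2})k^2-A_1k-A_0+n\omega_0=0$$ that lies along the positively oriented boundary $\partial D^+$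 of the region $$D^+=\Big\{k\in\mathbb C:\ \operatorname{Im}(k)>0\ \text{ and }\ \operatorname{Re}\Big(\frac{i(A_3k^3+A_2k^2-A_1k-A_0)}{1+A_{-2}k^2}\Big)<0\Big\}.$$
   Context: "Asymptotically time-periodic" means having the same temporal period as $g_0$ in the large-time limit: $u(x,t)\sim\sum_{n\in\mathbb Z}U_n(x)e^{in\omega_0t}$ and $\partial_x^ju(0,t)\sim\sum_{n\in\mathbb Z}b_n^{(j)}e^{in\omega_0t}$ as $t\to\infty$, for some functions $U_n(x)$ and complex coefficients $b^{(j)}_n$. The (generalized) Dirichlet-to-Neumann map is the map expressing the boundary values $\partial_x^ju(0,t)$, $j\ge1$, in terms of the Dirichlet datum $u(0,t)=g_0(t)$; here it amounts to expressing the coefficients $b_n^{(j)}$ in terms of the $a_n$. The solution is understood to decay as $x\to\infty$.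
   Formalization: In the nonlocal case D^+ is assumed nonempty, excluding only A_1=0, A_2+A_0A_{-2}=0, where D^+ and its boundary are empty and k_0(n) does not exist; for ω_0=0, where A_2/(ω_0A_{-2}) is undefined, the non-integrality condition is read as A_2≠0. *)

theory Defs
  imports "HOL-Analysis.Analysis"
begin

section \<open>Smooth functions of one variable\<close>

definition nderiv :: "real set \<Rightarrow> nat \<Rightarrow> (real \<Rightarrow> complex) \<Rightarrow> real \<Rightarrow> complex" where
  "nderiv S j = (\<lambda>f x. vector_derivative f (at x within S)) ^^ j"

text \<open>For \<open>S = {0..}\<close> the derivatives at \<open>0\<close> are one-sided; for the open set \<open>S = {0<..}\<close>
  this is the usual \<open>C\<^sup>\<infinity>\<close> property.\<close>

definition smooth_on :: "real set \<Rightarrow> (real \<Rightarrow> complex) \<Rightarrow> bool" where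
  "smooth_on S f \<longleftrightarrow> (\<forall>j. \<forall>x\<in>S. nderiv S j f differentiable (at x within S))"

section \<open>Functions on the quarter plane\<close>

text \<open>A function \<open>u\<close> of \<open>x \<ge> 0\<close> and \<open>t\<close> is a curried function on all of \<open>\<real> \<times> \<real>\<close> whose values
  outside the quarter plane are never used. Accordingly \<open>dx\<close> is the right-hand derivative at
  \<open>x = 0\<close>, so that \<open>(dx ^^ j) u 0 t\<close> is the boundary value of the \<open>j\<close>-th spatial derivative.\<close>

definition dx :: "(real \<Rightarrow> real \<Rightarrow> complex) \<Rightarrow> real \<Rightarrow> real \<Rightarrow> complex" where
  "dx u x t = vector_derivative (\<lambda>y. u y t) (at x within {0..})"

definition dt :: "(real \<Rightarrow> real \<Rightarrow> complex) \<Rightarrow> real \<Rightarrow> real \<Rightarrow> complex" where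
  "dt u x t = vector_derivative (\<lambda>s. u x s) (at t)"

text \<open>\<open>Ck k u\<close>: all iterated partial derivatives of order at most \<open>k\<close>, taken in any order, exist and
  are jointly continuous on \<open>{0..} \<times> {0<..}\<close>, i.e. up to the boundary \<open>x = 0\<close> for positive times.\<close>

primrec Ck :: "nat \<Rightarrow> (real \<Rightarrow> real \<Rightarrow> complex) \<Rightarrow> bool" where
  "Ck 0 u \<longleftrightarrow> continuous_on ({0..} \<times> {0<..}) (\<lambda>(x, t). u x t)"
| "Ck (Suc k) u \<longleftrightarrow> continuous_on ({0..} \<times> {0<..}) (\<lambda>(x, t). u x t) \<and>
     (\<forall>x\<ge>0. \<forall>t>0. (\<lambda>y. u y t) differentiable (at x within {0..}) \<and>
                 (\<lambda>s. u x s) differentiable (at t)) \<and>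
     Ck k (dx u) \<and> Ck k (dt u)"

section \<open>The half-line problem\<close>

text \<open>``Sufficiently decaying'' is made precise as a quadratic rate for the spatial derivatives up
  to order three, the highest order in the equation.\<close>

definition admissible_initial_datum :: "(real \<Rightarrow> complex) \<Rightarrow> bool" where
  "admissible_initial_datum u0 \<longleftrightarrow> smooth_on {0..} u0 \<and>
     (\<forall>j\<le>3. \<exists>C. \<forall>x\<ge>0. (1 + x)\<^sup>2 * norm (nderiv {0..} j u0 x) \<le> C)"

text \<open>Decay of the solution, including its time derivative because of the term with \<open>\<partial>\<^sub>x\<^sup>2 u\<^sub>t\<close>.
  It is uniform on compact time intervals only: for large times \<open>u\<close> may approach waves that do
  not decay in \<open>x\<close>.\<close>

definition decaying :: "(real \<Rightarrow> real \<Rightarrow> complex) \<Rightarrow> bool" where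
  "decaying u \<longleftrightarrow> (\<forall>m\<le>1. \<forall>j\<le>3. \<forall>s>0. \<forall>T\<ge>s. \<exists>C. \<forall>t\<in>{s..T}. \<forall>x\<ge>0.
     (1 + x)\<^sup>2 * norm ((dt ^^ m) ((dx ^^ j) u) x t) \<le> C)"

text \<open>The parameter \<open>Am2\<close> stands for \<open>A\<^sub>-\<^sub>2\<close>.\<close>

definition satisfies_pde ::
    "real \<Rightarrow> real \<Rightarrow> real \<Rightarrow> real \<Rightarrow> real \<Rightarrow> (real \<Rightarrow> real \<Rightarrow> complex) \<Rightarrow> bool" where
  "satisfies_pde Am2 A0 A1 A2 A3 u \<longleftrightarrow> (\<forall>x>0. \<forall>t>0.
     dt u x t - of_real Am2 * (dx ^^ 2) (dt u) x t =
       \<i> * of_real A0 * u x t + of_real A1 * dx u x t +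
       \<i> * of_real A2 * (dx ^^ 2) u x t + of_real A3 * (dx ^^ 3) u x t)"

definition half_line_solution ::
    "real \<Rightarrow> real \<Rightarrow> real \<Rightarrow> real \<Rightarrow> real \<Rightarrow> (real \<Rightarrow> complex) \<Rightarrow> (real \<Rightarrow> complex) \<Rightarrow>
     (real \<Rightarrow> real \<Rightarrow> complex) \<Rightarrow> bool" where
  "half_line_solution Am2 A0 A1 A2 A3 u0 g0 u \<longleftrightarrow>
     continuous_on ({0..} \<times> {0..}) (\<lambda>(x, t). u x t) \<and> (\<forall>k. Ck k u) \<and> decaying u \<and>
     satisfies_pde Am2 A0 A1 A2 A3 u \<and>
     (\<forall>x>0. u x 0 = u0 x) \<and> (\<forall>t>0. u 0 t = g0 t)"

text \<open>Compatibility at the origin. Only the lowest-order condition is imposed; since the solution is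
  not required to be smooth at the corner \<open>x = t = 0\<close>, no condition of higher order is needed.\<close>

definition compatible_at_origin :: "(real \<Rightarrow> complex) \<Rightarrow> (real \<Rightarrow> complex) \<Rightarrow> bool" where
  "compatible_at_origin u0 g0 \<longleftrightarrow> (g0 \<longlongrightarrow> u0 0) (at_right 0)"

section \<open>Asymptotic periodicity in time\<close>

text \<open>\<open>f(t) \<sim> \<Sum>\<^sub>n c\<^sub>n exp(i n \<omega>\<^sub>0 t)\<close> as \<open>t \<rightarrow> \<infinity>\<close>: the series converges absolutely and the difference of
  the two sides tends to zero.\<close>

definition asymp_periodic :: "real \<Rightarrow> (real \<Rightarrow> complex) \<Rightarrow> (int \<Rightarrow> complex) \<Rightarrow> bool" where
  "asymp_periodic \<omega>0 f c \<longleftrightarrow> (\<lambda>n. norm (c n)) summable_on UNIV \<and>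
     ((\<lambda>t. f t - (\<Sum>\<^sub>\<infinity>n\<in>UNIV. c n * exp (\<i> * of_int n * of_real \<omega>0 * of_real t))) \<longlongrightarrow> 0) at_top"

section \<open>The region \<open>D\<^sup>+\<close> and the root \<open>k\<^sub>0(n)\<close>\<close>

text \<open>At the pole \<open>k = \<i> / sqrt Am2\<close> the quotient is \<open>0\<close> in HOL, so the pole is not a point of \<open>Dplus\<close>,
  as it should be. If \<open>Am2 > 0\<close> and \<open>A3 = 0\<close>, the region is empty exactly when \<open>A1 = 0\<close> and
  \<open>A2 + A0 * Am2 = 0\<close>: then the dispersion relation is constant and \<open>k\<^sub>0(n)\<close> does not exist.\<close>

definition Dplus :: "real \<Rightarrow> real \<Rightarrow> real \<Rightarrow> real \<Rightarrow> real \<Rightarrow> complex set" where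
  "Dplus Am2 A0 A1 A2 A3 = {k. Im k > 0 \<and>
     Re (\<i> * (of_real A3 * k ^ 3 + of_real A2 * k\<^sup>2 - of_real A1 * k - of_real A0) /
         (1 + of_real Am2 * k\<^sup>2)) < 0}"

definition is_k0 ::
    "real \<Rightarrow> real \<Rightarrow> real \<Rightarrow> real \<Rightarrow> real \<Rightarrow> real \<Rightarrow> int \<Rightarrow> complex \<Rightarrow> bool" where
  "is_k0 Am2 A0 A1 A2 A3 \<omega>0 n k \<longleftrightarrow>
     of_real A3 * k ^ 3 + (of_real A2 + of_int n * of_real \<omega>0 * of_real Am2) * k\<^sup>2
       - of_real A1 * k - of_real A0 + of_int n * of_real \<omega>0 = 0 \<and>
     k \<in> frontier (Dplus Am2 A0 A1 A2 A3)"

definition k0 ::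
    "real \<Rightarrow> real \<Rightarrow> real \<Rightarrow> real \<Rightarrow> real \<Rightarrow> real \<Rightarrow> int \<Rightarrow> complex" where
  "k0 Am2 A0 A1 A2 A3 \<omega>0 n = (THE k. is_k0 Am2 A0 A1 A2 A3 \<omega>0 n k)"

text \<open>The requirement that \<open>A\<^sub>2 / (\<omega>\<^sub>0 A\<^sub>-\<^sub>2)\<close> is not an integer. For \<open>\<omega>\<^sub>0 = 0\<close>, where HOL would return \<open>0\<close>
  for the quotient, it is read as \<open>A\<^sub>2 \<noteq> 0\<close> (an infinite quotient); in both cases the quadratic
  equation for \<open>k\<close> does not degenerate.\<close>

definition nonresonant :: "real \<Rightarrow> real \<Rightarrow> real \<Rightarrow> bool" where
  "nonresonant Am2 A2 \<omega>0 \<longleftrightarrow> (if \<omega>0 = 0 then A2 \<noteq> 0 else A2 / (\<omega>0 * Am2) \<notin> \<int>)"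

end

theory Submission
  imports Defs
begin

text \<open>Write \<open>\<beta> = A\<^sub>-\<^sub>2\<close>, \<open>g\<^sub>j(t) = \<partial>\<^sub>x\<^sup>j u(0,t)\<close> and \<open>P(k) = A\<^sub>3 k\<^sup>3 + A\<^sub>2 k\<^sup>2 - A\<^sub>1 k - A\<^sub>0\<close>. If \<open>Im k < 0\<close> and
  \<open>s (1 + \<beta> k\<^sup>2) = - \<i> P(k)\<close>, then \<open>exp (- \<i> k x - s t) (u - \<beta> u\<^sub>x\<^sub>x)\<close> is the density of a conservation
  law, whose flux at \<open>x = 0\<close> is linear in \<open>g\<^sub>0, g\<^sub>1, g\<^sub>2\<close>. An energy estimate bounds the growth of \<open>u(\<cdot>,t)\<close> by
  \<open>exp (\<eta> t)\<close> for every \<open>\<eta> > 0\<close>, so for \<open>Re s > 0\<close> the Laplace transform at \<open>s\<close> of the boundary flux is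
  bounded uniformly in \<open>k\<close>. Letting \<open>s\<close> tend to \<open>\<i> n \<omega>\<^sub>0\<close> inside a cone, an Abelian mean value picks out the
  \<open>n\<close>-th Fourier coefficients of the \<open>g\<^sub>j\<close>, and each root \<open>k\<close> of the dispersion relation other than
  \<open>k\<^sub>0(n)\<close> yields one linear relation between them, all these roots being limits of points
  in the lower half plane. By Vieta's formulas the relations say that \<open>b\<^sub>j = (\<i> k\<^sub>0)\<^sup>j a\<^sub>n\<close> for \<open>j = 1\<close>,
  and for \<open>j = 2\<close> if the equation has order three. The equation itself, differentiated in \<open>x\<close> at the boundary, gives the
  recursion for the remaining \<open>j\<close>.\<close>

text \<open>Nothing is known a priori about the size of the solution at large times: decay in x is
  uniform on compact time intervals only, and regularity holds for t > 0 but not at the corner. So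
  every estimate starts at time 1, and growth in time has to be derived, from boundary values that
  are bounded because they are asymptotically periodic. The constants of the energy estimate may
  depend on k and s, for they enter only through the density at time T, which is damped to zero as T
  grows. What survives is the density at time 1, whose bound depends on neither. This uniformity
  lets s reach the imaginary axis: multiplied by a vanishing \<open>\<mu>\<close>, the bounded
  transform disappears. Why all roots but \<open>k0\<close> can be reached: a simple real root is a
  limit from below with Re s > 0 exactly where the derivative of P / (1 + \<beta> k k), the group
  velocity, is negative, whereas a simple real \<open>k0\<close> lies where it is positive. If
  \<open>k0\<close> is a multiple root, its remaining copies are approached along slanted
  directions; at a triple root the two slanted branches have to be compared with each other.\<close>

abbreviation symbol :: "real \<Rightarrow> real \<Rightarrow> real \<Rightarrow> real \<Rightarrow> complex \<Rightarrow> complex" where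
  "symbol A0 A1 A2 A3 k \<equiv> of_real A3 * k ^ 3 + of_real A2 * k\<^sup>2 - of_real A1 * k - of_real A0"

section \<open>Calculus on the quarter plane\<close>

definition smooth :: "(real \<Rightarrow> real \<Rightarrow> complex) \<Rightarrow> bool" where
  "smooth u \<longleftrightarrow> (\<forall>k. Ck k u)"

lemma smooth_dx: "smooth u \<Longrightarrow> smooth (dx u)"
  and smooth_dt: "smooth u \<Longrightarrow> smooth (dt u)"
  unfolding smooth_def by (meson Ck.simps(2))+

lemma smooth_dx_iter: "smooth u \<Longrightarrow> smooth ((dx ^^ j) u)"
  by (induction j) (auto intro: smooth_dx)

lemma smooth_continuous:
  "smooth u \<Longrightarrow> continuous_on ({0..} \<times> {0<..}) (\<lambda>(x, t). u x t)"
  unfolding smooth_def by (metis Ck.simps(1))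

lemma smooth_continuous_compose:
  assumes "smooth u" "continuous_on S f" "continuous_on S g"
    "\<And>z. z \<in> S \<Longrightarrow> 0 \<le> f z" "\<And>z. z \<in> S \<Longrightarrow> 0 < g z"
  shows "continuous_on S (\<lambda>z. u (f z) (g z))"
proof -
  have "continuous_on S (\<lambda>z. (f z, g z))"
    using assms by (intro continuous_intros) auto
  then show ?thesis
    using continuous_on_compose2[OF smooth_continuous[OF assms(1)], of S "\<lambda>z. (f z, g z)"]
      assms(4,5) by auto
qed

lemma smooth_continuous_pair:
  assumes "smooth u"
  shows "continuous_on ({0..} \<times> {1..}) (\<lambda>z. u (fst z) (snd z))"
  by (rule smooth_continuous_compose[OF assms]) (auto intro!: continuous_intros)

lemma smooth_has_dx:
  assumes "smooth u" "x \<ge> 0" "t > 0"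
  shows "((\<lambda>y. u y t) has_vector_derivative dx u x t) (at x within {0..})"
  using assms unfolding smooth_def dx_def
  by (metis Ck.simps(2) vector_derivative_works)

lemma smooth_has_dt:
  assumes "smooth u" "x \<ge> 0" "t > 0"
  shows "((\<lambda>s. u x s) has_vector_derivative dt u x t) (at t)"
  using assms unfolding smooth_def dt_def
  by (metis Ck.simps(2) vector_derivative_works)

lemma at_within_atLeast_nontrivial: "(x::real) \<ge> 0 \<Longrightarrow> at x within {0..} \<noteq> bot"
proof -
  assume "x \<ge> 0"
  then have "\<exists>x'\<in>{0..}. x' \<noteq> x \<and> dist x' x < e" if "e > 0" for e
    using that by (intro bexI[of _ "x + e / 2"]) (auto simp: dist_real_def)
  then show ?thesis by (simp add: trivial_limit_within islimpt_approachable)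
qed

lemma dx_eqI:
  assumes "((\<lambda>y. f y t) has_vector_derivative d) (at x within {0..})" "x \<ge> 0"
  shows "dx f x t = d"
  unfolding dx_def by (rule vector_derivative_within[OF at_within_atLeast_nontrivial[OF assms(2)] assms(1)])

lemma dx_cong:
  assumes "\<And>y. y \<ge> 0 \<Longrightarrow> f y t = g y t" "x \<ge> 0"
  shows "dx f x t = dx g x t"
proof -
  have "((\<lambda>y. f y t) has_vector_derivative d) (at x within {0..}) \<longleftrightarrow>
        ((\<lambda>y. g y t) has_vector_derivative d) (at x within {0..})" for d
    using assms by (intro has_vector_derivative_cong_ev) (auto intro!: always_eventually)
  then show ?thesis unfolding dx_def vector_derivative_def by simp
qed

text \<open>The time derivative is integrated: \<open>u y s\<close> is its value at an earlier time
  plus the integral of \<open>dt u y\<close>, the Leibniz rule moves \<open>dx\<close> under the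
  integral, and differentiating in the upper limit gives the claim. Taken within
  \<open>{0..}\<close>, the Leibniz rule also covers the one-sided derivative at
  \<open>x = 0\<close>, where the boundary values live.\<close>

lemma dx_dt_commute:
  assumes u: "smooth u" and x: "x \<ge> 0" and t: "t > 0"
  shows "dx (dt u) x t = dt (dx u) x t"
proof -
  define a where "a = t / 2"
  have a: "0 < a" "a < t" using t by (auto simp: a_def)
  note ut = smooth_dt[OF u]
  note cont = smooth_continuous_compose[OF u] smooth_continuous_compose[OF ut]
    smooth_continuous_compose[OF smooth_dx[OF ut]]
  have ftc: "u y s = u y a + integral {a..s} (dt u y)" if "y \<ge> 0" "s \<ge> a" for y s
  proof -
    have "(dt u y has_integral u y s - u y a) {a..s}"
      using that a smooth_has_dt[OF u that(1)]
      by (intro fundamental_theorem_of_calculus)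
         (auto intro: has_vector_derivative_at_within)
    then show ?thesis by (simp add: integral_unique)
  qed
  have rep: "dx u x s = dx u x a + integral {a..s} (dx (dt u) x)" if s: "s \<ge> a" for s
  proof (rule dx_eqI[OF _ x])
    have "((\<lambda>y. integral (cbox a s) (dt u y)) has_vector_derivative
             integral (cbox a s) (dx (dt u) x)) (at x within {0..})"
      using a x s
      by (intro leibniz_rule_vector_derivative)
         (auto intro!: smooth_has_dx[OF ut] integrable_continuous_real continuous_intros cont
           simp: split_beta)
    then have "((\<lambda>y. u y a + integral {a..s} (dt u y)) has_vector_derivative
             (dx u x a + integral {a..s} (dx (dt u) x))) (at x within {0..})"
      using a x by (intro derivative_intros smooth_has_dx[OF u]) auto
    then show "((\<lambda>y. u y s) has_vector_derivative
             (dx u x a + integral {a..s} (dx (dt u) x))) (at x within {0..})"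
      by (rule has_vector_derivative_transform[rotated -1]) (use x in simp, rule ftc[OF _ s], simp)
  qed
  have "((\<lambda>s. integral {a..s} (dx (dt u) x)) has_vector_derivative dx (dt u) x t)
           (at t within {a..t + 1})"
    using a x by (intro integral_has_vector_derivative continuous_intros cont) auto
  then have "((\<lambda>s. dx u x a + integral {a..s} (dx (dt u) x)) has_vector_derivative dx (dt u) x t)
           (at t within {a..t + 1})"
    by (auto intro!: derivative_eq_intros)
  then have "((\<lambda>s. dx u x s) has_vector_derivative dx (dt u) x t) (at t within {a..t + 1})"
    by (rule has_vector_derivative_transform[rotated -1]) (use a in simp, rule rep, simp)
  moreover have "at t within {a..t + 1} = at t"
    using a by (intro at_within_interior) auto
  ultimately have "((\<lambda>s. dx u x s) has_vector_derivative dx (dt u) x t) (at t)" by simp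
  then show ?thesis
    unfolding dt_def by (simp add: vector_derivative_at)
qed

lemma dx_iter_dt_commute:
  assumes u: "smooth u" and x: "x \<ge> 0" and t: "t > 0"
  shows "(dx ^^ j) (dt u) x t = dt ((dx ^^ j) u) x t"
  using x
proof (induction j arbitrary: x)
  case (Suc j)
  have "dx ((dx ^^ j) (dt u)) x t = dx (dt ((dx ^^ j) u)) x t"
    using Suc by (intro dx_cong) auto
  then show ?case
    using dx_dt_commute[OF smooth_dx_iter[OF u] Suc.prems t] by simp
qed simp

text \<open>The equation is given for \<open>x > 0\<close> only. Both sides are continuous up to
  \<open>x = 0\<close>, so it persists there, and then it may be differentiated in x any number of
  times. At \<open>x = 0\<close> this becomes the recursion for the boundary values.\<close>

lemma pde_all_orders:
  assumes u: "smooth u" and pde: "satisfies_pde Am2 A0 A1 A2 A3 u"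
    and x: "x \<ge> 0" and t: "t > 0"
  shows "dt ((dx ^^ j) u) x t - of_real Am2 * dt ((dx ^^ (j + 2)) u) x t =
       \<i> * of_real A0 * (dx ^^ j) u x t + of_real A1 * (dx ^^ (j + 1)) u x t +
       \<i> * of_real A2 * (dx ^^ (j + 2)) u x t + of_real A3 * (dx ^^ (j + 3)) u x t"
  using x
proof (induction j arbitrary: x)
  case 0
  note sm = smooth_dx_iter[OF u]
  define D where "D y = dt u y t - of_real Am2 * dt ((dx ^^ 2) u) y t -
       (\<i> * of_real A0 * u y t + of_real A1 * dx u y t +
       \<i> * of_real A2 * (dx ^^ 2) u y t + of_real A3 * (dx ^^ 3) u y t)" for y
  have pos: "D y = 0" if "y > 0" for y
    unfolding D_def right_minus_eq dx_iter_dt_commute[OF u less_imp_le[OF that] t, symmetric]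
    using pde[unfolded satisfies_pde_def, rule_format, OF that t] .
  have "continuous_on {0..} D"
    unfolding D_def using t
    by (intro continuous_intros smooth_continuous_compose[OF sm]
      smooth_continuous_compose[OF u] smooth_continuous_compose[OF smooth_dx[OF u]]
      smooth_continuous_compose[OF smooth_dt[OF sm]]
      smooth_continuous_compose[OF smooth_dt[OF u]]) auto
  then have "(D \<longlongrightarrow> D 0) (at_right 0)"
    unfolding continuous_on_def at_within_Ici_at_right[symmetric] by simp
  moreover have "(D \<longlongrightarrow> 0) (at_right 0)"
    by (rule tendsto_eventually) (use pos in \<open>auto simp: eventually_at_right_field intro!: exI[of _ 1]\<close>)
  ultimately have "D 0 = 0" by (rule tendsto_unique[rotated]) simp
  with pos 0 have "D x = 0" by (cases "x = 0") auto
  then show ?case unfolding D_def right_minus_eq by (simp add: numeral_2_eq_2)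
next
  case (Suc j)
  note sm = smooth_dx_iter[OF u]
  let ?w = "\<lambda>j. (dx ^^ j) u"
  have L: "((\<lambda>y. dt (?w j) y t - of_real Am2 * dt (?w (j + 2)) y t) has_vector_derivative
     dx (dt (?w j)) x t - of_real Am2 * dx (dt (?w (j + 2))) x t) (at x within {0..})"
    using Suc.prems t by (intro derivative_intros smooth_has_dx[OF smooth_dt[OF sm]])
  have R: "((\<lambda>y. \<i> * of_real A0 * ?w j y t + of_real A1 * ?w (j + 1) y t +
       \<i> * of_real A2 * ?w (j + 2) y t + of_real A3 * ?w (j + 3) y t) has_vector_derivative
      \<i> * of_real A0 * dx (?w j) x t + of_real A1 * dx (?w (j + 1)) x t +
       \<i> * of_real A2 * dx (?w (j + 2)) x t + of_real A3 * dx (?w (j + 3)) x t) (at x within {0..})"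
    using Suc.prems t by (intro derivative_intros smooth_has_dx[OF sm])
  have "((\<lambda>y. dt (?w j) y t - of_real Am2 * dt (?w (j + 2)) y t) has_vector_derivative
      \<i> * of_real A0 * dx (?w j) x t + of_real A1 * dx (?w (j + 1)) x t +
       \<i> * of_real A2 * dx (?w (j + 2)) x t + of_real A3 * dx (?w (j + 3)) x t) (at x within {0..})"
  proof (rule has_vector_derivative_transform[OF _ _ R])
    show "x \<in> {0..}" using Suc.prems by simp
    fix y :: real assume "y \<in> {0..}"
    then show "dt (?w j) y t - of_real Am2 * dt (?w (j + 2)) y t =
        \<i> * of_real A0 * ?w j y t + of_real A1 * ?w (j + 1) y t +
        \<i> * of_real A2 * ?w (j + 2) y t + of_real A3 * ?w (j + 3) y t"
      by (intro Suc.IH) simp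
  qed
  then have "dx (dt (?w j)) x t - of_real Am2 * dx (dt (?w (j + 2))) x t =
     \<i> * of_real A0 * dx (?w j) x t + of_real A1 * dx (?w (j + 1)) x t +
       \<i> * of_real A2 * dx (?w (j + 2)) x t + of_real A3 * dx (?w (j + 3)) x t"
    using vector_derivative_unique_within[OF at_within_atLeast_nontrivial[OF Suc.prems] L] by blast
  then show ?case
    using dx_dt_commute[OF sm[of j] Suc.prems t] dx_dt_commute[OF sm[of "j+2"] Suc.prems t]
    unfolding add_Suc funpow.simps comp_apply by simp
qed

text \<open>The common core of the energy estimate and of the global relation: the fundamental
  theorem in t for each x, then Fubini. The inner integral of \<open>Qt\<close> is afterwards
  evaluated or bounded by a flux in x.\<close>

lemma integral_time_difference:
  fixes Q Qt :: "real \<Rightarrow> real \<Rightarrow> 'a::euclidean_space"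
  assumes "0 \<le> X" "s \<le> T"
    and Qt: "\<And>x t. x \<in> {0..X} \<Longrightarrow> t \<in> {s..T} \<Longrightarrow> ((\<lambda>t. Q x t) has_vector_derivative Qt x t) (at t within {s..T})"
    and cQt: "continuous_on ({0..X} \<times> {s..T}) (\<lambda>(x, t). Qt x t)"
    and cQ: "\<And>t. t \<in> {s..T} \<Longrightarrow> continuous_on {0..X} (\<lambda>x. Q x t)"
  shows "integral {0..X} (\<lambda>x. Q x T) - integral {0..X} (\<lambda>x. Q x s) =
    integral {s..T} (\<lambda>t. integral {0..X} (\<lambda>x. Qt x t))"
proof -
  have "integral {0..X} (\<lambda>x. Q x T) - integral {0..X} (\<lambda>x. Q x s) =
     integral {0..X} (\<lambda>x. Q x T - Q x s)"
    using assms by (intro integral_diff[symmetric] integrable_continuous_real cQ) auto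
  also have "\<dots> = integral {0..X} (\<lambda>x. integral {s..T} (Qt x))"
  proof (rule integral_cong)
    fix x assume "x \<in> {0..X}"
    then have "(Qt x has_integral Q x T - Q x s) {s..T}"
      using assms by (intro fundamental_theorem_of_calculus) auto
    then show "Q x T - Q x s = integral {s..T} (Qt x)" by (simp add: integral_unique)
  qed
  also have "\<dots> = integral {s..T} (\<lambda>t. integral {0..X} (\<lambda>x. Qt x t))"
    using integral_swap_continuous[of 0 s X T Qt] cQt by (simp add: cbox_Pair_eq)
  finally show ?thesis .
qed

section \<open>Energy estimates\<close>

text \<open>Removes the flux through the far end X, which is of order \<open>1 / (1 + X)\<close> on
  a fixed time interval.\<close>

lemma le_of_le_add_vanishing:
  fixes a b c :: real
  assumes "\<And>X. X \<ge> X0 \<Longrightarrow> a \<le> b + c / (1 + X)"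
  shows "a \<le> b"
proof -
  have "filterlim (\<lambda>X::real. 1 + X) at_top at_top"
    by (rule filterlim_tendsto_add_at_top[OF tendsto_const filterlim_ident])
  then have "((\<lambda>X. b + c / (1 + X)) \<longlongrightarrow> b + 0) at_top"
    by (intro tendsto_add tendsto_const real_tendsto_divide_at_top[OF tendsto_const])
  then have "b + 0 \<ge> a"
    by (rule tendsto_lowerbound) (auto intro: eventually_mono[OF eventually_ge_at_top[of X0]] assms)
  then show ?thesis by simp
qed

lemma integral_inverse_square_le: "X \<ge> 0 \<Longrightarrow> integral {0..X} (\<lambda>x. 1 / (1 + x)\<^sup>2) \<le> (1::real)"
proof -
  assume X: "X \<ge> 0"
  have "((\<lambda>x. 1 / (1 + x)\<^sup>2) has_integral (- 1 / (1 + X)) - (- 1 / (1 + 0))) {0..X}"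
    using X
    by (intro fundamental_theorem_of_calculus)
       (auto intro!: derivative_eq_intros
         simp: has_real_derivative_iff_has_vector_derivative[symmetric] power2_eq_square field_simps)
  then show ?thesis using X by (simp add: integral_unique)
qed

lemma integral_exp_decay_le:
  assumes "a \<le> X" "0 < c"
  shows "integral {a..X} (\<lambda>x. exp (- (c * x))) \<le> exp (- (c * a)) / (c::real)"
proof -
  have "((\<lambda>x. exp (- (c * x))) has_integral (- exp (- (c * X)) / c) - (- exp (- (c * a)) / c)) {a..X}"
    using assms
    by (intro fundamental_theorem_of_calculus)
       (auto intro!: derivative_eq_intros
         simp: has_real_derivative_iff_has_vector_derivative[symmetric])
  then show ?thesis using assms by (simp add: integral_unique)
qed

text \<open>Truncation at X with a constant independent of X stands for the integral over the
  half-line. The bound is obtained for every positive \<open>\<eta>\<close>, each with its own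
  constant, which amounts to subexponential growth.\<close>

abbreviation energy_bound :: "real \<Rightarrow> (real \<Rightarrow> real \<Rightarrow> complex) \<Rightarrow> (real \<Rightarrow> real \<Rightarrow> complex) \<Rightarrow> real \<Rightarrow> bool" where
  "energy_bound Am2 v vx \<eta> \<equiv> \<exists>C. \<forall>X\<ge>0. \<forall>T\<ge>1.
    integral {0..X} (\<lambda>x. (norm (v x T))\<^sup>2 + Am2 * (norm (vx x T))\<^sup>2) \<le> C * exp (\<eta> * T)"

text \<open>Pair the equation with v: the time derivative of the energy density is the x-derivative
  of the flux \<open>J\<close> plus twice the inner product of v and F. Decay kills the flux at
  infinity, \<open>influx\<close> limits what enters at \<open>x = 0\<close>, and an arbitrarily
  small exponential rate absorbs the forcing. The term F is there for the nonlocal case, where v is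
  not u itself.\<close>

lemma energy_growth:
  fixes v vx vxx vxxx vt vxt vxxt F :: "real \<Rightarrow> real \<Rightarrow> complex"
  assumes Am2: "Am2 \<ge> 0"
    and dv: "\<And>x t. x \<ge> 0 \<Longrightarrow> t \<ge> 1 \<Longrightarrow> ((\<lambda>y. v y t) has_vector_derivative vx x t) (at x within {0..})"
    and dvx: "\<And>x t. x \<ge> 0 \<Longrightarrow> t \<ge> 1 \<Longrightarrow> ((\<lambda>y. vx y t) has_vector_derivative vxx x t) (at x within {0..})"
    and dvxx: "\<And>x t. x \<ge> 0 \<Longrightarrow> t \<ge> 1 \<Longrightarrow> ((\<lambda>y. vxx y t) has_vector_derivative vxxx x t) (at x within {0..})"
    and dvxt: "\<And>x t. x \<ge> 0 \<Longrightarrow> t \<ge> 1 \<Longrightarrow> ((\<lambda>y. vxt y t) has_vector_derivative vxxt x t) (at x within {0..})"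
    and tv: "\<And>x t. x \<ge> 0 \<Longrightarrow> t \<ge> 1 \<Longrightarrow> ((\<lambda>s. v x s) has_vector_derivative vt x t) (at t)"
    and tvx: "\<And>x t. x \<ge> 0 \<Longrightarrow> t \<ge> 1 \<Longrightarrow> ((\<lambda>s. vx x s) has_vector_derivative vxt x t) (at t)"
    and cont: "continuous_on ({0..} \<times> {1..}) (\<lambda>z. v (fst z) (snd z))"
      "continuous_on ({0..} \<times> {1..}) (\<lambda>z. vx (fst z) (snd z))"
      "continuous_on ({0..} \<times> {1..}) (\<lambda>z. vxx (fst z) (snd z))"
      "continuous_on ({0..} \<times> {1..}) (\<lambda>z. vxxx (fst z) (snd z))"
      "continuous_on ({0..} \<times> {1..}) (\<lambda>z. vt (fst z) (snd z))"
      "continuous_on ({0..} \<times> {1..}) (\<lambda>z. vxt (fst z) (snd z))"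
      "continuous_on ({0..} \<times> {1..}) (\<lambda>z. vxxt (fst z) (snd z))"
    and pde: "\<And>x t. x \<ge> 0 \<Longrightarrow> t \<ge> 1 \<Longrightarrow> vt x t - of_real Am2 * vxxt x t =
       \<i> * of_real A0 * v x t + of_real A1 * vx x t + \<i> * of_real A2 * vxx x t
         + of_real A3 * vxxx x t + F x t"
    and decay: "\<And>T. T \<ge> 1 \<Longrightarrow> \<exists>C. \<forall>t\<in>{1..T}. \<forall>x\<ge>0. (1 + x) * norm (v x t) \<le> C \<and>
       (1 + x) * norm (vx x t) \<le> C \<and> norm (vxx x t) \<le> C \<and> norm (vxt x t) \<le> C"
    and F: "\<And>x t. x \<ge> 0 \<Longrightarrow> t \<ge> 1 \<Longrightarrow> (norm (F x t))\<^sup>2 \<le> K * exp (- (c * x))" and c: "c > 0"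
    and influx: "\<And>t. t \<ge> 1 \<Longrightarrow> - B \<le> 2 * Am2 * (v 0 t \<bullet> vxt 0 t) + A1 * (v 0 t \<bullet> v 0 t) +
       2 * A2 * (v 0 t \<bullet> (\<i> * vx 0 t)) + 2 * A3 * (v 0 t \<bullet> vxx 0 t) - A3 * (vx 0 t \<bullet> vx 0 t)"
    and \<eta>: "\<eta> > 0"
  shows "energy_bound Am2 v vx \<eta>"
proof -
  have K: "K \<ge> 0" using F[of 0 1] by (simp add: order_trans[OF zero_le_power2])
  define J where "J x t = 2 * Am2 * (v x t \<bullet> vxt x t) + A1 * (v x t \<bullet> v x t) +
       2 * A2 * (v x t \<bullet> (\<i> * vx x t)) + 2 * A3 * (v x t \<bullet> vxx x t) - A3 * (vx x t \<bullet> vx x t)" for x t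
  note J = J_def
  have J0: "- B \<le> J 0 t" if "t \<ge> 1" for t unfolding J using influx[OF that] .
  define e where "e x t = v x t \<bullet> v x t + Am2 * (vx x t \<bullet> vx x t)" for x t
  \<comment> \<open>The weight contributes \<open>- \<eta> * e x t\<close> to the time derivative.
    This pays for the forcing, and the weighted inflow becomes integrable over all times.\<close>
  define Q where "Q x t = exp (- (\<eta> * t)) * e x t" for x t
  define Qt where "Qt x t = exp (- (\<eta> * t)) *
    (2 * (v x t \<bullet> vt x t) + 2 * Am2 * (vx x t \<bullet> vxt x t) - \<eta> * e x t)" for x t
  \<comment> \<open>The extra exponential is an antiderivative in x of the bound
    \<open>K / \<eta> * exp (- (c * x))\<close> on the forcing, so flux and forcing together are
    bounded by one exact x-derivative.\<close>
  define G where "G x t = exp (- (\<eta> * t)) * (J x t - K / (c * \<eta>) * exp (- (c * x)))" for x t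
  define Gx where "Gx x t = exp (- (\<eta> * t)) *
    (2 * Am2 * (vx x t \<bullet> vxt x t + v x t \<bullet> vxxt x t) + 2 * A1 * (v x t \<bullet> vx x t) +
     2 * A2 * (v x t \<bullet> (\<i> * vxx x t)) + 2 * A3 * (v x t \<bullet> vxxx x t) + K / \<eta> * exp (- (c * x)))" for x t
  note inner_deriv = bounded_bilinear.has_vector_derivative[OF bounded_bilinear_inner]
  have e_nonneg: "e x t \<ge> 0" for x t using Am2 by (simp add: e_def)
  have Qt: "((\<lambda>t. Q x t) has_vector_derivative Qt x t) (at t within S)" if "x \<ge> 0" "t \<ge> 1" for x t S
  proof -
    have 1: "((\<lambda>t. v x t \<bullet> v x t) has_real_derivative 2 * (v x t \<bullet> vt x t)) (at t)"
      using inner_deriv[OF tv[OF that] tv[OF that]]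
      by (simp add: has_real_derivative_iff_has_vector_derivative inner_commute)
    have 2: "((\<lambda>t. vx x t \<bullet> vx x t) has_real_derivative 2 * (vx x t \<bullet> vxt x t)) (at t)"
      using inner_deriv[OF tvx[OF that] tvx[OF that]]
      by (simp add: has_real_derivative_iff_has_vector_derivative inner_commute)
    have "((\<lambda>t. Q x t) has_real_derivative Qt x t) (at t)"
      unfolding Q_def Qt_def e_def
      by (rule derivative_eq_intros 1 2 refl | simp add: algebra_simps)+
    then show ?thesis
      by (simp add: has_real_derivative_iff_has_vector_derivative has_vector_derivative_at_within)
  qed
  \<comment> \<open>Multiplication by \<open>\<i>\<close> is skew-symmetric for the real inner
    product. Hence the \<open>A2\<close> term is a pure x-derivative, and for the same reason the
    \<open>A0\<close> term drops out of the balance below.\<close>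
  have inner_i: "p \<bullet> (\<i> * p) = 0" for p :: complex
    by (simp add: inner_complex_def)
  have Gx: "((\<lambda>y. G y t) has_vector_derivative Gx x t) (at x within {0..})" if "x \<ge> 0" "t \<ge> 1" for x t
  proof -
    note d = dv[OF that] dvx[OF that] dvxx[OF that] dvxt[OF that]
    have di: "((\<lambda>y. \<i> * vx y t) has_vector_derivative \<i> * vxx x t) (at x within {0..})"
      using d(2) by (rule has_vector_derivative_mult_right)
    note ds = inner_deriv[OF d(1) d(4)] inner_deriv[OF d(1) d(1)] inner_deriv[OF d(1) di]
      inner_deriv[OF d(1) d(3)] inner_deriv[OF d(2) d(2)]
    note ds' = ds[folded has_real_derivative_iff_has_vector_derivative]
    have "((\<lambda>y. G y t) has_real_derivative Gx x t) (at x within {0..})"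
      unfolding G_def Gx_def J
      by (rule derivative_eq_intros ds' refl)+
         (use c \<eta> in \<open>simp add: inner_i inner_commute algebra_simps\<close>)
    then show ?thesis by (simp add: has_real_derivative_iff_has_vector_derivative)
  qed
  have le: "Qt x t \<le> Gx x t" if "x \<ge> 0" "t \<ge> 1" for x t
  proof -
    have "v x t \<bullet> (vt x t - of_real Am2 * vxxt x t) = A1 * (v x t \<bullet> vx x t) +
       A2 * (v x t \<bullet> (\<i> * vxx x t)) + A3 * (v x t \<bullet> vxxx x t) + v x t \<bullet> F x t"
      unfolding pde[OF that] by (simp add: inner_complex_def algebra_simps)
    moreover have "v x t \<bullet> (of_real Am2 * vxxt x t) = Am2 * (v x t \<bullet> vxxt x t)"
      by (simp add: inner_complex_def algebra_simps)
    ultimately have 1: "v x t \<bullet> vt x t = Am2 * (v x t \<bullet> vxxt x t) + A1 * (v x t \<bullet> vx x t) +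
       A2 * (v x t \<bullet> (\<i> * vxx x t)) + A3 * (v x t \<bullet> vxxx x t) + v x t \<bullet> F x t"
      by (simp add: inner_diff_right)
    have "2 * (v x t \<bullet> F x t) \<le> 2 * (norm (v x t) * norm (F x t))"
      using norm_cauchy_schwarz by auto
    \<comment> \<open>Young's inequality, weighted so that the term in v is just what the factor
      \<open>exp (- (\<eta> * t))\<close> can absorb.\<close>
    also have "\<dots> \<le> \<eta> * (norm (v x t))\<^sup>2 + (norm (F x t))\<^sup>2 / \<eta>"
    proof -
      have "0 \<le> (\<eta> * norm (v x t) - norm (F x t))\<^sup>2 / \<eta>" using \<eta> by simp
      then show ?thesis using \<eta> by (simp add: power2_eq_square field_simps)
    qed
    also have "(norm (F x t))\<^sup>2 / \<eta> \<le> K / \<eta> * exp (- (c * x))"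
      using F[OF that] \<eta> by (simp add: divide_right_mono)
    also have "\<eta> * (norm (v x t))\<^sup>2 \<le> \<eta> * e x t"
      using \<eta> Am2 by (simp add: e_def power2_norm_eq_inner)
    finally have "2 * (v x t \<bullet> F x t) \<le> \<eta> * e x t + K / \<eta> * exp (- (c * x))" by simp
    then show ?thesis unfolding Qt_def Gx_def
      by (intro mult_left_mono) (simp_all add: 1 algebra_simps)
  qed
  have cc: "continuous_on S (\<lambda>z. h (p z) (q z))"
    if "continuous_on ({0..} \<times> {1..}) (\<lambda>z. h (fst z) (snd z))" "continuous_on S p" "continuous_on S q"
      "\<And>z. z \<in> S \<Longrightarrow> p z \<ge> 0" "\<And>z. z \<in> S \<Longrightarrow> q z \<ge> 1"
    for S :: "'z::topological_space set" and p q and h :: "real \<Rightarrow> real \<Rightarrow> complex"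
    using continuous_on_compose2[OF that(1), of S "\<lambda>z. (p z, q z)"] that(2-)
    by (auto intro!: continuous_intros)
  note cont' = cont[THEN cc]
  obtain C1 where C1: "\<And>x. x \<ge> 0 \<Longrightarrow> (1 + x) * norm (v x 1) \<le> C1"
     "\<And>x. x \<ge> 0 \<Longrightarrow> (1 + x) * norm (vx x 1) \<le> C1"
    using decay[of 1] by auto
  have e1: "e x 1 \<le> (1 + Am2) * C1\<^sup>2 * (1 / (1 + x)\<^sup>2)" if "x \<ge> 0" for x
  proof -
    have "(1 + x)\<^sup>2 * (norm (v x 1))\<^sup>2 \<le> C1\<^sup>2" "(1 + x)\<^sup>2 * (norm (vx x 1))\<^sup>2 \<le> C1\<^sup>2"
      unfolding power_mult_distrib[symmetric] using C1[OF that] that by (auto intro!: power_mono)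
    then have "(norm (v x 1))\<^sup>2 \<le> C1\<^sup>2 / (1 + x)\<^sup>2" "(norm (vx x 1))\<^sup>2 \<le> C1\<^sup>2 / (1 + x)\<^sup>2"
      using that by (simp_all add: pos_le_divide_eq mult.commute)
    moreover from this(2) have "Am2 * (norm (vx x 1))\<^sup>2 \<le> Am2 * (C1\<^sup>2 / (1 + x)\<^sup>2)"
      using Am2 by (rule mult_left_mono)
    ultimately show ?thesis
      unfolding e_def power2_norm_eq_inner[symmetric] by (simp add: algebra_simps)
  qed
  define B' where "B' = \<bar>B\<bar> + K / (c * \<eta>)"
  have B': "B' \<ge> 0" using K c \<eta> by (simp add: B'_def)
  \<comment> \<open>A bound for the energy at time 1 plus the total weighted inflow, as the integral
    of \<open>B' * exp (- (\<eta> * t))\<close> over \<open>t \<ge> 1\<close> is at most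
    \<open>B' / \<eta>\<close>.\<close>
  define D where "D = (1 + Am2) * C1\<^sup>2 + B' / \<eta>"
  have main: "integral {0..X} (\<lambda>x. Q x T) \<le> D" if X: "X \<ge> 0" and T: "T \<ge> 1" for X T
  proof -
    obtain C where C: "\<And>t x. t \<in> {1..T} \<Longrightarrow> x \<ge> 0 \<Longrightarrow> (1 + x) * norm (v x t) \<le> C \<and>
       (1 + x) * norm (vx x t) \<le> C \<and> norm (vxx x t) \<le> C \<and> norm (vxt x t) \<le> C"
      using decay[OF T] by blast
    define S where "S = 2 * Am2 + \<bar>A1\<bar> + 2 * \<bar>A2\<bar> + 3 * \<bar>A3\<bar>"
    have JX: "J x t \<le> S * C\<^sup>2 / (1 + x)" if "t \<in> {1..T}" "x \<ge> 0" for x t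
    proof -
      note Ct = C[OF that]
      have C0: "C \<ge> 0" using Ct norm_ge_zero order_trans by blast
      have b: "norm (v x t) \<le> C / (1 + x)" "norm (vx x t) \<le> C / (1 + x)"
        using Ct that by (simp_all add: pos_le_divide_eq mult.commute)
      have "C / (1 + x) \<le> C" using C0 that by (simp add: divide_le_eq mult_le_cancel_left1)
      then have b': "norm (v x t) \<le> C" "norm (vx x t) \<le> C" using b by linarith+
      have prod: "\<bar>p \<bullet> q\<bar> \<le> C\<^sup>2 / (1 + x)" if "norm p \<le> C / (1 + x)" "norm q \<le> C" for p q :: complex
      proof -
        have "\<bar>p \<bullet> q\<bar> \<le> norm p * norm q" by (rule Cauchy_Schwarz_ineq2)
        also have "\<dots> \<le> C / (1 + x) * C" using that C0 \<open>x \<ge> 0\<close> by (intro mult_mono) auto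
        finally show ?thesis by (simp add: power2_eq_square)
      qed
      have sc: "r * p \<le> \<bar>r\<bar> * (C\<^sup>2 / (1 + x))" if "\<bar>p\<bar> \<le> C\<^sup>2 / (1 + x)" for r p :: real
        by (rule order_trans[OF abs_ge_self]) (simp add: abs_mult mult_left_mono that del: times_divide_eq_right)
      have 1: "2 * Am2 * (v x t \<bullet> vxt x t) \<le> \<bar>2 * Am2\<bar> * (C\<^sup>2 / (1 + x))"
        by (rule sc, rule prod) (use b Ct in auto)
      have 2: "A1 * (v x t \<bullet> v x t) \<le> \<bar>A1\<bar> * (C\<^sup>2 / (1 + x))"
        by (rule sc, rule prod) (use b b' in auto)
      have 3: "2 * A2 * (v x t \<bullet> (\<i> * vx x t)) \<le> \<bar>2 * A2\<bar> * (C\<^sup>2 / (1 + x))"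
        by (rule sc, rule prod) (use b b' in \<open>auto simp: norm_mult\<close>)
      have 4: "2 * A3 * (v x t \<bullet> vxx x t) \<le> \<bar>2 * A3\<bar> * (C\<^sup>2 / (1 + x))"
        by (rule sc, rule prod) (use b Ct in auto)
      have 5: "- A3 * (vx x t \<bullet> vx x t) \<le> \<bar>- A3\<bar> * (C\<^sup>2 / (1 + x))"
        by (rule sc, rule prod) (use b b' in auto)
      have "J x t \<le> (\<bar>2 * Am2\<bar> + \<bar>A1\<bar> + \<bar>2 * A2\<bar> + \<bar>2 * A3\<bar> + \<bar>- A3\<bar>) * (C\<^sup>2 / (1 + x))"
        unfolding J distrib_right using 1 2 3 4 5 by linarith
      also have "\<dots> = S * C\<^sup>2 / (1 + x)"
        using Am2 by (simp add: S_def abs_mult add_divide_distrib distrib_right)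
      finally show ?thesis .
    qed
    \<comment> \<open>With T fixed the interval is enlarged to Y, which can only increase the left
      side. Letting Y tend to infinity then removes the flux at Y while X stays put.\<close>
    have "integral {0..X} (\<lambda>x. Q x T) \<le> D + (T - 1) * (S * C\<^sup>2) / (1 + Y)" if Y: "Y \<ge> X" for Y
    proof -
      have Y0: "Y \<ge> 0" using X Y by simp
      have cQ: "continuous_on {0..Y} (\<lambda>x. Q x t)" if "t \<ge> 1" for t
        unfolding Q_def e_def using that by (intro continuous_intros cont') auto
      have cQt: "continuous_on ({0..Y} \<times> {1..T}) (\<lambda>(x, t). Qt x t)"
        unfolding Qt_def e_def split_beta by (intro continuous_intros cont') auto
      have cGx: "continuous_on {0..Y} (\<lambda>x. Gx x t)" if "t \<ge> 1" for t
        unfolding Gx_def using that by (intro continuous_intros cont') auto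
      have cQtx: "continuous_on {0..Y} (\<lambda>x. Qt x t)" if "t \<ge> 1" for t
        unfolding Qt_def e_def using that by (intro continuous_intros cont') auto
      have cG: "continuous_on {1..T} (\<lambda>t. G x t)" if "x \<ge> 0" for x
        unfolding G_def J using that by (intro continuous_intros cont') auto
      have "integral {0..X} (\<lambda>x. Q x T) \<le> integral {0..Y} (\<lambda>x. Q x T)"
        using X Y T e_nonneg
        by (intro integral_subset_le integrable_continuous_real cQ[THEN continuous_on_subset] cQ)
           (auto simp: Q_def)
      also have "integral {0..Y} (\<lambda>x. Q x T) = integral {0..Y} (\<lambda>x. Q x 1) +
          integral {1..T} (\<lambda>t. integral {0..Y} (\<lambda>x. Qt x t))"
      proof -
        have "integral {0..Y} (\<lambda>x. Q x T) - integral {0..Y} (\<lambda>x. Q x 1) =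
          integral {1..T} (\<lambda>t. integral {0..Y} (\<lambda>x. Qt x t))"
        proof (rule integral_time_difference[OF Y0 T _ cQt])
          show "((\<lambda>t. Q x t) has_vector_derivative Qt x t) (at t within {1..T})"
            if "x \<in> {0..Y}" "t \<in> {1..T}" for x t
            using that by (intro Qt) auto
          show "continuous_on {0..Y} (\<lambda>x. Q x t)" if "t \<in> {1..T}" for t
            using that by (intro cQ) auto
        qed
        then show ?thesis by simp
      qed
      also have "integral {0..Y} (\<lambda>x. Q x 1) \<le>
          integral {0..Y} (\<lambda>x. (1 + Am2) * C1\<^sup>2 * (1 / (1 + x)\<^sup>2))"
      proof (intro integral_le integrable_continuous_real cQ)
        show "continuous_on {0..Y} (\<lambda>x. (1 + Am2) * C1\<^sup>2 * (1 / (1 + x)\<^sup>2))"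
          by (intro continuous_intros) auto
        show "Q x 1 \<le> (1 + Am2) * C1\<^sup>2 * (1 / (1 + x)\<^sup>2)" if "x \<in> {0..Y}" for x
        proof -
          have "Q x 1 \<le> 1 * e x 1"
            unfolding Q_def using e_nonneg \<eta> by (intro mult_right_mono) auto
          then show ?thesis using e1[of x] that by simp
        qed
      qed simp
      also have "\<dots> = (1 + Am2) * C1\<^sup>2 * integral {0..Y} (\<lambda>x. 1 / (1 + x)\<^sup>2)"
        by (rule integral_mult_right)
      also have "\<dots> \<le> (1 + Am2) * C1\<^sup>2 * 1"
        using Am2 by (intro mult_left_mono integral_inverse_square_le Y0) auto
      also have "integral {1..T} (\<lambda>t. integral {0..Y} (\<lambda>x. Qt x t)) \<le>
          integral {1..T} (\<lambda>t. S * C\<^sup>2 / (1 + Y) + B' * exp (- (\<eta> * t)))"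
      proof (intro integral_le)
        show "(\<lambda>t. integral {0..Y} (\<lambda>x. Qt x t)) integrable_on {1..T}"
        proof -
          have "continuous_on ({1..T} \<times> cbox 0 Y) (\<lambda>(t, x). Qt x t)"
            unfolding Qt_def e_def split_beta by (intro continuous_intros cont') auto
          from integral_continuous_on_param[OF this] show ?thesis
            by (intro integrable_continuous_real) simp
        qed
        show "(\<lambda>t. S * C\<^sup>2 / (1 + Y) + B' * exp (- (\<eta> * t))) integrable_on {1..T}"
          by (intro integrable_continuous_real continuous_intros)
        show "integral {0..Y} (\<lambda>x. Qt x t) \<le> S * C\<^sup>2 / (1 + Y) + B' * exp (- (\<eta> * t))"
          if t: "t \<in> {1..T}" for t
        proof -
          have S0: "S \<ge> 0" using Am2 by (simp add: S_def)
          have "integral {0..Y} (\<lambda>x. Qt x t) \<le> integral {0..Y} (\<lambda>x. Gx x t)"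
            using t by (intro integral_le integrable_continuous_real cQtx cGx le) auto
          also have "\<dots> = G Y t - G 0 t"
            using t Y0 Gx
            by (intro integral_unique fundamental_theorem_of_calculus)
               (auto intro: has_vector_derivative_within_subset[of _ _ _ "{0..}"])
          finally have 1: "integral {0..Y} (\<lambda>x. Qt x t) \<le> G Y t - G 0 t" .
          have "J Y t - K / (c * \<eta>) * exp (- (c * Y)) \<le> S * C\<^sup>2 / (1 + Y)"
            using JX[OF t Y0] K c \<eta>
            by (smt (verit, best) divide_nonneg_pos exp_ge_zero mult_nonneg_nonneg mult_pos_pos)
          then have "G Y t \<le> exp (- (\<eta> * t)) * (S * C\<^sup>2 / (1 + Y))"
            unfolding G_def by (intro mult_left_mono) auto
          also have "\<dots> \<le> 1 * (S * C\<^sup>2 / (1 + Y))"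
            using \<eta> t S0 Y0 by (intro mult_right_mono) auto
          finally have 2: "G Y t \<le> S * C\<^sup>2 / (1 + Y)" by simp
          have "- (J 0 t - K / (c * \<eta>) * exp (- (c * 0))) \<le> B'"
            using J0[of t] t by (simp add: B'_def)
          then have "exp (- (\<eta> * t)) * - (J 0 t - K / (c * \<eta>) * exp (- (c * 0))) \<le> exp (- (\<eta> * t)) * B'"
            by (intro mult_left_mono) auto
          then have 3: "- G 0 t \<le> B' * exp (- (\<eta> * t))"
            unfolding G_def by (simp add: algebra_simps)
          show ?thesis using 1 2 3 by linarith
        qed
      qed
      also have "\<dots> = (T - 1) * (S * C\<^sup>2) / (1 + Y) + B' * integral {1..T} (\<lambda>t. exp (- (\<eta> * t)))"
        using T by (subst integral_add)
          (auto intro!: integrable_continuous_real continuous_intros)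
      also have "integral {1..T} (\<lambda>t. exp (- (\<eta> * t))) \<le> 1 / \<eta>"
        by (rule order_trans[OF integral_exp_decay_le[OF T \<eta>]])
           (use \<eta> in \<open>simp add: divide_right_mono\<close>)
      finally show ?thesis using B' by (simp add: D_def mult_left_mono)
    qed
    then show ?thesis by (rule le_of_le_add_vanishing)
  qed
  have "integral {0..X} (\<lambda>x. (norm (v x T))\<^sup>2 + Am2 * (norm (vx x T))\<^sup>2) \<le> D * exp (\<eta> * T)"
    if "X \<ge> 0" "T \<ge> 1" for X T
  proof -
    have "integral {0..X} (\<lambda>x. (norm (v x T))\<^sup>2 + Am2 * (norm (vx x T))\<^sup>2) =
       integral {0..X} (\<lambda>x. exp (\<eta> * T) * Q x T)"
      by (rule integral_cong) (simp add: Q_def e_def power2_norm_eq_inner exp_minus)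
    also have "\<dots> = exp (\<eta> * T) * integral {0..X} (\<lambda>x. Q x T)" by (rule integral_mult_right)
    also have "\<dots> \<le> exp (\<eta> * T) * D" by (intro mult_left_mono main that) simp
    finally show ?thesis by (simp add: mult.commute)
  qed
  then show ?thesis by blast
qed

section \<open>The energy estimate in the local and in the nonlocal case\<close>

lemma decaying_uniform:
  assumes "decaying u" "T \<ge> 1"
  shows "\<exists>C\<ge>0. \<forall>m\<le>1. \<forall>j\<le>3. \<forall>t\<in>{1..T}. \<forall>x\<ge>0. (1 + x)\<^sup>2 * norm ((dt ^^ m) ((dx ^^ j) u) x t) \<le> C"
proof -
  have "\<forall>m j. \<exists>C. m \<le> 1 \<longrightarrow> j \<le> 3 \<longrightarrow>
      (\<forall>t\<in>{1..T}. \<forall>x\<ge>0. (1 + x)\<^sup>2 * norm ((dt ^^ m) ((dx ^^ j) u) x t) \<le> C)"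
    using assms unfolding decaying_def by (meson zero_less_one)
  then obtain C where C: "\<And>m j t x. m \<le> 1 \<Longrightarrow> j \<le> 3 \<Longrightarrow> t \<in> {1..T} \<Longrightarrow> x \<ge> 0 \<Longrightarrow>
      (1 + x)\<^sup>2 * norm ((dt ^^ m) ((dx ^^ j) u) x t) \<le> C m j"
    by metis
  define D where "D = (\<Sum>(m, j)\<in>{..1} \<times> {..3}. \<bar>C m j\<bar>)"
  have "(1 + x)\<^sup>2 * norm ((dt ^^ m) ((dx ^^ j) u) x t) \<le> D"
    if "m \<le> 1" "j \<le> 3" "t \<in> {1..T}" "x \<ge> 0" for m j t x
  proof -
    have "\<bar>C m j\<bar> \<le> D"
      unfolding D_def using that
      by (intro member_le_sum[of "(m, j)" _ "\<lambda>(m, j). \<bar>C m j\<bar>", simplified]) auto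
    then show ?thesis using C[OF that] by linarith
  qed
  moreover have "D \<ge> 0" unfolding D_def by (intro sum_nonneg) auto
  ultimately show ?thesis by blast
qed

lemma le_weighted: "(1 + x)\<^sup>2 * a \<le> C \<Longrightarrow> x \<ge> 0 \<Longrightarrow> a \<ge> 0 \<Longrightarrow> (1 + x) * a \<le> (C::real)"
  by (rule order_trans[rotated], assumption, rule mult_right_mono) (simp_all add: power2_eq_square)

lemma le_unweighted: "(1 + x)\<^sup>2 * a \<le> C \<Longrightarrow> x \<ge> 0 \<Longrightarrow> a \<ge> 0 \<Longrightarrow> a \<le> (C::real)"
  using mult_right_mono[of 1 "(1 + x)\<^sup>2" a] by (simp add: one_le_power)

text \<open>With \<open>Am2 = 0\<close> the energy flux at \<open>x = 0\<close> involves only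
  \<open>u\<close>, \<open>dx u\<close> and \<open>dx (dx u)\<close>, which are bounded there, so
  the general estimate applies to u itself with zero forcing.\<close>

lemma energy_growth_local:
  assumes u: "smooth u" and dec: "decaying u" and pde: "satisfies_pde 0 A0 A1 A2 A3 u"
    and bd: "\<And>t j. t \<ge> 1 \<Longrightarrow> j \<le> 2 \<Longrightarrow> norm ((dx ^^ j) u 0 t) \<le> M" and \<eta>: "\<eta> > 0"
  shows "energy_bound 0 u (dx u) \<eta>"
proof -
  note u1 = smooth_dx[OF u] note u2 = smooth_dx[OF u1] note u3 = smooth_dx[OF u2]
  note ut = smooth_dt[OF u] note u1t = smooth_dt[OF u1]
  note u1tx = smooth_dx[OF u1t]
  have J0: "- ((\<bar>A1\<bar> + 2 * \<bar>A2\<bar> + 3 * \<bar>A3\<bar>) * M\<^sup>2) \<le>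
      2 * 0 * (u 0 t \<bullet> dt (dx u) 0 t) + A1 * (u 0 t \<bullet> u 0 t) + 2 * A2 * (u 0 t \<bullet> (\<i> * dx u 0 t)) +
      2 * A3 * (u 0 t \<bullet> dx (dx u) 0 t) - A3 * (dx u 0 t \<bullet> dx u 0 t)" if t: "t \<ge> 1" for t
  proof -
    have n: "norm (u 0 t) \<le> M" "norm (dx u 0 t) \<le> M" "norm (dx (dx u) 0 t) \<le> M"
      using bd[OF t, of 0] bd[OF t, of 1] bd[OF t, of 2] by (simp_all add: numeral_2_eq_2)
    have M: "M \<ge> 0" using n norm_ge_zero order_trans by blast
    have sc: "- (\<bar>r\<bar> * M\<^sup>2) \<le> r * (p \<bullet> q)" if "norm p \<le> M" "norm q \<le> M" for r and p q :: complex
    proof -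
      have "\<bar>p \<bullet> q\<bar> \<le> norm p * norm q" by (rule Cauchy_Schwarz_ineq2)
      also have "\<dots> \<le> M\<^sup>2" unfolding power2_eq_square using that M by (intro mult_mono) auto
      finally have "\<bar>r * (p \<bullet> q)\<bar> \<le> \<bar>r\<bar> * M\<^sup>2" by (simp add: abs_mult mult_left_mono)
      then show ?thesis by linarith
    qed
    have n4: "norm (\<i> * dx u 0 t) \<le> M" using n by (simp add: norm_mult)
    have eq: "(\<bar>A1\<bar> + 2 * \<bar>A2\<bar> + 3 * \<bar>A3\<bar>) * M\<^sup>2 =
        \<bar>A1\<bar> * M\<^sup>2 + \<bar>2 * A2\<bar> * M\<^sup>2 + \<bar>2 * A3\<bar> * M\<^sup>2 + \<bar>- A3\<bar> * M\<^sup>2"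
      by (simp add: abs_mult distrib_right)
    from sc[OF n(1) n(1), of A1] sc[OF n(1) n4, of "2 * A2"] sc[OF n(1) n(3), of "2 * A3"]
      sc[OF n(2) n(2), of "- A3"]
    show ?thesis unfolding eq by linarith
  qed
  show ?thesis
  proof (rule energy_growth[where ?Am2.0 = 0 and v = u and vx = "dx u" and vxx = "dx (dx u)" and vxxx = "dx (dx (dx u))"
        and vt = "dt u" and vxt = "dt (dx u)" and vxxt = "dx (dt (dx u))" and F = "\<lambda>_ _. 0" and K = 0
        and c = 1 and ?A0.0 = A0 and ?A1.0 = A1 and ?A2.0 = A2 and ?A3.0 = A3 and \<eta> = \<eta>])
    show "- ((\<bar>A1\<bar> + 2 * \<bar>A2\<bar> + 3 * \<bar>A3\<bar>) * M\<^sup>2) \<le>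
      2 * 0 * (u 0 t \<bullet> dt (dx u) 0 t) + A1 * (u 0 t \<bullet> u 0 t) + 2 * A2 * (u 0 t \<bullet> (\<i> * dx u 0 t)) +
      2 * A3 * (u 0 t \<bullet> dx (dx u) 0 t) - A3 * (dx u 0 t \<bullet> dx u 0 t)" if t: "t \<ge> 1" for t
      using J0[OF that] .
    show "dt u x t - of_real 0 * dx (dt (dx u)) x t = \<i> * of_real A0 * u x t + of_real A1 * dx u x t +
        \<i> * of_real A2 * dx (dx u) x t + of_real A3 * dx (dx (dx u)) x t + 0"
      if "x \<ge> 0" "t \<ge> 1" for x t
      using pde_all_orders[OF u pde that(1), of t 0] that
      by (simp add: numeral_2_eq_2 numeral_3_eq_3)
    show "\<exists>C. \<forall>t\<in>{1..T}. \<forall>x\<ge>0. (1 + x) * norm (u x t) \<le> C \<and> (1 + x) * norm (dx u x t) \<le> C \<and>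
        norm (dx (dx u) x t) \<le> C \<and> norm (dt (dx u) x t) \<le> C" if T: "T \<ge> 1" for T
    proof -
      obtain C where C: "\<forall>m\<le>1. \<forall>j\<le>3. \<forall>t\<in>{1..T}. \<forall>x\<ge>0. (1 + x)\<^sup>2 * norm ((dt ^^ m) ((dx ^^ j) u) x t) \<le> C"
        using decaying_uniform[OF dec T] by blast
      have "(1 + x) * norm (u x t) \<le> C \<and> (1 + x) * norm (dx u x t) \<le> C \<and>
        norm (dx (dx u) x t) \<le> C \<and> norm (dt (dx u) x t) \<le> C" if "t \<in> {1..T}" "x \<ge> 0" for t x
        using C[rule_format, OF _ _ that, of 0 0] C[rule_format, OF _ _ that, of 0 1] C[rule_format, OF _ _ that, of 0 2]
          C[rule_format, OF _ _ that, of 1 1] that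
        by (auto intro!: le_weighted intro: le_unweighted simp: numeral_2_eq_2)
      then show ?thesis by blast
    qed
  qed (simp_all add: \<eta> smooth_continuous_pair smooth_has_dx smooth_has_dt
      u u1 u2 u3 ut u1t u1tx)
qed

text \<open>Subtracting \<open>u(0,t) exp (- x / sqrt A\<^sub>-\<^sub>2)\<close>, which \<open>1 - A\<^sub>-\<^sub>2 \<partial>\<^sub>x\<^sup>2\<close> annihilates, makes the boundary value zero
  without bringing in the time derivative of \<open>u(0,t)\<close>, which need not be bounded.\<close>

lemma energy_growth_nonlocal:
  assumes u: "smooth u" and dec: "decaying u" and pde: "satisfies_pde Am2 A0 A1 A2 0 u"
    and Am2: "Am2 > 0" and bd: "\<And>t. t \<ge> 1 \<Longrightarrow> norm (u 0 t) \<le> M" and \<eta>: "\<eta> > 0"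
  shows "energy_bound Am2 u (dx u) \<eta>"
proof -
  note u1 = smooth_dx[OF u] note u2 = smooth_dx[OF u1] note u3 = smooth_dx[OF u2]
  note ut = smooth_dt[OF u] note u1t = smooth_dt[OF u1]
  note u1tx = smooth_dx[OF u1t]
  have M: "M \<ge> 0" using bd[of 1] norm_ge_zero order_trans by blast
  define c where "c = 1 / sqrt Am2"
  have c: "c > 0" and c2: "Am2 * c\<^sup>2 = 1" using Am2 by (simp_all add: c_def power_divide)
  define \<phi> where "\<phi> x = exp (- (c * x))" for x
  have \<phi>: "0 \<le> \<phi> x" "x \<ge> 0 \<Longrightarrow> \<phi> x \<le> 1" "x \<ge> 0 \<Longrightarrow> (1 + x) * \<phi> x \<le> 1 + 1 / c" for x
  proof -
    show "0 \<le> \<phi> x" by (simp add: \<phi>_def)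
    show le1: "\<phi> x \<le> 1" if "x \<ge> 0" using that c by (simp add: \<phi>_def)
    have "c * x \<le> exp (c * x)" using exp_ge_add_one_self[of "c * x"] by linarith
    then have "x * \<phi> x \<le> 1 / c" using c by (simp add: \<phi>_def exp_minus field_simps)
    then show "(1 + x) * \<phi> x \<le> 1 + 1 / c" if "x \<ge> 0" using le1[OF that] by (simp add: distrib_right)
  qed
  \<comment> \<open>The index k counts the x-derivatives taken so far, the k-th derivative of
    \<open>\<phi>\<close> being \<open>(- c) ^ k * \<phi> x\<close>; g is the boundary value or its
    time derivative.\<close>
  define sub where "sub w g k = (\<lambda>x t. w x t - of_real ((- c) ^ k * \<phi> x) * g t)"
    for w :: "real \<Rightarrow> real \<Rightarrow> complex" and g :: "real \<Rightarrow> complex" and k :: nat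
  have sub_dx: "((\<lambda>y. sub w g k y t) has_vector_derivative sub (dx w) g k' x t) (at x within {0..})"
    if "smooth w" "k' = Suc k" "x \<ge> 0" "t \<ge> 1" for w g k k' x t
    using that unfolding sub_def \<phi>_def
    by (auto intro!: derivative_eq_intros smooth_has_dx[OF that(1)]
        simp: has_real_derivative_iff_has_vector_derivative[symmetric])
  have sub_dt: "((\<lambda>s. sub w (u 0) k x s) has_vector_derivative sub (dt w) (dt u 0) k x t) (at t)"
    if "smooth w" "x \<ge> 0" "t \<ge> 1" for w k x t
    using that unfolding sub_def
    by (auto intro!: derivative_eq_intros smooth_has_dt[OF that(1)] smooth_has_dt[OF u])
  have sub_cont: "continuous_on ({0..} \<times> {1..}) (\<lambda>z. sub w (w' 0) k (fst z) (snd z))"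
    if "smooth w" "smooth w'" for w w' k
    unfolding sub_def \<phi>_def
    by (intro continuous_intros smooth_continuous_pair that
        smooth_continuous_compose[OF that(2)]) auto
  \<comment> \<open>The right-hand side of the equation with each x-derivative replaced by
    \<open>- c\<close>. Since the left-hand side annihilates \<open>\<phi>\<close>, \<open>F\<close>
    is the whole error made by the subtraction.\<close>
  define \<kappa> where "\<kappa> = \<i> * of_real A0 - of_real (c * A1) + \<i> * of_real (c\<^sup>2 * A2)"
  define F where "F x t = of_real (\<phi> x) * u 0 t * \<kappa>" for x t
  have "\<exists>C. \<forall>X\<ge>0. \<forall>T\<ge>1. integral {0..X} (\<lambda>x. (norm (sub u (u 0) 0 x T))\<^sup>2 +
          Am2 * (norm (sub (dx u) (u 0) 1 x T))\<^sup>2) \<le> C * exp (\<eta> * T)"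
  proof (rule energy_growth[where ?Am2.0 = Am2 and v = "sub u (u 0) 0" and vx = "sub (dx u) (u 0) 1"
        and vxx = "sub (dx (dx u)) (u 0) 2" and vxxx = "sub (dx (dx (dx u))) (u 0) 3"
        and vt = "sub (dt u) (dt u 0) 0" and vxt = "sub (dt (dx u)) (dt u 0) 1"
        and vxxt = "sub (dx (dt (dx u))) (dt u 0) 2" and F = F and K = "(M * norm \<kappa>)\<^sup>2"
        and c = "2 * c" and B = 0 and ?A0.0 = A0 and ?A1.0 = A1 and ?A2.0 = A2 and ?A3.0 = 0 and \<eta> = \<eta>])
    show "sub (dt u) (dt u 0) 0 x t - of_real Am2 * sub (dx (dt (dx u))) (dt u 0) 2 x t =
       \<i> * of_real A0 * sub u (u 0) 0 x t + of_real A1 * sub (dx u) (u 0) 1 x t +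
       \<i> * of_real A2 * sub (dx (dx u)) (u 0) 2 x t + of_real 0 * sub (dx (dx (dx u))) (u 0) 3 x t + F x t"
      if "x \<ge> 0" "t \<ge> 1" for x t
    proof -
      have e: "dt u x t - of_real Am2 * dt (dx (dx u)) x t =
        \<i> * of_real A0 * u x t + of_real A1 * dx u x t + \<i> * of_real A2 * dx (dx u) x t"
        using pde_all_orders[OF u pde that(1), of t 0] that by (simp add: numeral_2_eq_2)
      have "dx (dt (dx u)) x t = dt (dx (dx u)) x t"
        using dx_dt_commute[OF u1 that(1)] that by simp
      then have "sub (dt u) (dt u 0) 0 x t - of_real Am2 * sub (dx (dt (dx u))) (dt u 0) 2 x t =
          (dt u x t - of_real Am2 * dt (dx (dx u)) x t) - of_real (\<phi> x) * dt u 0 t * (1 - of_real (Am2 * c\<^sup>2))"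
        by (simp add: sub_def algebra_simps)
      also have "\<dots> = \<i> * of_real A0 * u x t + of_real A1 * dx u x t + \<i> * of_real A2 * dx (dx u) x t"
        unfolding e c2 by simp
      finally show ?thesis by (simp add: sub_def F_def \<kappa>_def algebra_simps)
    qed
    show "\<exists>C. \<forall>t\<in>{1..T}. \<forall>x\<ge>0. (1 + x) * norm (sub u (u 0) 0 x t) \<le> C \<and>
        (1 + x) * norm (sub (dx u) (u 0) 1 x t) \<le> C \<and> norm (sub (dx (dx u)) (u 0) 2 x t) \<le> C \<and>
        norm (sub (dt (dx u)) (dt u 0) 1 x t) \<le> C" if T: "T \<ge> 1" for T
    proof -
      obtain C where C0: "C \<ge> 0" and C: "\<forall>m\<le>1. \<forall>j\<le>3. \<forall>t\<in>{1..T}. \<forall>x\<ge>0. (1 + x)\<^sup>2 * norm ((dt ^^ m) ((dx ^^ j) u) x t) \<le> C"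
        using decaying_uniform[OF dec T] by blast
      define L where "L = C + (1 + c)\<^sup>2 * ((1 + 1 / c) * C)"
      have key: "(1 + x) * norm (sub w g k x t) \<le> L"
        if "(1 + x) * norm (w x t) \<le> C" "norm (g t) \<le> C" "x \<ge> 0" "k \<le> 2" for w g k x t
      proof -
        have ck: "c ^ k \<le> (1 + c)\<^sup>2"
          by (rule order_trans[OF power_mono[of c "1 + c" k] power_increasing]) (use that c in auto)
        have "(1 + x) * norm (sub w g k x t) \<le>
            (1 + x) * (norm (w x t) + norm (of_real ((- c) ^ k * \<phi> x) * g t))"
          unfolding sub_def using that by (intro mult_left_mono norm_triangle_ineq4) auto
        also have "\<dots> = (1 + x) * norm (w x t) + c ^ k * (((1 + x) * \<phi> x) * norm (g t))"
          using c \<phi>(1)[of x] by (simp add: norm_mult norm_power power_abs algebra_simps)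
        also have "c ^ k * (((1 + x) * \<phi> x) * norm (g t)) \<le> (1 + c)\<^sup>2 * ((1 + 1 / c) * C)"
          using that c \<phi>(1)[of x] \<phi>(3)[of x] by (intro mult_mono ck) auto
        finally show ?thesis using that by (simp add: L_def)
      qed
      have key': "norm (sub w g k x t) \<le> L"
        if "(1 + x) * norm (w x t) \<le> C" "norm (g t) \<le> C" "x \<ge> 0" "k \<le> 2" for w g k x t
      proof -
        have "1 * norm (sub w g k x t) \<le> (1 + x) * norm (sub w g k x t)"
          using that by (intro mult_right_mono) auto
        then show ?thesis using key[of x w t g k, OF that] by simp
      qed
      have "(1 + x) * norm (sub u (u 0) 0 x t) \<le> L \<and>
        (1 + x) * norm (sub (dx u) (u 0) 1 x t) \<le> L \<and> norm (sub (dx (dx u)) (u 0) 2 x t) \<le> L \<and>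
        norm (sub (dt (dx u)) (dt u 0) 1 x t) \<le> L" if "t \<in> {1..T}" "x \<ge> 0" for t x
      proof -
        have w: "(1 + x) * norm (u x t) \<le> C" "(1 + x) * norm (dx u x t) \<le> C"
          "(1 + x) * norm (dx (dx u) x t) \<le> C" "(1 + x) * norm (dt (dx u) x t) \<le> C"
          using C[rule_format, OF _ _ that, of 0 0] C[rule_format, OF _ _ that, of 0 1] C[rule_format, OF _ _ that, of 0 2]
          C[rule_format, OF _ _ that, of 1 1] that
          by (auto intro!: le_weighted simp: numeral_2_eq_2)
        have "norm (u 0 t) \<le> C" "norm (dt u 0 t) \<le> C"
          using C[rule_format, of 0 0 t 0] C[rule_format, of 1 0 t 0] that by auto
        with w that show ?thesis by (intro conjI key key') auto
      qed
      then show ?thesis by blast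
    qed
    show "(norm (F x t))\<^sup>2 \<le> (M * norm \<kappa>)\<^sup>2 * exp (- (2 * c * x))" if "x \<ge> 0" "t \<ge> 1" for x t
    proof -
      have "(norm (F x t))\<^sup>2 = (norm (u 0 t) * norm \<kappa>)\<^sup>2 * (\<phi> x)\<^sup>2"
        using \<phi>(1)[of x] by (simp add: F_def norm_mult power_mult_distrib)
      also have "\<dots> \<le> (M * norm \<kappa>)\<^sup>2 * (\<phi> x)\<^sup>2"
        using bd[OF that(2)] by (intro mult_right_mono power_mono) auto
      also have "(\<phi> x)\<^sup>2 = exp (- (2 * c * x))"
        by (simp add: \<phi>_def power2_eq_square flip: exp_add)
      finally show ?thesis .
    qed
    show "- 0 \<le> 2 * Am2 * (sub u (u 0) 0 0 t \<bullet> sub (dt (dx u)) (dt u 0) 1 0 t) +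
       A1 * (sub u (u 0) 0 0 t \<bullet> sub u (u 0) 0 0 t) +
       2 * A2 * (sub u (u 0) 0 0 t \<bullet> (\<i> * sub (dx u) (u 0) 1 0 t)) +
       2 * 0 * (sub u (u 0) 0 0 t \<bullet> sub (dx (dx u)) (u 0) 2 0 t) -
       0 * (sub (dx u) (u 0) 1 0 t \<bullet> sub (dx u) (u 0) 1 0 t)" for t
      by (simp add: sub_def \<phi>_def)
    show "((\<lambda>y. sub (u) (u 0) 0 y t) has_vector_derivative sub (dx (u)) (u 0) 1 x t) (at x within {0..})"
      if "x \<ge> 0" "t \<ge> 1" for x t
      by (rule sub_dx[OF u]) (use that in simp_all)
    show "((\<lambda>y. sub (dx u) (u 0) 1 y t) has_vector_derivative sub (dx (dx u)) (u 0) 2 x t) (at x within {0..})"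
      if "x \<ge> 0" "t \<ge> 1" for x t
      by (rule sub_dx[OF u1]) (use that in simp_all)
    show "((\<lambda>y. sub (dx (dx u)) (u 0) 2 y t) has_vector_derivative sub (dx (dx (dx u))) (u 0) 3 x t) (at x within {0..})"
      if "x \<ge> 0" "t \<ge> 1" for x t
      by (rule sub_dx[OF u2]) (use that in simp_all)
    show "((\<lambda>y. sub (dt (dx u)) (dt u 0) 1 y t) has_vector_derivative sub (dx (dt (dx u))) (dt u 0) 2 x t) (at x within {0..})"
      if "x \<ge> 0" "t \<ge> 1" for x t
      by (rule sub_dx[OF u1t]) (use that in simp_all)
    show "((\<lambda>s. sub (u) (u 0) 0 x s) has_vector_derivative sub (dt (u)) (dt u 0) 0 x t) (at t)"
      if "x \<ge> 0" "t \<ge> 1" for x t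
      by (rule sub_dt[OF u]) (use that in simp_all)
    show "((\<lambda>s. sub (dx u) (u 0) 1 x s) has_vector_derivative sub (dt (dx u)) (dt u 0) 1 x t) (at t)"
      if "x \<ge> 0" "t \<ge> 1" for x t
      by (rule sub_dt[OF u1]) (use that in simp_all)
  qed (use Am2 c \<eta> in \<open>simp_all add: sub_cont[OF u u] sub_cont[OF u1 u] sub_cont[OF u2 u]
      sub_cont[OF u3 u] sub_cont[OF ut ut] sub_cont[OF u1t ut] sub_cont[OF u1tx ut]\<close>)
  then obtain C where C: "\<And>X T. X \<ge> 0 \<Longrightarrow> T \<ge> 1 \<Longrightarrow> integral {0..X} (\<lambda>x. (norm (sub u (u 0) 0 x T))\<^sup>2 +
          Am2 * (norm (sub (dx u) (u 0) 1 x T))\<^sup>2) \<le> C * exp (\<eta> * T)" by blast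
  have "integral {0..X} (\<lambda>x. (norm (u x T))\<^sup>2 + Am2 * (norm (dx u x T))\<^sup>2) \<le>
     (2 * C + 2 * M\<^sup>2 / c) * exp (\<eta> * T)" if X: "X \<ge> 0" and T: "T \<ge> 1" for X T
  proof -
    \<comment> \<open>For undoing the subtraction. The removed exponential has bounded energy,
      because \<open>Am2 * c\<^sup>2 = 1\<close> and the integral of
      \<open>exp (- (2 * c * x))\<close> is at most \<open>1 / (2 * c)\<close>.\<close>
    have sq: "(norm p)\<^sup>2 \<le> 2 * (norm (p - q))\<^sup>2 + 2 * (norm q)\<^sup>2" for p q :: complex
    proof -
      have "norm p \<le> norm (p - q) + norm q" by (metis diff_add_cancel norm_triangle_ineq)
      then have "(norm p)\<^sup>2 \<le> (norm (p - q) + norm q)\<^sup>2" by (intro power_mono) auto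
      also have "\<dots> \<le> 2 * (norm (p - q))\<^sup>2 + 2 * (norm q)\<^sup>2"
        using sum_squares_bound[of "norm (p - q)" "norm q"] by (simp add: power2_sum)
      finally show ?thesis .
    qed
    have cont: "continuous_on {0..X} (\<lambda>x. u x T)" "continuous_on {0..X} (\<lambda>x. dx u x T)"
      "continuous_on {0..X} (\<lambda>x. sub u (u 0) 0 x T)" "continuous_on {0..X} (\<lambda>x. sub (dx u) (u 0) 1 x T)"
      unfolding sub_def \<phi>_def using T
      by (auto intro!: continuous_intros smooth_continuous_compose[OF u] smooth_continuous_compose[OF u1])
    have "integral {0..X} (\<lambda>x. (norm (u x T))\<^sup>2 + Am2 * (norm (dx u x T))\<^sup>2) \<le>
      integral {0..X} (\<lambda>x. 2 * ((norm (sub u (u 0) 0 x T))\<^sup>2 +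
          Am2 * (norm (sub (dx u) (u 0) 1 x T))\<^sup>2) + 4 * M\<^sup>2 * exp (- (2 * c * x)))"
    proof (intro integral_le integrable_continuous_real continuous_intros cont)
      fix x assume x: "x \<in> {0..X}"
      have e: "exp (- (2 * c * x)) = (\<phi> x)\<^sup>2"
        by (simp add: \<phi>_def power2_eq_square flip: exp_add)
      have g: "(norm (u 0 T))\<^sup>2 \<le> M\<^sup>2" using bd[OF T] by (intro power_mono) auto
      have "(norm (u x T))\<^sup>2 \<le> 2 * (norm (sub u (u 0) 0 x T))\<^sup>2 + 2 * ((\<phi> x)\<^sup>2 * (norm (u 0 T))\<^sup>2)"
        using sq[of "u x T" "of_real (\<phi> x) * u 0 T"] by (simp add: sub_def norm_mult power_mult_distrib)
      also have "2 * ((\<phi> x)\<^sup>2 * (norm (u 0 T))\<^sup>2) \<le> 2 * ((\<phi> x)\<^sup>2 * M\<^sup>2)"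
        using g by (intro mult_left_mono) auto
      finally have 1: "(norm (u x T))\<^sup>2 \<le> 2 * (norm (sub u (u 0) 0 x T))\<^sup>2 + 2 * ((\<phi> x)\<^sup>2 * M\<^sup>2)"
        by simp
      have "(norm (dx u x T))\<^sup>2 \<le> 2 * (norm (sub (dx u) (u 0) 1 x T))\<^sup>2 + 2 * (c\<^sup>2 * (\<phi> x)\<^sup>2 * (norm (u 0 T))\<^sup>2)"
        using sq[of "dx u x T" "of_real (- c * \<phi> x) * u 0 T"] by (simp add: sub_def norm_mult power_mult_distrib)
      also have "2 * (c\<^sup>2 * (\<phi> x)\<^sup>2 * (norm (u 0 T))\<^sup>2) \<le> 2 * (c\<^sup>2 * (\<phi> x)\<^sup>2 * M\<^sup>2)"
        using g by (intro mult_left_mono) auto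
      finally have "Am2 * (norm (dx u x T))\<^sup>2 \<le>
          Am2 * (2 * (norm (sub (dx u) (u 0) 1 x T))\<^sup>2 + 2 * (c\<^sup>2 * (\<phi> x)\<^sup>2 * M\<^sup>2))"
        using Am2 by (intro mult_left_mono) auto
      also have "\<dots> = 2 * (Am2 * (norm (sub (dx u) (u 0) 1 x T))\<^sup>2) + 2 * ((Am2 * c\<^sup>2) * (\<phi> x)\<^sup>2 * M\<^sup>2)"
        by (simp add: algebra_simps)
      finally show "(norm (u x T))\<^sup>2 + Am2 * (norm (dx u x T))\<^sup>2 \<le> 2 * ((norm (sub u (u 0) 0 x T))\<^sup>2 +
          Am2 * (norm (sub (dx u) (u 0) 1 x T))\<^sup>2) + 4 * M\<^sup>2 * exp (- (2 * c * x))"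
        using 1 unfolding c2 e by (simp add: algebra_simps)
    qed
    also have "\<dots> = 2 * integral {0..X} (\<lambda>x. (norm (sub u (u 0) 0 x T))\<^sup>2 +
          Am2 * (norm (sub (dx u) (u 0) 1 x T))\<^sup>2) + 4 * M\<^sup>2 * integral {0..X} (\<lambda>x. exp (- (2 * c * x)))"
      unfolding integral_mult_right[symmetric]
      by (intro integral_add integrable_continuous_real continuous_intros cont)
    also have "\<dots> \<le> 2 * (C * exp (\<eta> * T)) + 4 * M\<^sup>2 * (1 / (2 * c))"
      using C[OF X T] integral_exp_decay_le[of 0 X "2 * c"] X c
      by (intro add_mono mult_left_mono) auto
    also have "4 * M\<^sup>2 * (1 / (2 * c)) = 2 * M\<^sup>2 / c * 1" by simp
    also have "\<dots> \<le> 2 * M\<^sup>2 / c * exp (\<eta> * T)"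
      using \<eta> T c by (intro mult_left_mono) auto
    finally show ?thesis by (simp add: algebra_simps)
  qed
  then show ?thesis by blast
qed

section \<open>The global relation\<close>

text \<open>Applied to \<open>u, u\<^sub>x, u\<^sub>x\<^sub>x\<close> this is the quotient of the operator
  \<open>A\<^sub>3 \<partial>\<^sub>x\<^sup>3 + \<i> (A\<^sub>2 - \<i> s A\<^sub>-\<^sub>2) \<partial>\<^sub>x\<^sup>2 + A\<^sub>1 \<partial>\<^sub>x + (\<i> A\<^sub>0 - s)\<close>, obtained from the equation by \<open>\<partial>\<^sub>t = s\<close>, by \<open>\<partial>\<^sub>x - \<i> k\<close>.\<close>

definition flux :: "real \<Rightarrow> real \<Rightarrow> real \<Rightarrow> real \<Rightarrow> complex \<Rightarrow> complex \<Rightarrow> complex \<Rightarrow> complex \<Rightarrow> complex \<Rightarrow> complex" where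
  "flux Am2 A1 A2 A3 k s w0 w1 w2 =
     of_real A3 * w2 + \<i> * (of_real A2 - \<i> * s * of_real Am2 + of_real A3 * k) * w1 +
     (of_real A1 - (of_real A2 - \<i> * s * of_real Am2) * k - of_real A3 * k\<^sup>2) * w0"

abbreviation flux_at where
  "flux_at Am2 A1 A2 A3 k s u x t \<equiv> flux Am2 A1 A2 A3 k s (u x t) (dx u x t) (dx (dx u) x t)"

text \<open>Taking \<open>u - A\<^sub>-\<^sub>2 u\<^sub>x\<^sub>x\<close> rather than \<open>(1 + A\<^sub>-\<^sub>2 k\<^sup>2) u\<close> in the density keeps time derivatives of the boundary values,
  about which nothing is assumed, out of the flux.\<close>

lemma global_relation:
  assumes u: "smooth u" and pde: "satisfies_pde Am2 A0 A1 A2 A3 u"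
    and disp: "s * (1 + of_real Am2 * k\<^sup>2) =
      - \<i> * (symbol A0 A1 A2 A3 k)"
    and X: "X \<ge> 0" and T: "T \<ge> 1"
  shows "integral {0..X} (\<lambda>x. exp (- \<i> * k * of_real x - s * of_real T) * (u x T - of_real Am2 * dx (dx u) x T)) -
      integral {0..X} (\<lambda>x. exp (- \<i> * k * of_real x - s * of_real 1) * (u x 1 - of_real Am2 * dx (dx u) x 1)) =
    integral {1..T} (\<lambda>t. exp (- \<i> * k * of_real X - s * of_real t) *
        flux_at Am2 A1 A2 A3 k s u X t) -
    integral {1..T} (\<lambda>t. exp (- s * of_real t) *
        flux_at Am2 A1 A2 A3 k s u 0 t)"
proof -
  note u1 = smooth_dx[OF u] note u2 = smooth_dx[OF u1] note u3 = smooth_dx[OF u2]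
  note ut = smooth_dt[OF u] note u2t = smooth_dt[OF u2]
  note cont = smooth_continuous_compose[OF u] smooth_continuous_compose[OF u1]
    smooth_continuous_compose[OF u2] smooth_continuous_compose[OF u3]
    smooth_continuous_compose[OF ut] smooth_continuous_compose[OF u2t]
  define E where "E x t = exp (- \<i> * k * of_real x - s * of_real t)" for x t :: real
  define Q where "Q x t = E x t * (u x t - of_real Am2 * dx (dx u) x t)" for x t
  define Qt where "Qt x t = E x t * (dt u x t - of_real Am2 * dt (dx (dx u)) x t
     - s * (u x t - of_real Am2 * dx (dx u) x t))" for x t
  define J where "J x t = E x t * flux_at Am2 A1 A2 A3 k s u x t" for x t
  have Et: "((\<lambda>s. E x s) has_vector_derivative - s * E x t) (at t)" for x t
    unfolding E_def by (rule has_vector_derivative_real_field) (auto intro!: derivative_eq_intros)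
  have Ex: "((\<lambda>y. E y t) has_vector_derivative - \<i> * k * E x t) (at x)" for x t
    unfolding E_def by (rule has_vector_derivative_real_field) (auto intro!: derivative_eq_intros)
  have cE: "continuous_on S (\<lambda>z. E (f z) (g z))" if "continuous_on S f" "continuous_on S g"
    for S :: "'z::topological_space set" and f g
    unfolding E_def using that by (intro continuous_intros)
  have Qt: "((\<lambda>t. Q x t) has_vector_derivative Qt x t) (at t within S)" if "x \<ge> 0" "t \<ge> 1" for x t S
  proof -
    have "((\<lambda>t. Q x t) has_vector_derivative
        E x t * (dt u x t - of_real Am2 * dt (dx (dx u)) x t) +
        - s * E x t * (u x t - of_real Am2 * dx (dx u) x t)) (at t)"
      unfolding Q_def using that
      by (intro has_vector_derivative_mult Et derivative_intros smooth_has_dt[OF u]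
          smooth_has_dt[OF u2]) auto
    then show ?thesis
      unfolding Qt_def by (simp add: algebra_simps has_vector_derivative_at_within)
  qed
  have Jx: "((\<lambda>y. J y t) has_vector_derivative Qt x t) (at x within {0..})" if xt: "x \<ge> 0" "t \<ge> 1" for x t
  proof -
    have d: "((\<lambda>y. J y t) has_vector_derivative
        E x t * flux Am2 A1 A2 A3 k s (dx u x t) (dx (dx u) x t) (dx (dx (dx u)) x t) +
        - \<i> * k * E x t * flux_at Am2 A1 A2 A3 k s u x t) (at x within {0..})"
      unfolding J_def flux_def using that
      by (intro has_vector_derivative_mult Ex[THEN has_vector_derivative_at_within] derivative_intros
          smooth_has_dx[OF u] smooth_has_dx[OF u1] smooth_has_dx[OF u2]) auto
    have pde': "dt u x t - of_real Am2 * dt (dx (dx u)) x t =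
        \<i> * of_real A0 * u x t + of_real A1 * dx u x t + \<i> * of_real A2 * dx (dx u) x t
        + of_real A3 * dx (dx (dx u)) x t"
      using pde_all_orders[OF u pde xt(1), of t 0] xt by (simp add: numeral_2_eq_2 numeral_3_eq_3)
    let ?B1 = "flux Am2 A1 A2 A3 k s (dx u x t) (dx (dx u) x t) (dx (dx (dx u)) x t)"
    let ?B0 = "flux_at Am2 A1 A2 A3 k s u x t"
    let ?L = "dt u x t - of_real Am2 * dt (dx (dx u)) x t - s * (u x t - of_real Am2 * dx (dx u) x t)"
    have "?B1 + - \<i> * k * ?B0 =
        (dt u x t - of_real Am2 * dt (dx (dx u)) x t - s * (u x t - of_real Am2 * dx (dx u) x t)) +
        (s * (1 + of_real Am2 * k\<^sup>2) +
          \<i> * (symbol A0 A1 A2 A3 k)) * u x t"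
      unfolding pde' flux_def
      by (simp add: algebra_simps power2_eq_square power3_eq_cube)
    then have eq: "?B1 + - \<i> * k * ?B0 = ?L"
      unfolding disp by simp
    have "E x t * ?B1 + - \<i> * k * E x t * ?B0 = E x t * (?B1 + - \<i> * k * ?B0)"
      by (simp add: algebra_simps)
    also have "\<dots> = Qt x t" unfolding eq Qt_def ..
    finally show ?thesis using d by simp
  qed
  have "integral {0..X} (\<lambda>x. Q x T) - integral {0..X} (\<lambda>x. Q x 1) =
      integral {1..T} (\<lambda>t. integral {0..X} (\<lambda>x. Qt x t))"
  proof (rule integral_time_difference[OF X T])
    show "((\<lambda>t. Q x t) has_vector_derivative Qt x t) (at t within {1..T})"
      if "x \<in> {0..X}" "t \<in> {1..T}" for x t using that by (intro Qt) auto
    show "continuous_on ({0..X} \<times> {1..T}) (\<lambda>(x, t). Qt x t)"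
      unfolding Qt_def split_beta by (intro continuous_intros cont cE) auto
    show "continuous_on {0..X} (\<lambda>x. Q x t)" if "t \<in> {1..T}" for t
      unfolding Q_def using that by (intro continuous_intros cont cE) auto
  qed
  also have "\<dots> = integral {1..T} (\<lambda>t. J X t - J 0 t)"
  proof (rule integral_cong, rule integral_unique, rule fundamental_theorem_of_calculus)
    show "((\<lambda>y. J y t) has_vector_derivative Qt x t) (at x within {0..X})"
      if "t \<in> {1..T}" "x \<in> {0..X}" for t x
      by (rule has_vector_derivative_within_subset[OF Jx]) (use that in auto)
  qed (rule X)
  also have "\<dots> = integral {1..T} (\<lambda>t. J X t) - integral {1..T} (\<lambda>t. J 0 t)"
    unfolding J_def flux_def using X
    by (intro integral_diff integrable_continuous_real continuous_intros cont cE) auto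
  finally show ?thesis unfolding Q_def J_def E_def by simp
qed

lemma norm_flux_le:
  "norm (flux Am2 A1 A2 A3 k s w0 w1 w2) \<le> \<bar>A3\<bar> * norm w2 +
     norm (of_real A2 - \<i> * s * of_real Am2 + of_real A3 * k) * norm w1 +
     norm (of_real A1 - (of_real A2 - \<i> * s * of_real Am2) * k - of_real A3 * k\<^sup>2) * norm w0"
  unfolding flux_def
  by (rule order_trans[OF norm_triangle_ineq] add_mono)+ (simp_all add: norm_mult)

text \<open>The order of the quantifiers is the point: M bounds the density at time 1 and serves all
  k and s, while K and r may depend on them because they disappear as T tends to infinity. Letting X
  tend to infinity in the global relation leaves the boundary flux and the densities at times 1 and
  T; the last one decays because the energy grows more slowly than
  \<open>exp (Re s * T)\<close>.\<close>

lemma boundary_transform_bound: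
  assumes u: "smooth u" and dec: "decaying u" and pde: "satisfies_pde Am2 A0 A1 A2 A3 u"
    and Am2: "Am2 \<ge> 0"
    and energy: "\<And>\<eta>. \<eta> > 0 \<Longrightarrow> energy_bound Am2 u (dx u) \<eta>"
    and bd: "\<And>t. t \<ge> 1 \<Longrightarrow> norm (dx u 0 t) \<le> G"
  shows "\<exists>M. \<forall>k s. Im k < 0 \<longrightarrow> Re s > 0 \<longrightarrow>
     s * (1 + of_real Am2 * k\<^sup>2) = - \<i> * (symbol A0 A1 A2 A3 k) \<longrightarrow>
     (\<exists>K. \<exists>r>0. \<forall>T\<ge>1. norm (integral {1..T} (\<lambda>t. exp (- s * of_real t) *
        flux_at Am2 A1 A2 A3 k s u 0 t)) \<le> M + K * exp (- (r * T)))"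
proof -
  note u1 = smooth_dx[OF u] note u2 = smooth_dx[OF u1]
  note cont = smooth_continuous_compose[OF u] smooth_continuous_compose[OF u1]
    smooth_continuous_compose[OF u2]
  have bounds: "\<exists>C\<ge>0. \<forall>t\<in>{1..T}. \<forall>x\<ge>0. (1 + x)\<^sup>2 * norm (u x t) \<le> C \<and> (1 + x)\<^sup>2 * norm (dx u x t) \<le> C \<and>
      (1 + x)\<^sup>2 * norm (dx (dx u) x t) \<le> C" if T: "T \<ge> 1" for T
  proof -
    obtain C where C0: "C \<ge> 0" and C: "\<forall>m\<le>1. \<forall>j\<le>3. \<forall>t\<in>{1..T}. \<forall>x\<ge>0. (1 + x)\<^sup>2 * norm ((dt ^^ m) ((dx ^^ j) u) x t) \<le> C"
      using decaying_uniform[OF dec T] by blast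
    have "(1 + x)\<^sup>2 * norm (u x t) \<le> C \<and> (1 + x)\<^sup>2 * norm (dx u x t) \<le> C \<and>
      (1 + x)\<^sup>2 * norm (dx (dx u) x t) \<le> C" if "t \<in> {1..T}" "x \<ge> 0" for t x
      using C[rule_format, OF _ _ that, of 0 0] C[rule_format, OF _ _ that, of 0 1] C[rule_format, OF _ _ that, of 0 2]
      by (simp add: numeral_2_eq_2)
    with C0 show ?thesis by blast
  qed
  obtain C1 where C1: "\<forall>x\<ge>0. (1 + x)\<^sup>2 * norm (u x 1) \<le> C1 \<and> (1 + x)\<^sup>2 * norm (dx (dx u) x 1) \<le> C1" and C1_0: "C1 \<ge> 0"
    using bounds[of 1] by auto
  define M where "M = (1 + Am2) * C1"
  have G: "G \<ge> 0" using bd[of 1] norm_ge_zero order_trans by blast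
  have "\<exists>K. \<exists>r>0. \<forall>T\<ge>1. norm (integral {1..T} (\<lambda>t. exp (- s * of_real t) *
        flux_at Am2 A1 A2 A3 k s u 0 t)) \<le> M + K * exp (- (r * T))"
    if k: "Im k < 0" and s: "Re s > 0"
      and disp: "s * (1 + of_real Am2 * k\<^sup>2) =
        - \<i> * (symbol A0 A1 A2 A3 k)" for k s
  proof -
    \<comment> \<open>Half of \<open>Re s\<close> is spent on the growth of the energy, the other
      half remains as decay in T.\<close>
    define \<eta> where "\<eta> = Re s / 2"
    define y where "y = - Im k"
    have \<eta>: "\<eta> > 0" "Re s = \<eta> + \<eta>" and y: "y > 0" "Im k = - y" using s k by (auto simp: \<eta>_def y_def)
    obtain C where C: "\<forall>X\<ge>0. \<forall>T\<ge>1.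
      integral {0..X} (\<lambda>x. (norm (u x T))\<^sup>2 + Am2 * (norm (dx u x T))\<^sup>2) \<le> C * exp (\<eta> * T)"
      using energy[OF \<eta>(1)] by blast
    define K where "K = (1 + Am2 * (norm k)\<^sup>2) / (4 * y) + \<bar>C\<bar> / 2 + Am2 * G"
    define e where "e x = exp (- \<i> * k * of_real x)" for x :: real
    have norm_e: "norm (e x) = exp (- (y * x))" for x
      by (simp add: e_def y)
    have e_le: "norm (e x) \<le> 1" if "x \<ge> 0" for x
      unfolding norm_e using y that by simp
    have ce: "continuous_on S e" for S unfolding e_def by (intro continuous_intros)
    have E: "exp (- \<i> * k * of_real x - s * of_real t) = exp (- s * of_real t) * e x" for x t :: real
      unfolding e_def exp_add[symmetric] by (rule arg_cong[of _ _ exp]) simp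
    define I where "I X t = integral {0..X} (\<lambda>x. exp (- \<i> * k * of_real x - s * of_real t) *
       (u x t - of_real Am2 * dx (dx u) x t))" for X t :: real
    have I1: "norm (I X 1) \<le> M" if X: "X \<ge> 0" for X
    proof -
      have "norm (I X 1) \<le> integral {0..X} (\<lambda>x. M * (1 / (1 + x)\<^sup>2))"
        unfolding I_def
      proof (intro integral_norm_bound_integral integrable_continuous_real)
        show "continuous_on {0..X} (\<lambda>x. exp (- \<i> * k * of_real x - s * of_real 1) *
          (u x 1 - of_real Am2 * dx (dx u) x 1))" by (intro continuous_intros cont) auto
        show "continuous_on {0..X} (\<lambda>x. M * (1 / (1 + x)\<^sup>2))" by (intro continuous_intros) auto
        fix x assume x: "x \<in> {0..X}"
        have "norm (exp (- \<i> * k * of_real x - s * of_real 1)) \<le> 1"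
        proof -
          have "0 \<le> y * x" using x y by simp
          then have "- (y * x) \<le> Re s" using s by linarith
          then show ?thesis using y by simp
        qed
        moreover have "norm (u x 1 - of_real Am2 * dx (dx u) x 1) \<le> M * (1 / (1 + x)\<^sup>2)"
        proof -
          have "norm (u x 1) \<le> C1 / (1 + x)\<^sup>2" "norm (dx (dx u) x 1) \<le> C1 / (1 + x)\<^sup>2"
            using C1 x by (simp_all add: pos_le_divide_eq mult.commute)
          then have "norm (u x 1) + Am2 * norm (dx (dx u) x 1) \<le> C1 / (1 + x)\<^sup>2 + Am2 * (C1 / (1 + x)\<^sup>2)"
            using Am2 by (intro add_mono mult_left_mono)
          moreover have "norm (u x 1 - of_real Am2 * dx (dx u) x 1) \<le> norm (u x 1) + Am2 * norm (dx (dx u) x 1)"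
            using norm_triangle_ineq4[of "u x 1" "of_real Am2 * dx (dx u) x 1"] Am2 by (simp add: norm_mult)
          ultimately show ?thesis by (simp add: M_def algebra_simps add_divide_distrib)
        qed
        ultimately have "norm (exp (- \<i> * k * of_real x - s * of_real 1)) * norm (u x 1 - of_real Am2 * dx (dx u) x 1)
           \<le> 1 * (M * (1 / (1 + x)\<^sup>2))" by (intro mult_mono) auto
        then show "norm (exp (- \<i> * k * of_real x - s * of_real 1) * (u x 1 - of_real Am2 * dx (dx u) x 1))
           \<le> M * (1 / (1 + x)\<^sup>2)" by (simp only: norm_mult mult_1)
      qed
      also have "\<dots> = M * integral {0..X} (\<lambda>x. 1 / (1 + x)\<^sup>2)" by (rule integral_mult_right)
      also have "\<dots> \<le> M * 1"
        using C1_0 Am2 by (intro mult_left_mono integral_inverse_square_le X) (simp add: M_def)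
      finally show ?thesis by simp
    qed
    have main: "norm (integral {1..T} (\<lambda>t. exp (- s * of_real t) *
        flux_at Am2 A1 A2 A3 k s u 0 t)) \<le> M + K * exp (- (\<eta> * T))"
      if T: "T \<ge> 1" for T
    proof -
      obtain CT where CT0: "CT \<ge> 0" and CT: "\<forall>t\<in>{1..T}. \<forall>x\<ge>0. (1 + x)\<^sup>2 * norm (u x t) \<le> CT \<and>
          (1 + x)\<^sup>2 * norm (dx u x t) \<le> CT \<and> (1 + x)\<^sup>2 * norm (dx (dx u) x t) \<le> CT"
        using bounds[OF T] by blast
      have CT': "norm (u x t) \<le> CT / (1 + x)" "norm (dx u x t) \<le> CT / (1 + x)" "norm (dx (dx u) x t) \<le> CT / (1 + x)"
        if "t \<in> {1..T}" "x \<ge> 0" for t x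
        using CT that by (auto simp: pos_le_divide_eq mult.commute[of _ "1 + x"] intro!: le_weighted)
      define D where "D = \<bar>A3\<bar> + norm (of_real A2 - \<i> * s * of_real Am2 + of_real A3 * k) +
        norm (of_real A1 - (of_real A2 - \<i> * s * of_real Am2) * k - of_real A3 * k\<^sup>2)"
      have IT: "norm (I X T) \<le> K * exp (- (\<eta> * T)) + Am2 * CT / (1 + X)" if X: "X \<ge> 0" for X
      proof -
        have cX: "continuous_on {0..X} (\<lambda>x. u x T)" "continuous_on {0..X} (\<lambda>x. dx u x T)"
          "continuous_on {0..X} (\<lambda>x. dx (dx u) x T)"
          using T by (auto intro!: cont continuous_intros)
        have "I X T = integral {0..X} (\<lambda>x. exp (- s * of_real T) * (e x * (u x T - of_real Am2 * dx (dx u) x T)))"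
          unfolding I_def E by (simp only: mult.assoc)
        also have "\<dots> = exp (- s * of_real T) * integral {0..X} (\<lambda>x. e x * (u x T - of_real Am2 * dx (dx u) x T))"
          by (rule integral_mult_right)
        \<comment> \<open>The energy does not control the second x-derivative in the density, so
          that term is integrated by parts; the boundary term at 0 is bounded by means of G.\<close>
        also have "integral {0..X} (\<lambda>x. e x * (u x T - of_real Am2 * dx (dx u) x T)) =
            integral {0..X} (\<lambda>x. e x * (u x T - of_real Am2 * \<i> * k * dx u x T)
              - of_real Am2 * (e x * dx (dx u) x T + - \<i> * k * e x * dx u x T))"
          by (rule integral_cong) (simp add: algebra_simps)
        also have "\<dots> = integral {0..X} (\<lambda>x. e x * (u x T - of_real Am2 * \<i> * k * dx u x T)) -
            of_real Am2 * integral {0..X} (\<lambda>x. e x * dx (dx u) x T + - \<i> * k * e x * dx u x T)"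
          unfolding integral_mult_right[symmetric]
          by (intro integral_diff integrable_continuous_real continuous_intros ce cX)
        also have "integral {0..X} (\<lambda>x. e x * dx (dx u) x T + - \<i> * k * e x * dx u x T) =
            e X * dx u X T - e 0 * dx u 0 T"
        proof (intro integral_unique fundamental_theorem_of_calculus X has_vector_derivative_mult)
          fix x assume x: "x \<in> {0..X}"
          have "((\<lambda>x. e x) has_vector_derivative - \<i> * k * e x) (at x)"
            unfolding e_def by (rule has_vector_derivative_real_field) (auto intro!: derivative_eq_intros)
          then show "(e has_vector_derivative - \<i> * k * e x) (at x within {0..X})"
            by (rule has_vector_derivative_at_within)
          show "((\<lambda>x. dx u x T) has_vector_derivative dx (dx u) x T) (at x within {0..X})"
            by (rule has_vector_derivative_within_subset[OF smooth_has_dx[OF u1]]) (use x T in auto)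
        qed
        finally have I_eq: "I X T = exp (- s * of_real T) *
           (integral {0..X} (\<lambda>x. e x * (u x T - of_real Am2 * \<i> * k * dx u x T)) -
            of_real Am2 * (e X * dx u X T - e 0 * dx u 0 T))" .
        \<comment> \<open>The inequality \<open>2 * a * b \<le> a\<^sup>2 + b\<^sup>2\<close>
          separates the exponential, square integrable because \<open>Im k < 0\<close>, from the
          energy.\<close>
        have "norm (integral {0..X} (\<lambda>x. e x * (u x T - of_real Am2 * \<i> * k * dx u x T))) \<le>
          integral {0..X} (\<lambda>x. (1 + Am2 * (norm k)\<^sup>2) / 2 * exp (- (2 * y * x)) +
             1 / 2 * ((norm (u x T))\<^sup>2 + Am2 * (norm (dx u x T))\<^sup>2))"
        proof (intro integral_norm_bound_integral integrable_continuous_real continuous_intros ce cX)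
          fix x assume "x \<in> {0..X}"
          have ee: "exp (- (2 * y * x)) = (norm (e x))\<^sup>2"
            unfolding norm_e by (simp add: power2_eq_square flip: exp_add)
          have "norm (e x * (u x T - of_real Am2 * \<i> * k * dx u x T)) \<le>
             norm (e x) * (norm (u x T) + Am2 * norm k * norm (dx u x T))"
            unfolding norm_mult
            by (intro mult_left_mono order_trans[OF norm_triangle_ineq4])
               (use Am2 in \<open>simp_all add: norm_mult\<close>)
          moreover have "norm (e x) * norm (u x T) \<le> ((norm (e x))\<^sup>2 + (norm (u x T))\<^sup>2) / 2"
            using sum_squares_bound[of "norm (e x)" "norm (u x T)"] by simp
          moreover have "Am2 * ((norm k * norm (e x)) * norm (dx u x T)) \<le>
             Am2 * (((norm k * norm (e x))\<^sup>2 + (norm (dx u x T))\<^sup>2) / 2)"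
            using sum_squares_bound[of "norm k * norm (e x)" "norm (dx u x T)"] Am2 by (intro mult_left_mono) simp_all
          ultimately show "norm (e x * (u x T - of_real Am2 * \<i> * k * dx u x T)) \<le>
             (1 + Am2 * (norm k)\<^sup>2) / 2 * exp (- (2 * y * x)) +
             1 / 2 * ((norm (u x T))\<^sup>2 + Am2 * (norm (dx u x T))\<^sup>2)"
            unfolding ee by (simp add: algebra_simps power_mult_distrib add_divide_distrib)
        qed
        also have "\<dots> = (1 + Am2 * (norm k)\<^sup>2) / 2 * integral {0..X} (\<lambda>x. exp (- (2 * y * x))) +
             1 / 2 * integral {0..X} (\<lambda>x. (norm (u x T))\<^sup>2 + Am2 * (norm (dx u x T))\<^sup>2)"
          unfolding integral_mult_right[symmetric]
          by (intro integral_add integrable_continuous_real continuous_intros cX)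
        also have "\<dots> \<le> (1 + Am2 * (norm k)\<^sup>2) / 2 * (1 / (2 * y)) + 1 / 2 * (C * exp (\<eta> * T))"
          using integral_exp_decay_le[of 0 X "2 * y"] X y C T Am2
          by (intro add_mono mult_left_mono) auto
        finally have n1: "norm (integral {0..X} (\<lambda>x. e x * (u x T - of_real Am2 * \<i> * k * dx u x T))) \<le>
            (1 + Am2 * (norm k)\<^sup>2) / (4 * y) + C / 2 * exp (\<eta> * T)"
          by simp
        have "norm (e X * dx u X T - e 0 * dx u 0 T) \<le> norm (e X) * norm (dx u X T) + norm (e 0) * norm (dx u 0 T)"
          by (rule order_trans[OF norm_triangle_ineq4]) (simp add: norm_mult)
        also have "\<dots> \<le> 1 * (CT / (1 + X)) + 1 * G"
          using e_le[OF X] e_le[of 0] CT'(2)[of T X] T X bd[OF T] CT0 G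
          by (intro add_mono mult_mono) auto
        finally have n2: "norm (of_real Am2 * (e X * dx u X T - e 0 * dx u 0 T)) \<le> Am2 * (CT / (1 + X) + G)"
          using Am2 by (simp add: norm_mult mult_left_mono)
        have "norm (I X T) \<le> exp (- (Re s * T)) * ((1 + Am2 * (norm k)\<^sup>2) / (4 * y) + C / 2 * exp (\<eta> * T) +
             Am2 * (CT / (1 + X) + G))"
          unfolding I_eq norm_mult
          by (intro mult_mono order_trans[OF norm_triangle_ineq4] add_mono n1 n2) auto
        also have "\<dots> = exp (- (\<eta> * T)) * (exp (- (\<eta> * T)) * ((1 + Am2 * (norm k)\<^sup>2) / (4 * y) + Am2 * G)
            + C / 2) + exp (- (Re s * T)) * (Am2 * CT / (1 + X))"
        proof -
          have "exp (- (Re s * T)) = exp (- (\<eta> * T)) * exp (- (\<eta> * T))"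
            unfolding \<eta>(2) by (simp add: algebra_simps flip: exp_add)
          moreover have "exp (- (\<eta> * T)) * exp (\<eta> * T) = 1"
            by (simp flip: exp_add)
          ultimately show ?thesis by algebra
        qed
        also have "\<dots> \<le> exp (- (\<eta> * T)) * (1 * ((1 + Am2 * (norm k)\<^sup>2) / (4 * y) + Am2 * G) + \<bar>C\<bar> / 2)
            + 1 * (Am2 * CT / (1 + X))"
          using \<eta>(1) T Am2 G y CT0 X s by (intro add_mono mult_left_mono mult_right_mono) auto
        finally show ?thesis by (simp add: K_def algebra_simps)
      qed
      have JX: "norm (integral {1..T} (\<lambda>t. exp (- \<i> * k * of_real X - s * of_real t) *
          flux_at Am2 A1 A2 A3 k s u X t)) \<le> (T - 1) * (D * CT) / (1 + X)"
        if X: "X \<ge> 0" for X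
      proof -
        have "norm (integral {1..T} (\<lambda>t. exp (- \<i> * k * of_real X - s * of_real t) *
          flux_at Am2 A1 A2 A3 k s u X t)) \<le>
          integral {1..T} (\<lambda>t. D * (CT / (1 + X)))"
        proof (intro integral_norm_bound_integral integrable_continuous_real)
          show "continuous_on {1..T} (\<lambda>t. exp (- \<i> * k * of_real X - s * of_real t) *
              flux_at Am2 A1 A2 A3 k s u X t)"
            unfolding flux_def using X by (intro continuous_intros cont) auto
          fix t assume t: "t \<in> {1..T}"
          have "norm (exp (- \<i> * k * of_real X - s * of_real t)) \<le> 1"
          proof -
            have "0 \<le> y * X" "0 \<le> Re s * t" using t X y s by simp_all
            then have "- (y * X) \<le> Re s * t" by linarith
            then show ?thesis using y by simp
          qed
          moreover have "norm (flux_at Am2 A1 A2 A3 k s u X t) \<le> D * (CT / (1 + X))"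
            unfolding D_def distrib_right
            by (intro order_trans[OF norm_flux_le] add_mono mult_left_mono CT' t X) auto
          ultimately have "norm (exp (- \<i> * k * of_real X - s * of_real t)) *
              norm (flux_at Am2 A1 A2 A3 k s u X t) \<le> 1 * (D * (CT / (1 + X)))"
            by (intro mult_mono) auto
          then show "norm (exp (- \<i> * k * of_real X - s * of_real t) *
              flux_at Am2 A1 A2 A3 k s u X t) \<le> D * (CT / (1 + X))"
            by (simp only: norm_mult mult_1)
        qed (intro continuous_intros)
        then show ?thesis using T by (simp add: mult_ac)
      qed
      show ?thesis
      proof (rule le_of_le_add_vanishing)
        fix X :: real assume X: "X \<ge> 0"
        have triangle: "norm d \<le> norm a + norm b + norm c" if "a - b = c - d" for a b c d :: complex
        proof -
          have "d = c - a + b" using that by (simp add: algebra_simps)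
          then show ?thesis
            using norm_triangle_ineq[of "c - a" b] norm_triangle_ineq4[of c a] by simp
        qed
        from triangle[OF global_relation[OF u pde disp X T], folded I_def]
        show "norm (integral {1..T} (\<lambda>t. exp (- s * of_real t) *
            flux_at Am2 A1 A2 A3 k s u 0 t)) \<le>
            M + K * exp (- (\<eta> * T)) + (Am2 * CT + (T - 1) * (D * CT)) / (1 + X)"
          using I1[OF X] IT[OF X] JX[OF X] by (simp add: add_divide_distrib)
      qed
    qed
    then show ?thesis using \<eta> by blast
  qed
  then show ?thesis by blast
qed

section \<open>Abelian means\<close>

lemma exp_decay_tendsto_0: "r > 0 \<Longrightarrow> ((\<lambda>T. c * exp (- (r * T))) \<longlongrightarrow> 0) at_top" for r c :: real
proof -
  assume "r > 0"
  then have "filterlim (\<lambda>T. r * T) at_top at_top"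
    by (rule filterlim_tendsto_pos_mult_at_top[OF tendsto_const _ filterlim_ident])
  then have "((\<lambda>T. exp (- (r * T))) \<longlongrightarrow> 0) at_top"
    by (intro filterlim_compose[OF exp_at_bot] filterlim_uminus_at_bot[THEN iffD1] ) (simp add: filterlim_uminus_at_bot)
  then show ?thesis by (rule tendsto_mult_right_zero)
qed

section \<open>Laplace transforms of bounded continuous functions on \<open>{1..}\<close>\<close>

definition bdd_cont :: "(real \<Rightarrow> complex) \<Rightarrow> bool" where
  "bdd_cont f \<longleftrightarrow> continuous_on {1..} f \<and> (\<exists>B. \<forall>t\<ge>1. norm (f t) \<le> B)"

text \<open>The lower limit is 1 since the boundary values are controlled only away from the corner.
  A bounded time interval leaves no trace in an Abelian mean, where its share is multiplied by a
  vanishing \<open>\<mu>\<close>.\<close>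

definition laplace :: "(real \<Rightarrow> complex) \<Rightarrow> complex \<Rightarrow> complex" where
  "laplace f s = integral {1..} (\<lambda>t. exp (- s * of_real t) * f t)"

lemma bdd_contE:
  assumes "bdd_cont f"
  obtains B where "continuous_on {1..} f" "B \<ge> 0" "\<And>t. t \<ge> 1 \<Longrightarrow> norm (f t) \<le> B"
proof -
  from assms obtain B where B: "continuous_on {1..} f" "\<forall>t\<ge>1. norm (f t) \<le> B"
    unfolding bdd_cont_def by blast
  then have "B \<ge> 0" using norm_ge_zero order_trans by blast
  with B that show ?thesis by blast
qed

lemma bdd_cont_add:
  assumes "bdd_cont f" "bdd_cont g"
  shows "bdd_cont (\<lambda>t. f t + g t)"
proof -
  obtain B where B: "continuous_on {1..} f" "\<And>t. t \<ge> 1 \<Longrightarrow> norm (f t) \<le> B"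
    using assms(1) bdd_contE by blast
  obtain C where C: "continuous_on {1..} g" "\<And>t. t \<ge> 1 \<Longrightarrow> norm (g t) \<le> C"
    using assms(2) bdd_contE by blast
  have "norm (f t + g t) \<le> B + C" if "t \<ge> 1" for t
    using B(2)[OF that] C(2)[OF that] norm_triangle_ineq[of "f t" "g t"] by linarith
  then show ?thesis unfolding bdd_cont_def using B(1) C(1)
    by (intro conjI exI[of _ "B + C"] allI impI continuous_intros) auto
qed

lemma bdd_cont_cmult:
  assumes "bdd_cont f" shows "bdd_cont (\<lambda>t. c * f t)"
proof -
  obtain B where B: "continuous_on {1..} f" "\<And>t. t \<ge> 1 \<Longrightarrow> norm (f t) \<le> B"
    using assms bdd_contE by blast
  have "norm (c * f t) \<le> norm c * B" if "t \<ge> 1" for t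
    using B(2)[OF that] by (simp add: norm_mult mult_left_mono)
  then show ?thesis unfolding bdd_cont_def using B(1)
    by (intro conjI exI[of _ "norm c * B"] allI impI continuous_intros) auto
qed

lemma bdd_cont_diff:
  assumes "bdd_cont f" "bdd_cont g"
  shows "bdd_cont (\<lambda>t. f t - g t)"
  using bdd_cont_add[OF assms(1) bdd_cont_cmult[OF assms(2), of "-1"]] by simp

lemma integrable_laplace:
  assumes f: "bdd_cont f" and s: "Re s > 0" and a: "a \<ge> 1"
  shows "(\<lambda>t. exp (- s * of_real t) * f t) integrable_on {a..}"
proof -
  obtain B where B: "continuous_on {1..} f" "\<And>t. t \<ge> 1 \<Longrightarrow> norm (f t) \<le> B"
    using f bdd_contE by blast
  have "(\<lambda>t. exp (- s * of_real t) * f t) absolutely_integrable_on {a..}"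
  proof (rule measurable_bounded_by_integrable_imp_absolutely_integrable)
    show "(\<lambda>t. exp (- s * of_real t) * f t) \<in> borel_measurable (lebesgue_on {a..})"
      using a
      by (intro continuous_imp_measurable_on_sets_lebesgue continuous_intros continuous_on_subset[OF B(1)]) auto
    show "(\<lambda>t. B * exp (- Re s * t)) integrable_on {a..}"
      using integrable_on_exp_minus_to_infinity[OF s] by (intro integrable_on_mult_right)
    show "norm (exp (- s * of_real t) * f t) \<le> B * exp (- Re s * t)" if "t \<in> {a..}" for t
      using B(2)[of t] that a by (simp add: norm_mult mult.commute)
  qed simp
  then show ?thesis by (rule absolutely_integrable_on_def[THEN iffD1, THEN conjunct1])
qed

lemma norm_laplace_tail_le:
  assumes f: "bdd_cont f" and B: "\<And>t. t \<ge> 1 \<Longrightarrow> norm (f t) \<le> B" and s: "Re s > 0" and a: "a \<ge> 1"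
  shows "norm (integral {a..} (\<lambda>t. exp (- s * of_real t) * f t)) \<le> B * exp (- (Re s * a)) / Re s"
proof -
  have int: "((\<lambda>t. B * exp (- Re s * t)) has_integral B * (exp (- Re s * a) / Re s)) {a..}"
    using has_integral_exp_minus_to_infinity[OF s] by (rule has_integral_mult_right)
  have "norm (integral {a..} (\<lambda>t. exp (- s * of_real t) * f t)) \<le> integral {a..} (\<lambda>t. B * exp (- Re s * t))"
    by (intro integral_norm_bound_integral integrable_laplace[OF f s a] has_integral_integrable[OF int])
       (use B a in \<open>auto simp: norm_mult mult.commute\<close>)
  also have "\<dots> = B * exp (- (Re s * a)) / Re s"
    unfolding integral_unique[OF int] by (simp only: mult_minus_left times_divide_eq_right)
  finally show ?thesis .
qed

lemma laplace_tendsto: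
  assumes f: "bdd_cont f" and s: "Re s > 0"
  shows "((\<lambda>T. integral {1..T} (\<lambda>t. exp (- s * of_real t) * f t)) \<longlongrightarrow> laplace f s) at_top"
proof -
  obtain B where B: "continuous_on {1..} f" "\<And>t. t \<ge> 1 \<Longrightarrow> norm (f t) \<le> B"
    using f bdd_contE by blast
  have "norm (integral {1..T} (\<lambda>t. exp (- s * of_real t) * f t) - laplace f s) \<le> B * exp (- (Re s * T)) / Re s"
    if T: "T \<ge> 1" for T
  proof -
    have "{1..} = {1..T} \<union> {T..}" "{1..T} \<inter> {T..} = {T}" using T by auto
    then have "laplace f s = integral {1..T} (\<lambda>t. exp (- s * of_real t) * f t) +
        integral {T..} (\<lambda>t. exp (- s * of_real t) * f t)"
      unfolding laplace_def using T
      by (metis (no_types, lifting) integral_Un integrable_laplace[OF f s] integrable_on_subinterval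
          negligible_sing order_refl Un_upper1)
    then show ?thesis using norm_laplace_tail_le[OF f B(2) s T] by (simp add: norm_minus_commute)
  qed
  note bound = this
  have lim0: "((\<lambda>T. B * exp (- (Re s * T)) / Re s) \<longlongrightarrow> 0) at_top"
    using exp_decay_tendsto_0[OF s, of "B / Re s"] by simp
  show ?thesis
  proof (rule LIM_zero_cancel, rule Lim_null_comparison[OF _ lim0])
    show "eventually (\<lambda>T. norm (integral {1..T} (\<lambda>t. exp (- s * of_real t) * f t) - laplace f s) \<le>
        B * exp (- (Re s * T)) / Re s) at_top"
      by (rule eventually_mono[OF eventually_ge_at_top[of 1]]) (rule bound)
  qed
qed

lemma laplace_add:
  assumes "bdd_cont f" "bdd_cont g" "Re s > 0"
  shows "laplace (\<lambda>t. f t + g t) s = laplace f s + laplace g s"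
  unfolding laplace_def distrib_left using assms by (intro integral_add integrable_laplace) auto

lemma laplace_cmult: "laplace (\<lambda>t. c * f t) s = c * laplace f s"
proof -
  have "laplace (\<lambda>t. c * f t) s = integral {1..} (\<lambda>t. c * (exp (- s * of_real t) * f t))"
    unfolding laplace_def by (simp only: mult.left_commute)
  then show ?thesis unfolding laplace_def by simp
qed

lemma laplace_diff:
  assumes "bdd_cont f" "bdd_cont g" "Re s > 0"
  shows "laplace (\<lambda>t. f t - g t) s = laplace f s - laplace g s"
  using laplace_add[OF assms(1) bdd_cont_cmult[OF assms(2), of "-1"] assms(3)]
  by (simp only: laplace_cmult) simp

text \<open>As T tends to infinity the term with K drops out, so K may depend on s without
  harm.\<close>

lemma norm_laplace_le:
  assumes "bdd_cont f" "Re s > 0"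
    and bd: "\<And>T. T \<ge> 1 \<Longrightarrow> norm (integral {1..T} (\<lambda>t. exp (- s * of_real t) * f t)) \<le> M + K * exp (- (r * T))"
    and r: "r > 0"
  shows "norm (laplace f s) \<le> M"
proof -
  have "((\<lambda>T. M + K * exp (- (r * T))) \<longlongrightarrow> M) at_top"
    using tendsto_add[OF tendsto_const exp_decay_tendsto_0[OF r], of M K] by simp
  then show ?thesis
    using tendsto_norm[OF laplace_tendsto[OF assms(1,2)]]
    by (rule tendsto_le[OF trivial_limit_at_top_linorder])
       (rule eventually_mono[OF eventually_ge_at_top[of 1]], rule bd)
qed

text \<open>Integration by parts on \<open>{1..T}\<close>: boundedness of f and
  \<open>Re s > 0\<close> kill the boundary term at infinity, and the one at time 1 remains.\<close>

lemma laplace_deriv: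
  assumes f: "bdd_cont f" and f': "bdd_cont f'" and s: "Re s > 0"
    and d: "\<And>t. t \<ge> 1 \<Longrightarrow> (f has_vector_derivative f' t) (at t)"
  shows "laplace f' s = s * laplace f s - exp (- s) * f 1"
proof -
  obtain B where B: "continuous_on {1..} f" "\<And>t. t \<ge> 1 \<Longrightarrow> norm (f t) \<le> B"
    using f bdd_contE by blast
  have c': "continuous_on {1..} f'" using f' by (simp add: bdd_cont_def)
  let ?I = "\<lambda>f T. integral {1..T} (\<lambda>t. exp (- s * of_real t) * f t)"
  have eq: "?I f' T - s * ?I f T = exp (- s * of_real T) * f T - exp (- s) * f 1" if T: "T \<ge> 1" for T
  proof -
    have "((\<lambda>t. exp (- s * of_real t) * f' t + - s * exp (- s * of_real t) * f t) has_integral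
        exp (- s * of_real T) * f T - exp (- s * of_real 1) * f 1) {1..T}"
    proof (intro fundamental_theorem_of_calculus T has_vector_derivative_mult)
      show "((\<lambda>t. exp (- s * of_real t)) has_vector_derivative - s * exp (- s * of_real t)) (at t within {1..T})" for t
        by (rule has_vector_derivative_at_within, rule has_vector_derivative_real_field)
           (auto intro!: derivative_eq_intros)
      show "(f has_vector_derivative f' t) (at t within {1..T})" if "t \<in> {1..T}" for t
        using d that by (auto intro: has_vector_derivative_at_within)
    qed
    moreover have "integral {1..T} (\<lambda>t. exp (- s * of_real t) * f' t + - s * exp (- s * of_real t) * f t) =
        ?I f' T + integral {1..T} (\<lambda>t. - s * (exp (- s * of_real t) * f t))"
      unfolding mult.assoc
      by (intro integral_add integrable_continuous_real continuous_intros
          continuous_on_subset[OF B(1)] continuous_on_subset[OF c']) auto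
    ultimately show ?thesis by (simp add: integral_unique)
  qed
  have "((\<lambda>T. ?I f' T - s * ?I f T) \<longlongrightarrow> laplace f' s - s * laplace f s) at_top"
    by (intro tendsto_intros laplace_tendsto f f' s)
  moreover
  have "((\<lambda>T. exp (- s * of_real T) * f T - exp (- s) * f 1) \<longlongrightarrow> 0 - exp (- s) * f 1) at_top"
  proof (intro tendsto_intros)
    have "((\<lambda>T. B * exp (- (Re s * T))) \<longlongrightarrow> 0) at_top" using exp_decay_tendsto_0[OF s] .
    then show "((\<lambda>T. exp (- s * of_real T) * f T) \<longlongrightarrow> 0) at_top"
    proof (rule Lim_null_comparison[rotated], intro eventually_mono[OF eventually_ge_at_top[of 1]])
      show "norm (exp (- s * of_real T) * f T) \<le> B * exp (- (Re s * T))" if "1 \<le> T" for T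
        using B(2)[OF that] by (simp add: norm_mult mult.commute)
    qed
  qed
  then have "((\<lambda>T. ?I f' T - s * ?I f T) \<longlongrightarrow> 0 - exp (- s) * f 1) at_top"
    by (rule Lim_transform_eventually)
       (rule eventually_mono[OF eventually_ge_at_top[of 1]], rule eq[symmetric])
  ultimately have "laplace f' s - s * laplace f s = 0 - exp (- s) * f 1"
    by (rule tendsto_unique[OF trivial_limit_at_top_linorder])
  then show ?thesis by (simp add: algebra_simps)
qed

text \<open>Abelian means are taken over a cone around the positive reals, since the frequencies
  \<open>s = - \<i> \<omega>(k)\<close> available from the global relation approach \<open>\<i> \<nu>\<close> only nontangentially.\<close>

definition cone :: "complex set" where
  "cone = {\<mu>. norm \<mu> \<le> 2 * Re \<mu>}"

text \<open>For an almost periodic f this is the Bohr-Fourier coefficient at frequency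
  \<open>\<nu>\<close>, written as the nontangential residue of the transform at
  \<open>\<i> * of_real \<nu>\<close>. Bounded continuity is built in so that sums and multiples
  carry no side conditions.\<close>

definition amplitude :: "real \<Rightarrow> (real \<Rightarrow> complex) \<Rightarrow> complex \<Rightarrow> bool" where
  "amplitude \<nu> f L \<longleftrightarrow> bdd_cont f \<and>
     ((\<lambda>\<mu>. \<mu> * laplace f (\<mu> + \<i> * of_real \<nu>)) \<longlongrightarrow> L) (at 0 within cone)"

lemma eventually_cone: "eventually (\<lambda>\<mu>. Re \<mu> > 0 \<and> norm \<mu> \<le> 2 * Re \<mu>) (at 0 within cone)"
proof -
  have "Re \<mu> > 0 \<and> norm \<mu> \<le> 2 * Re \<mu>" if "\<mu> \<in> cone" "\<mu> \<noteq> 0" for \<mu>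
  proof -
    have "norm \<mu> > 0" "norm \<mu> \<le> 2 * Re \<mu>" using that by (simp_all add: cone_def)
    then show ?thesis by linarith
  qed
  then show ?thesis unfolding eventually_at_filter by (auto intro: always_eventually)
qed

lemma at_0_within_cone_nontrivial: "at 0 within cone \<noteq> bot"
proof -
  have "\<exists>\<mu>\<in>cone. \<mu> \<noteq> 0 \<and> dist \<mu> 0 < e" if "e > 0" for e
    using that by (intro bexI[of _ "of_real (e / 2)"]) (auto simp: cone_def)
  then show ?thesis by (simp add: trivial_limit_within islimpt_approachable)
qed

lemma amplitude_unique:
  assumes "amplitude \<nu> f L" "amplitude \<nu> f L'"
  shows "L = L'"
  by (rule tendsto_unique[OF at_0_within_cone_nontrivial]) (use assms in \<open>simp_all add: amplitude_def\<close>)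

lemma amplitude_add:
  assumes "amplitude \<nu> f L" "amplitude \<nu> g L'"
  shows "amplitude \<nu> (\<lambda>t. f t + g t) (L + L')"
  unfolding amplitude_def
proof
  have bc: "bdd_cont f" "bdd_cont g" using assms by (simp_all add: amplitude_def)
  then show "bdd_cont (\<lambda>t. f t + g t)" by (rule bdd_cont_add)
  have "((\<lambda>\<mu>. \<mu> * laplace f (\<mu> + \<i> * of_real \<nu>) + \<mu> * laplace g (\<mu> + \<i> * of_real \<nu>)) \<longlongrightarrow> L + L') (at 0 within cone)"
    using assms by (intro tendsto_add) (simp_all add: amplitude_def)
  then show "((\<lambda>\<mu>. \<mu> * laplace (\<lambda>t. f t + g t) (\<mu> + \<i> * of_real \<nu>)) \<longlongrightarrow> L + L') (at 0 within cone)"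
    by (rule Lim_transform_eventually)
       (rule eventually_mono[OF eventually_cone], subst laplace_add[OF bc], simp_all add: distrib_left)
qed

lemma amplitude_cmult:
  assumes "amplitude \<nu> f L" shows "amplitude \<nu> (\<lambda>t. c * f t) (c * L)"
  using assms unfolding amplitude_def laplace_cmult mult.left_commute[of _ c]
  by (auto intro: tendsto_mult_left bdd_cont_cmult)

lemma amplitude_diff:
  assumes "amplitude \<nu> f L" "amplitude \<nu> g L'"
  shows "amplitude \<nu> (\<lambda>t. f t - g t) (L - L')"
  using amplitude_add[OF assms(1) amplitude_cmult[OF assms(2), of "-1"]] by simp

lemma amplitude_zero: "amplitude \<nu> (\<lambda>_. 0) 0"
  unfolding amplitude_def bdd_cont_def laplace_def by (auto intro: exI[of _ 0])

lemma amplitude_sum: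
  assumes "finite A" "\<And>i. i \<in> A \<Longrightarrow> amplitude \<nu> (f i) (L i)"
  shows "amplitude \<nu> (\<lambda>t. \<Sum>i\<in>A. f i t) (\<Sum>i\<in>A. L i)"
  using assms by (induction A rule: finite_induct) (auto intro: amplitude_add amplitude_zero)

text \<open>It is enough that the derivative is bounded; its amplitude results. Integration by parts
  gives the factor s, which tends to \<open>\<i> * of_real \<nu>\<close>, and a boundary term at
  time 1 that \<open>\<mu>\<close> annihilates in the limit.\<close>

lemma amplitude_deriv:
  assumes f: "amplitude \<nu> f L" and f': "bdd_cont f'"
    and d: "\<And>t. t \<ge> 1 \<Longrightarrow> (f has_vector_derivative f' t) (at t)"
  shows "amplitude \<nu> f' (\<i> * of_real \<nu> * L)"
  unfolding amplitude_def
proof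
  let ?s = "\<lambda>\<mu>. \<mu> + \<i> * of_real \<nu>"
  have "((\<lambda>\<mu>. ?s \<mu> * (\<mu> * laplace f (?s \<mu>)) - \<mu> * (exp (- ?s \<mu>) * f 1)) \<longlongrightarrow>
      (0 + \<i> * of_real \<nu>) * L - 0 * (exp (- (0 + \<i> * of_real \<nu>)) * f 1)) (at 0 within cone)"
    using f unfolding amplitude_def by (intro tendsto_intros) simp_all
  moreover have "eventually (\<lambda>\<mu>. ?s \<mu> * (\<mu> * laplace f (?s \<mu>)) - \<mu> * (exp (- ?s \<mu>) * f 1) =
      \<mu> * laplace f' (?s \<mu>)) (at 0 within cone)"
    by (rule eventually_mono[OF eventually_cone], subst laplace_deriv[OF _ f' _ d])
       (use f in \<open>auto simp: amplitude_def algebra_simps\<close>)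
  ultimately show "((\<lambda>\<mu>. \<mu> * laplace f' (?s \<mu>)) \<longlongrightarrow> \<i> * of_real \<nu> * L) (at 0 within cone)"
    by (rule Lim_transform_eventually[THEN tendsto_eq_rhs]) simp
qed (rule f')

text \<open>Orthogonality of characters. The exponential is an eigenfunction of differentiation, so
  \<open>laplace_deriv\<close> gives \<open>s - \<i> * of_real \<theta>\<close> times its transform
  in closed form; for \<open>\<theta> = \<nu>\<close> that factor is \<open>\<mu>\<close>
  itself.\<close>

lemma amplitude_exp:
  "amplitude \<nu> (\<lambda>t. exp (\<i> * of_real \<theta> * of_real t)) (if \<theta> = \<nu> then 1 else 0)"
  unfolding amplitude_def
proof
  let ?e = "\<lambda>t::real. exp (\<i> * of_real \<theta> * of_real t)" let ?s = "\<lambda>\<mu>. \<mu> + \<i> * of_real \<nu>"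
  show bc: "bdd_cont ?e"
    unfolding bdd_cont_def by (auto intro!: continuous_intros exI[of _ 1])
  have d: "(?e has_vector_derivative \<i> * of_real \<theta> * ?e t) (at t)" for t
    by (rule has_vector_derivative_real_field) (auto intro!: derivative_eq_intros)
  have eq: "(?s \<mu> - \<i> * of_real \<theta>) * laplace ?e (?s \<mu>) = exp (- ?s \<mu>) * ?e 1" if "Re \<mu> > 0" for \<mu>
    using laplace_deriv[OF bc bdd_cont_cmult[OF bc] _ d, of "?s \<mu>"] that
    by (simp add: laplace_cmult algebra_simps)
  show "((\<lambda>\<mu>. \<mu> * laplace ?e (?s \<mu>)) \<longlongrightarrow> (if \<theta> = \<nu> then 1 else 0)) (at 0 within cone)"
  proof (cases "\<theta> = \<nu>")
    case True
    have "((\<lambda>\<mu>. exp (- ?s \<mu>) * ?e 1) \<longlongrightarrow> exp (- ?s 0) * ?e 1) (at 0 within cone)"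
      by (intro tendsto_intros)
    also have "exp (- ?s 0) * ?e 1 = 1" using True by (simp flip: exp_add)
    finally have "((\<lambda>\<mu>. \<mu> * laplace ?e (?s \<mu>)) \<longlongrightarrow> 1) (at 0 within cone)"
      by (rule Lim_transform_eventually) (rule eventually_mono[OF eventually_cone], use eq True in simp)
    then show ?thesis using True by simp
  next
    case False
    have "((\<lambda>\<mu>. \<mu> * (exp (- ?s \<mu>) * ?e 1 / (?s \<mu> - \<i> * of_real \<theta>))) \<longlongrightarrow>
        0 * (exp (- ?s 0) * ?e 1 / (?s 0 - \<i> * of_real \<theta>))) (at 0 within cone)"
      using False by (intro tendsto_intros) auto
    moreover have "eventually (\<lambda>\<mu>. \<mu> * (exp (- ?s \<mu>) * ?e 1 / (?s \<mu> - \<i> * of_real \<theta>)) = \<mu> * laplace ?e (?s \<mu>))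
        (at 0 within cone)"
    proof (rule eventually_mono[OF eventually_cone])
      fix \<mu> assume \<mu>: "0 < Re \<mu> \<and> cmod \<mu> \<le> 2 * Re \<mu>"
      then have "Re (?s \<mu> - \<i> * of_real \<theta>) > 0" by simp
      then have "?s \<mu> - \<i> * of_real \<theta> \<noteq> 0" by (metis less_irrefl zero_complex.sel(1))
      then show "\<mu> * (exp (- ?s \<mu>) * ?e 1 / (?s \<mu> - \<i> * of_real \<theta>)) = \<mu> * laplace ?e (?s \<mu>)"
        using eq[of \<mu>] \<mu> by (simp add: field_simps)
    qed
    ultimately show ?thesis using False by (simp add: Lim_transform_eventually)
  qed
qed

text \<open>An error that is eventually at most \<open>\<epsilon>\<close> has a transform of size at
  most \<open>\<epsilon> / Re s\<close> plus a constant, and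
  \<open>norm \<mu> \<le> 2 * Re \<mu>\<close> keeps
  \<open>norm \<mu> * \<epsilon> / Re \<mu>\<close> small. This is where the cone enters.\<close>

lemma amplitude_approx:
  assumes f: "bdd_cont f"
    and approx: "\<And>\<epsilon>. \<epsilon> > 0 \<Longrightarrow> \<exists>g T. amplitude \<nu> g L \<and> (\<forall>t\<ge>T. norm (f t - g t) \<le> \<epsilon>)"
  shows "amplitude \<nu> f L"
  unfolding amplitude_def
proof
  let ?s = "\<lambda>\<mu>. \<mu> + \<i> * of_real \<nu>"
  show "((\<lambda>\<mu>. \<mu> * laplace f (?s \<mu>)) \<longlongrightarrow> L) (at 0 within cone)"
  proof (rule tendstoI)
    fix e :: real assume e: "e > 0"
    \<comment> \<open>Two of the four parts pay for the late error in the cone, one for the early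
      error, one for the convergence belonging to g.\<close>
    define \<epsilon> where "\<epsilon> = e / 4"
    have \<epsilon>: "\<epsilon> > 0" using e by (simp add: \<epsilon>_def)
    obtain g T where g: "amplitude \<nu> g L" and T: "\<forall>t\<ge>T. norm (f t - g t) \<le> \<epsilon>" using approx[OF \<epsilon>] by blast
    have bg: "bdd_cont g" using g by (simp add: amplitude_def)
    define h where "h t = f t - g t" for t
    have bh: "bdd_cont h" unfolding h_def by (rule bdd_cont_diff[OF f bg])
    then obtain B where B: "B \<ge> 0" "\<And>t. t \<ge> 1 \<Longrightarrow> norm (h t) \<le> B" using bdd_contE by blast
    \<comment> \<open>Since \<open>exp (T - t) \<ge> 1\<close> for \<open>t < T\<close>, a single
      integrable majorant covers early and late times.\<close>
    have h_le: "norm (h t) \<le> \<epsilon> + B * exp (T - t)" if "t \<ge> 1" for t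
    proof (cases "t \<ge> T")
      case True
      then show ?thesis using T B(1) by (simp add: h_def add_increasing2)
    next
      case False
      then have "B * 1 \<le> B * exp (T - t)" using B(1) by (intro mult_left_mono) auto
      then show ?thesis using B(2)[OF that] \<epsilon> by linarith
    qed
    have h_bound: "norm (laplace h s) \<le> \<epsilon> / Re s + B * exp T" if s: "Re s > 0" for s
    proof -
      have "((\<lambda>t. \<epsilon> * exp (- Re s * t) + B * exp T * exp (- 1 * t)) has_integral
          \<epsilon> * (exp (- Re s * 1) / Re s) + B * exp T * (exp (- 1 * 1) / 1)) {1..}"
        by (intro has_integral_add has_integral_mult_right has_integral_exp_minus_to_infinity s) simp
      note int = this
      have "norm (laplace h s) \<le> integral {1..} (\<lambda>t. \<epsilon> * exp (- Re s * t) + B * exp T * exp (- 1 * t))"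
        unfolding laplace_def
      proof (intro integral_norm_bound_integral integrable_laplace[OF bh s] has_integral_integrable[OF int])
        fix t :: real assume t: "t \<in> {1..}"
        have "norm (exp (- s * of_real t) * h t) \<le> exp (- Re s * t) * (\<epsilon> + B * exp (T - t))"
          using h_le[of t] t by (simp add: norm_mult)
        also have "\<dots> = \<epsilon> * exp (- Re s * t) + exp (- Re s * t) * (B * exp T * exp (- 1 * t))"
          by (simp add: algebra_simps exp_diff exp_minus divide_inverse)
        also have "exp (- Re s * t) * (B * exp T * exp (- 1 * t)) \<le> 1 * (B * exp T * exp (- 1 * t))"
          using t s B(1) by (intro mult_right_mono) auto
        finally show "norm (exp (- s * of_real t) * h t) \<le> \<epsilon> * exp (- Re s * t) + B * exp T * exp (- 1 * t)"
          by simp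
      qed simp
      also have "\<dots> = \<epsilon> * (exp (- Re s * 1) / Re s) + B * exp T * (exp (- 1 * 1) / 1)"
        using int by (rule integral_unique)
      also have "\<dots> \<le> \<epsilon> * (1 / Re s) + B * exp T * 1"
        using s \<epsilon> B(1) by (intro add_mono mult_left_mono divide_right_mono) auto
      finally show ?thesis by simp
    qed
    have "((\<lambda>\<mu>. norm \<mu> * (B * exp T)) \<longlongrightarrow> norm (0::complex) * (B * exp T)) (at 0 within cone)"
      by (intro tendsto_intros)
    then have ev1: "eventually (\<lambda>\<mu>. norm \<mu> * (B * exp T) < \<epsilon>) (at 0 within cone)"
      using \<epsilon> by (intro order_tendstoD(2)) auto
    have ev2: "eventually (\<lambda>\<mu>. dist (\<mu> * laplace g (?s \<mu>)) L < \<epsilon>) (at 0 within cone)"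
      using g \<epsilon> unfolding amplitude_def by (auto dest: tendstoD)
    show "eventually (\<lambda>\<mu>. dist (\<mu> * laplace f (?s \<mu>)) L < e) (at 0 within cone)"
      using ev1 ev2 eventually_cone
    proof eventually_elim
      case (elim \<mu>)
      have s: "Re (?s \<mu>) > 0" using elim by simp
      have "norm (\<mu> * laplace h (?s \<mu>)) \<le> norm \<mu> * (\<epsilon> / Re (?s \<mu>) + B * exp T)"
        unfolding norm_mult by (intro mult_left_mono h_bound s) simp
      also have "\<dots> = norm \<mu> / Re \<mu> * \<epsilon> + norm \<mu> * (B * exp T)" by (simp add: distrib_left)
      also have "norm \<mu> / Re \<mu> * \<epsilon> \<le> 2 * \<epsilon>"
        using elim \<epsilon> by (intro mult_right_mono) (simp_all add: divide_le_eq)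
      finally have "norm (\<mu> * laplace h (?s \<mu>)) \<le> 2 * \<epsilon> + \<epsilon>" using elim by simp
      moreover have "laplace h (?s \<mu>) = laplace f (?s \<mu>) - laplace g (?s \<mu>)"
        unfolding h_def by (rule laplace_diff[OF f bg s])
      then have "dist (\<mu> * laplace f (?s \<mu>)) (\<mu> * laplace g (?s \<mu>)) = norm (\<mu> * laplace h (?s \<mu>))"
        by (simp only: dist_norm right_diff_distrib)
      ultimately show ?case
        using elim dist_triangle[of "\<mu> * laplace f (?s \<mu>)" L "\<mu> * laplace g (?s \<mu>)"] by (simp add: \<epsilon>_def)
    qed
  qed
qed (rule f)

section \<open>Amplitudes of asymptotically periodic functions\<close>

lemma norm_fourier_term:
  "norm (c * exp (\<i> * of_int n * of_real \<omega> * of_real t)) = norm (c :: complex)"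
proof -
  have "norm (exp (\<i> * of_int n * of_real \<omega> * of_real t)) = 1" by simp
  then show ?thesis unfolding norm_mult by simp
qed

lemma asymp_periodic_bounded_continuous:
  assumes f: "asymp_periodic \<omega> f c" and cont: "continuous_on {1..} f"
  shows "bdd_cont f"
proof -
  let ?F = "\<lambda>t. \<Sum>\<^sub>\<infinity>n\<in>UNIV. c n * exp (\<i> * of_int n * of_real \<omega> * of_real t)"
  have sum: "(\<lambda>n. norm (c n)) summable_on UNIV" and lim: "((\<lambda>t. f t - ?F t) \<longlongrightarrow> 0) at_top"
    using f by (simp_all add: asymp_periodic_def)
  have F: "norm (?F t) \<le> (\<Sum>\<^sub>\<infinity>n\<in>UNIV. norm (c n))" for t
    by (rule order_trans[OF norm_infsum_bound]) (simp_all only: norm_fourier_term sum order_refl)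
  have "eventually (\<lambda>t. norm (f t - ?F t) < 1) at_top"
    using tendstoD[OF lim, of 1] by (simp only: dist_norm diff_0_right zero_less_one)
  then obtain T where T: "\<forall>t\<ge>T. norm (f t - ?F t) < 1"
    unfolding eventually_at_top_linorder by blast
  have "compact (f ` {1..T})"
    by (intro compact_continuous_image continuous_on_subset[OF cont]) auto
  then have "bounded (f ` {1..T})" by (rule compact_imp_bounded)
  then obtain B where "\<forall>z\<in>f ` {1..T}. norm z \<le> B" unfolding bounded_iff by blast
  then have B: "norm (f t) \<le> B" if "t \<in> {1..T}" for t using that by simp
  have "norm (f t) \<le> max B (1 + (\<Sum>\<^sub>\<infinity>n\<in>UNIV. norm (c n)))" if "t \<ge> 1" for t
  proof (cases "t \<le> T")
    case True
    then show ?thesis using B[of t] that by auto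
  next
    case False
    then show ?thesis using T[rule_format, of t] F[of t] norm_triangle_sub[of "f t" "?F t"] by linarith
  qed
  then show ?thesis unfolding bdd_cont_def
    by (intro conjI cont exI[of _ "max B (1 + (\<Sum>\<^sub>\<infinity>n\<in>UNIV. norm (c n)))"] allI impI)
qed

text \<open>By absolute convergence a finite partial sum is uniformly close to the series, hence
  eventually to f, and its amplitude is computed term by term. The condition
  \<open>\<omega> > 0\<close> keeps the frequencies of different indices apart.\<close>

lemma asymp_periodic_amplitude:
  assumes f: "asymp_periodic \<omega> f c" and cont: "continuous_on {1..} f" and \<omega>: "\<omega> > 0"
  shows "amplitude (of_int n * \<omega>) f (c n)"
proof (rule amplitude_approx)
  show "bdd_cont f" by (rule asymp_periodic_bounded_continuous[OF f cont])
  define e where "e m t = exp (\<i> * of_int m * of_real \<omega> * of_real t)" for m :: int and t :: real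
  let ?F = "\<lambda>t. \<Sum>\<^sub>\<infinity>m\<in>UNIV. c m * e m t"
  have sum: "(\<lambda>m. norm (c m)) summable_on UNIV" and lim: "((\<lambda>t. f t - ?F t) \<longlongrightarrow> 0) at_top"
    using f by (simp_all add: asymp_periodic_def e_def)
  have norm_e: "norm (c m * e m t) = norm (c m)" for m t unfolding e_def by (rule norm_fourier_term)
  have sumt: "(\<lambda>m. c m * e m t) summable_on A" for t A
    by (rule abs_summable_summable, unfold norm_e, rule summable_on_subset_banach[OF sum]) simp
  fix \<epsilon> :: real assume \<epsilon>: "\<epsilon> > 0"
  obtain F0 where F0: "finite F0" "dist (\<Sum>m\<in>F0. norm (c m)) (\<Sum>\<^sub>\<infinity>m\<in>UNIV. norm (c m)) \<le> \<epsilon> / 2"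
    using infsum_finite_approximation[OF sum, of "\<epsilon> / 2"] \<epsilon> by auto
  \<comment> \<open>The index n is put in by hand so that the finite sum is sure to contain the term
    to be picked out.\<close>
  define F where "F = insert n F0"
  have F: "finite F" "n \<in> F" using F0 by (auto simp: F_def)
  have tail: "(\<Sum>\<^sub>\<infinity>m\<in>-F. norm (c m)) \<le> \<epsilon> / 2"
  proof -
    have "(\<Sum>\<^sub>\<infinity>m\<in>UNIV. norm (c m)) = (\<Sum>\<^sub>\<infinity>m\<in>F \<union> -F. norm (c m))" by (simp add: Compl_partition)
    also have "\<dots> = (\<Sum>m\<in>F. norm (c m)) + (\<Sum>\<^sub>\<infinity>m\<in>-F. norm (c m))"
      using F by (subst infsum_Un_disjoint) (auto intro: summable_on_subset_banach[OF sum])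
    finally have "(\<Sum>\<^sub>\<infinity>m\<in>-F. norm (c m)) = (\<Sum>\<^sub>\<infinity>m\<in>UNIV. norm (c m)) - (\<Sum>m\<in>F. norm (c m))" by simp
    moreover have "(\<Sum>m\<in>F0. norm (c m)) \<le> (\<Sum>m\<in>F. norm (c m))"
      by (rule sum_mono2) (use F0 in \<open>auto simp: F_def\<close>)
    ultimately show ?thesis using F0(2) unfolding dist_real_def by linarith
  qed
  have "eventually (\<lambda>t. norm (f t - ?F t) < \<epsilon> / 2) at_top"
    using tendstoD[OF lim half_gt_zero[OF \<epsilon>]] by (simp only: dist_norm diff_0_right)
  then obtain T where T: "\<forall>t\<ge>T. norm (f t - ?F t) < \<epsilon> / 2"
    unfolding eventually_at_top_linorder by blast
  define g where "g t = (\<Sum>m\<in>F. c m * e m t)" for t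
  have "norm (f t - g t) \<le> \<epsilon>" if "t \<ge> T" for t
  proof -
    have "?F t = (\<Sum>\<^sub>\<infinity>m\<in>F \<union> -F. c m * e m t)" by (simp add: Compl_partition)
    also have "\<dots> = g t + (\<Sum>\<^sub>\<infinity>m\<in>-F. c m * e m t)"
      unfolding g_def using F sumt by (subst infsum_Un_disjoint) auto
    finally have "norm (?F t - g t) = norm (\<Sum>\<^sub>\<infinity>m\<in>-F. c m * e m t)" by simp
    also have "\<dots> \<le> (\<Sum>\<^sub>\<infinity>m\<in>-F. norm (c m * e m t))"
      by (rule norm_infsum_bound) (simp only: norm_e summable_on_subset_banach[OF sum] subset_UNIV)
    also have "\<dots> \<le> \<epsilon> / 2" using tail by (simp only: norm_e)
    finally show ?thesis
      using T[rule_format, OF that] norm_triangle_ineq[of "f t - ?F t" "?F t - g t"] by simp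
  qed
  moreover have "amplitude (of_int n * \<omega>) g (c n)"
  proof -
    have "amplitude (of_int n * \<omega>) (\<lambda>t. \<Sum>m\<in>F. c m * e m t) (\<Sum>m\<in>F. c m * (if m = n then 1 else 0))"
    proof (intro amplitude_sum F amplitude_cmult)
      fix m
      show "amplitude (of_int n * \<omega>) (e m) (if m = n then 1 else 0)"
      proof -
        have "e m = (\<lambda>t. exp (\<i> * of_real (of_int m * \<omega>) * of_real t))"
          by (rule ext) (simp add: e_def mult.assoc)
        then show ?thesis using amplitude_exp[of "of_int n * \<omega>" "of_int m * \<omega>"] \<omega> by simp
      qed
    qed
    also have "(\<Sum>m\<in>F. c m * (if m = n then 1 else 0)) = c n"
      using F by (simp add: if_distrib cong: if_cong)
    finally show ?thesis unfolding g_def .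
  qed
  ultimately show "\<exists>g T. amplitude (of_int n * \<omega>) g (c n) \<and> (\<forall>t\<ge>T. norm (f t - g t) \<le> \<epsilon>)" by blast
qed

section \<open>Roots of the dispersion relation\<close>

text \<open>On the real line, with \<open>Am2 = 0\<close> or \<open>A3 = 0\<close>, this is
  \<open>(1 + Am2 * k\<^sup>2)\<^sup>2\<close> times the derivative of
  \<open>symbol A0 A1 A2 A3 k / (1 + Am2 * k\<^sup>2)\<close>, so its sign is that of the group
  velocity. Off the real line it is the factor that decides membership in
  \<open>Dplus\<close>.\<close>

definition flux_sign :: "real \<Rightarrow> real \<Rightarrow> real \<Rightarrow> real \<Rightarrow> real \<Rightarrow> complex \<Rightarrow> real" where
  "flux_sign Am2 A0 A1 A2 A3 k =
     A3 * (3 * (Re k)\<^sup>2 - (Im k)\<^sup>2) + 2 * (A2 + A0 * Am2) * Re k + A1 * (Am2 * ((Re k)\<^sup>2 + (Im k)\<^sup>2) - 1)"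

abbreviation on_frontier :: "real \<Rightarrow> real \<Rightarrow> real \<Rightarrow> real \<Rightarrow> real \<Rightarrow> complex \<Rightarrow> bool" where
  "on_frontier Am2 A0 A1 A2 A3 k \<equiv>
     Im k \<ge> 0 \<and> flux_sign Am2 A0 A1 A2 A3 k \<ge> 0 \<and> (Im k = 0 \<or> flux_sign Am2 A0 A1 A2 A3 k = 0)"

text \<open>The first root is the candidate for \<open>k0\<close>: the one in the upper half plane
  or, if all are real, the middle one, at which a cubic with \<open>A3 < 0\<close> has nonnegative
  derivative.\<close>

abbreviation cubic_roots :: "complex \<Rightarrow> complex \<Rightarrow> complex \<Rightarrow> bool" where
  "cubic_roots p q r \<equiv> Im p > 0 \<and> q = cnj p \<and> Im r = 0 \<or>
     Im p = 0 \<and> Im q = 0 \<and> Im r = 0 \<and> Re q \<le> Re p \<and> Re p \<le> Re r"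

text \<open>Multiplication by the conjugate denominator makes the sign condition in
  \<open>Dplus\<close> polynomial. All coefficients being real, the imaginary part vanishes with
  \<open>Im k\<close>, which therefore splits off.\<close>

lemma Im_dispersion:
  assumes "Am2 = 0 \<or> A3 = 0"
  shows "Im ((symbol A0 A1 A2 A3 k) * cnj (1 + of_real Am2 * k\<^sup>2)) =
    Im k * flux_sign Am2 A0 A1 A2 A3 k"
  using assms
  by (elim disjE; cases k) (simp_all add: flux_sign_def power2_eq_square power3_eq_cube algebra_simps)

text \<open>Away from the pole this is \<open>Im_dispersion\<close> divided by a positive number. At
  the pole \<open>flux_sign\<close> vanishes, in agreement with the value 0 of the quotient
  there.\<close>

lemma Dplus_iff:
  assumes A: "(Am2 = 0 \<and> A3 < 0) \<or> (Am2 > 0 \<and> A3 = 0)"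
  shows "k \<in> Dplus Am2 A0 A1 A2 A3 \<longleftrightarrow> Im k > 0 \<and> flux_sign Am2 A0 A1 A2 A3 k > 0"
proof (cases "1 + of_real Am2 * k\<^sup>2 = 0")
  case True
  then have Am2: "Am2 > 0" "A3 = 0" using A by auto
  have re: "1 + Am2 * ((Re k)\<^sup>2 - (Im k)\<^sup>2) = 0" and im: "Am2 * (2 * Re k * Im k) = 0"
    using arg_cong[OF True, of Re] arg_cong[OF True, of Im]
    by (simp_all add: Re_power2 Im_power2)
  have "Re k = 0 \<or> Im k = 0" using im Am2 by simp
  moreover have "Im k \<noteq> 0"
  proof
    assume "Im k = 0"
    then have "1 + Am2 * (Re k)\<^sup>2 = 0" using re by simp
    moreover have "Am2 * (Re k)\<^sup>2 \<ge> 0" using Am2 by simp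
    ultimately show False by linarith
  qed
  ultimately have x: "Re k = 0" by simp
  then have "Am2 * (Im k)\<^sup>2 = 1" using re by simp
  then have "flux_sign Am2 A0 A1 A2 A3 k = 0" using x Am2 by (simp add: flux_sign_def)
  then show ?thesis using True by (simp add: Dplus_def)
next
  case False
  define q where "q = 1 + of_real Am2 * k\<^sup>2"
  define P where "P = symbol A0 A1 A2 A3 k"
  have q: "(cmod q)\<^sup>2 > 0" using False by (simp add: q_def)
  have "Re (\<i> * P / q) = Re (\<i> * P * cnj q) / (cmod q)\<^sup>2"
    by (metis Re_divide_of_real complex_div_cnj of_real_power)
  also have "Re (\<i> * P * cnj q) = - Im (P * cnj q)" by simp
  also have "Im (P * cnj q) = Im k * flux_sign Am2 A0 A1 A2 A3 k"
    unfolding P_def q_def using A by (intro Im_dispersion) auto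
  finally have eq: "Re (\<i> * P / q) = - (Im k * flux_sign Am2 A0 A1 A2 A3 k) / (cmod q)\<^sup>2" .
  have "Re (\<i> * P / q) < 0 \<longleftrightarrow> Im k * flux_sign Am2 A0 A1 A2 A3 k > 0"
    unfolding eq minus_divide_left[symmetric] neg_less_0_iff_less
    using pos_less_divide_eq[OF q, of 0] by simp
  then show ?thesis unfolding Dplus_def P_def q_def by (auto simp: zero_less_mult_iff)
qed

text \<open>\<open>Dplus\<close> is open, so the question is which points are limits of it: all
  those where \<open>Im k\<close> and \<open>flux_sign\<close> are nonnegative. If
  \<open>A3 < 0\<close> or \<open>A1 > 0\<close>, moving straight up increases
  \<open>flux_sign\<close>. Otherwise \<open>flux_sign\<close> is concave, and the segment towards
  any point of \<open>Dplus\<close> enters the region at once; this is where nonemptiness is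
  used.\<close>

lemma frontier_Dplus:
  assumes A: "(Am2 = 0 \<and> A3 < 0) \<or> (Am2 > 0 \<and> A3 = 0 \<and> Dplus Am2 A0 A1 A2 A3 \<noteq> {})"
  shows "k \<in> frontier (Dplus Am2 A0 A1 A2 A3) \<longleftrightarrow>
    on_frontier Am2 A0 A1 A2 A3 k"
proof -
  let ?D = "Dplus Am2 A0 A1 A2 A3" let ?F = "flux_sign Am2 A0 A1 A2 A3"
  have D: "?D = {k. Im k > 0} \<inter> {k. ?F k > 0}"
    using Dplus_iff[of Am2 A3 _ A0 A1 A2] A by auto
  have contF: "continuous_on UNIV ?F" unfolding flux_sign_def by (intro continuous_intros)
  have "open ?D" unfolding D
    by (intro open_Int open_Collect_less continuous_intros contF)
  then have fr: "frontier ?D = closure ?D - ?D" by (simp add: frontier_def interior_open)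
  have "closed ({k. Im k \<ge> 0} \<inter> {k. ?F k \<ge> 0})"
    by (intro closed_Int closed_Collect_le continuous_intros contF)
  then have sub: "closure ?D \<subseteq> {k. Im k \<ge> 0} \<inter> {k. ?F k \<ge> 0}"
    by (rule closure_minimal[rotated]) (auto simp: D)
  have "k \<in> closure ?D" if k: "Im k \<ge> 0" "?F k \<ge> 0" for k
  proof (cases "A3 < 0 \<or> A1 > 0")
    case True
    have "k + \<i> * of_real e \<in> ?D" if e: "e > 0" for e
    proof -
      have "?F (k + \<i> * of_real e) = ?F k + (A1 * Am2 - A3) * (e * (2 * Im k + e))"
        by (simp add: flux_sign_def power2_eq_square algebra_simps)
      moreover have "A1 * Am2 - A3 > 0" using True A by auto
      moreover have "e * (2 * Im k + e) > 0" using e k by (simp add: add_nonneg_pos)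
      ultimately have "?F (k + \<i> * of_real e) > 0" using k(2) by (simp add: add_nonneg_pos)
      then show ?thesis using k e by (simp add: D)
    qed
    then have "\<exists>y\<in>?D. dist y k < e" if "e > 0" for e
    proof -
      define r where "r = e / 2"
      then show ?thesis using that \<open>\<And>e. e > 0 \<Longrightarrow> k + \<i> * of_real e \<in> ?D\<close>[of r]
        by (intro bexI[of _ "k + \<i> * of_real r"]) (auto simp: dist_norm norm_mult)
    qed
    then show ?thesis by (simp add: closure_approachable)
  next
    case False
    then have A': "Am2 > 0" "A3 = 0" "A1 \<le> 0" and "?D \<noteq> {}" using A by auto
    then obtain p where "p \<in> ?D" by blast
    then have p: "Im p > 0" "?F p > 0" by (simp_all add: D)
    have inD: "(1 - r) *\<^sub>R k + r *\<^sub>R p \<in> ?D" if r: "0 < r" "r < 1" for r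
    proof -
      have eq: "?F ((1 - r) *\<^sub>R k + r *\<^sub>R p) = (1 - r) * ?F k + r * ?F p
          - A1 * Am2 * (r * (1 - r) * ((Re k - Re p)\<^sup>2 + (Im k - Im p)\<^sup>2))"
        using A' by (simp add: flux_sign_def power2_eq_square algebra_simps)
      have "A1 * Am2 * (r * (1 - r) * ((Re k - Re p)\<^sup>2 + (Im k - Im p)\<^sup>2)) \<le> 0"
        using A' r by (intro mult_nonpos_nonneg mult_nonneg_nonneg) auto
      moreover have "(1 - r) * ?F k \<ge> 0" "r * ?F p > 0" using r k p by auto
      ultimately have "?F ((1 - r) *\<^sub>R k + r *\<^sub>R p) > 0" unfolding eq by linarith
      moreover have "Im ((1 - r) *\<^sub>R k + r *\<^sub>R p) > 0"
        using r k p by (simp add: add_nonneg_pos)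
      ultimately show ?thesis by (simp add: D)
    qed
    have "((\<lambda>r. (1 - r) *\<^sub>R k + r *\<^sub>R p) \<longlongrightarrow> (1 - 0) *\<^sub>R k + 0 *\<^sub>R p) (at_right 0)"
      by (intro tendsto_intros)
    moreover have "eventually (\<lambda>r. (1 - r) *\<^sub>R k + r *\<^sub>R p \<in> closure ?D) (at_right (0::real))"
      unfolding eventually_at_right_field
      by (intro exI[of _ 1] conjI allI impI closure_subset[THEN subsetD] inD) auto
    ultimately have "(1 - 0) *\<^sub>R k + 0 *\<^sub>R p \<in> closure ?D"
      by (intro Lim_in_closed_set[of "closure ?D"]) auto
    then show ?thesis by simp
  qed
  with sub have cl: "closure ?D = {k. Im k \<ge> 0} \<inter> {k. ?F k \<ge> 0}" by auto
  have "k \<in> ?D \<longleftrightarrow> Im k > 0 \<and> ?F k > 0" by (simp add: D)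
  then show ?thesis unfolding fr cl by auto
qed

section \<open>Factorisation of real quadratics and cubics\<close>

lemma real_cubic_root:
  fixes b c d :: real
  shows "\<exists>x. x ^ 3 + b * x\<^sup>2 + c * x + d = 0"
proof -
  \<comment> \<open>Large enough for the cubic term to dominate at \<open>M\<close> and
    \<open>- M\<close>, so that the polynomial changes sign in between.\<close>
  define M where "M = 1 + \<bar>b\<bar> + \<bar>c\<bar> + \<bar>d\<bar>"
  have M: "M \<ge> 1" by (simp add: M_def)
  have "\<bar>b * x\<^sup>2 + c * x + d\<bar> \<le> M ^ 3" if "\<bar>x\<bar> = M" for x
  proof -
    have "\<bar>b * x\<^sup>2 + c * x + d\<bar> \<le> \<bar>b * x\<^sup>2\<bar> + \<bar>c * x\<bar> + \<bar>d\<bar>" by linarith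
    also have "\<dots> = \<bar>b\<bar> * M\<^sup>2 + \<bar>c\<bar> * M + \<bar>d\<bar>"
      using that by (simp add: abs_mult power2_eq_square)
    also have "\<dots> \<le> \<bar>b\<bar> * M\<^sup>2 + \<bar>c\<bar> * M\<^sup>2 + \<bar>d\<bar> * M\<^sup>2"
    proof -
      have "M \<le> M\<^sup>2" "1 \<le> M\<^sup>2"
        using M one_le_power[OF M, of 2] mult_left_mono[of 1 M M] by (simp_all add: power2_eq_square)
      then have "\<bar>c\<bar> * M \<le> \<bar>c\<bar> * M\<^sup>2" "\<bar>d\<bar> * 1 \<le> \<bar>d\<bar> * M\<^sup>2" by (intro mult_left_mono; simp)+
      then show ?thesis by linarith
    qed
    also have "\<dots> = (M - 1) * M\<^sup>2" by (simp add: M_def algebra_simps)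
    also have "\<dots> \<le> M ^ 3" by (simp add: power2_eq_square power3_eq_cube algebra_simps)
    finally show ?thesis .
  qed
  from this[of M] this[of "- M"] M
  have "(- M) ^ 3 + b * (- M)\<^sup>2 + c * (- M) + d \<le> 0" "0 \<le> M ^ 3 + b * M\<^sup>2 + c * M + d" by auto
  then have "\<exists>x\<ge>- M. x \<le> M \<and> x ^ 3 + b * x\<^sup>2 + c * x + d = 0"
    using M by (intro IVT' continuous_intros) auto
  then show ?thesis by blast
qed

lemma real_quadratic_factor:
  fixes b c :: real
  shows "\<exists>p q :: complex. (\<forall>k. k\<^sup>2 + of_real b * k + of_real c = (k - p) * (k - q)) \<and>
     (Im p > 0 \<and> q = cnj p \<or> Im p = 0 \<and> Im q = 0 \<and> Re p \<le> Re q)"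
proof -
  have vieta: "k\<^sup>2 + B * k + C = (k - p) * (k - q)" if "p * q = C" "p + q = - B" for k p q B C :: complex
  proof -
    have "(k - p) * (k - q) = k\<^sup>2 - (p + q) * k + p * q" by (simp add: algebra_simps power2_eq_square)
    then show ?thesis using that by simp
  qed
  show ?thesis
  proof (cases "b\<^sup>2 < 4 * c")
    case True
    define p where "p = Complex (- b / 2) (sqrt (4 * c - b\<^sup>2) / 2)"
    have "(sqrt (4 * c - b\<^sup>2))\<^sup>2 = 4 * c - b\<^sup>2" using True by simp
    then have "p * cnj p = of_real c" "p + cnj p = of_real (- b)"
      by (simp_all add: p_def complex_eq_iff power2_eq_square field_simps)
    then have "k\<^sup>2 + of_real b * k + of_real c = (k - p) * (k - cnj p)" for k
      by (intro vieta) simp_all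
    moreover have "Im p > 0" using True by (simp add: p_def)
    ultimately show ?thesis by blast
  next
    case False
    define s where "s = sqrt (b\<^sup>2 - 4 * c)"
    have s: "s \<ge> 0" "s\<^sup>2 = b\<^sup>2 - 4 * c" using False by (simp_all add: s_def)
    define p where "p = complex_of_real ((- b - s) / 2)"
    define q where "q = complex_of_real ((- b + s) / 2)"
    have "((- b - s) / 2) * ((- b + s) / 2) = c" "(- b - s) / 2 + (- b + s) / 2 = - b"
      using s(2) by (simp_all add: power2_eq_square field_simps)
    then have "p * q = of_real c" "p + q = - of_real b"
      unfolding p_def q_def of_real_mult[symmetric] of_real_add[symmetric] of_real_minus[symmetric] by simp_all
    then have "k\<^sup>2 + of_real b * k + of_real c = (k - p) * (k - q)" for k
      by (intro vieta) simp_all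
    moreover have "Im p = 0" "Im q = 0" "Re p \<le> Re q" using s by (simp_all add: p_def q_def)
    ultimately show ?thesis by blast
  qed
qed

lemma real_cubic_factor:
  fixes b c d :: real
  shows "\<exists>p q r :: complex. (\<forall>k. k ^ 3 + of_real b * k\<^sup>2 + of_real c * k + of_real d = (k - p) * (k - q) * (k - r)) \<and>
     (cubic_roots p q r)"
proof -
  obtain x where x: "x ^ 3 + b * x\<^sup>2 + c * x + d = 0" using real_cubic_root by blast
  \<comment> \<open>These are the coefficients left after division by the linear factor with root
    x.\<close>
  obtain p q :: complex where pq: "\<forall>k. k\<^sup>2 + of_real (b + x) * k + of_real (c + x * (b + x)) = (k - p) * (k - q)"
     "Im p > 0 \<and> q = cnj p \<or> Im p = 0 \<and> Im q = 0 \<and> Re p \<le> Re q"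
    using real_quadratic_factor by blast
  have fact: "k ^ 3 + of_real b * k\<^sup>2 + of_real c * k + of_real d = (k - p) * (k - q) * (k - of_real x)" for k
  proof -
    have "of_real (x ^ 3 + b * x\<^sup>2 + c * x + d) = (0::complex)" using x by simp
    then have "k ^ 3 + of_real b * k\<^sup>2 + of_real c * k + of_real d =
        (k\<^sup>2 + of_real (b + x) * k + of_real (c + x * (b + x))) * (k - of_real x)"
      unfolding of_real_add of_real_mult of_real_power by algebra
    then show ?thesis using pq(1) by simp
  qed
  show ?thesis
  proof (cases "Im p > 0")
    case True
    with fact pq(2) show ?thesis by (intro exI[of _ p] exI[of _ q] exI[of _ "of_real x"]) auto
  next
    case False
    with pq(2) have real: "Im p = 0" "Im q = 0" "Re p \<le> Re q" by auto
    \<comment> \<open>The position of x relative to the other two roots; in each case the middle one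
      becomes the first root of the factorisation.\<close>
    consider "x \<le> Re p" | "Re p \<le> x" "x \<le> Re q" | "Re q \<le> x" by linarith
    then show ?thesis
    proof cases
      case 1
      then show ?thesis using fact real
        by (intro exI[of _ p] exI[of _ "of_real x"] exI[of _ q]) (auto simp: mult_ac)
    next
      case 2
      then show ?thesis using fact real
        by (intro exI[of _ "of_real x"] exI[of _ p] exI[of _ q]) (auto simp: mult_ac)
    next
      case 3
      then show ?thesis using fact real
        by (intro exI[of _ q] exI[of _ p] exI[of _ "of_real x"]) (auto simp: mult_ac)
    qed
  qed
qed

text \<open>At a root the symbol is a real multiple of \<open>1 + Am2 * k\<^sup>2\<close>, so its
  product with the conjugate of that factor is real, and \<open>Im_dispersion\<close> leaves only
  \<open>flux_sign\<close> to vanish.\<close>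

lemma flux_sign_root_upper:
  assumes "Am2 = 0 \<or> A3 = 0" "Im k > 0"
    and root: "symbol (A0 - \<nu>) A1 (A2 + \<nu> * Am2) A3 k = 0"
  shows "flux_sign Am2 A0 A1 A2 A3 k = 0"
proof -
  let ?q = "1 + of_real Am2 * k\<^sup>2"
  have "symbol A0 A1 A2 A3 k = - of_real \<nu> * ?q"
    using root by (simp add: algebra_simps)
  then have "Im k * flux_sign Am2 A0 A1 A2 A3 k = Im (- of_real \<nu> * ?q * cnj ?q)"
    using Im_dispersion[OF assms(1), of k A2 A1 A0] by simp
  also have "\<dots> = 0" by (simp only: mult.assoc complex_mult_cnj) simp
  finally show ?thesis using assms(2) by simp
qed

text \<open>The second factor is the derivative of the shifted symbol at \<open>Re k\<close>. At a
  general real point the two sides differ by a multiple of the shifted symbol, which is zero at a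
  root.\<close>

lemma flux_sign_root_real:
  assumes "Am2 = 0 \<or> A3 = 0" "Im k = 0"
    and root: "symbol (A0 - \<nu>) A1 (A2 + \<nu> * Am2) A3 k = 0"
  shows "flux_sign Am2 A0 A1 A2 A3 k =
    (1 + Am2 * (Re k)\<^sup>2) * (3 * A3 * (Re k)\<^sup>2 + 2 * (A2 + \<nu> * Am2) * Re k - A1)"
proof -
  define x where "x = Re k"
  have k: "k = of_real x" using assms(2) by (simp add: x_def complex_eq_iff)
  have "of_real (A3 * x ^ 3 + (A2 + \<nu> * Am2) * x\<^sup>2 - A1 * x - (A0 - \<nu>)) = (0::complex)"
    using root unfolding k by simp
  then have "A3 * x ^ 3 + (A2 + \<nu> * Am2) * x\<^sup>2 - A1 * x - (A0 - \<nu>) = 0"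
    unfolding of_real_eq_0_iff .
  moreover have "A3 * x ^ 3 + (A2 + \<nu> * Am2) * x\<^sup>2 - A1 * x - (A0 - \<nu>) = 0 \<Longrightarrow>
     flux_sign Am2 A0 A1 A2 A3 (of_real x) = (1 + Am2 * x\<^sup>2) * (3 * A3 * x\<^sup>2 + 2 * (A2 + \<nu> * Am2) * x - A1)"
    (is "?p = 0 \<Longrightarrow> ?L = ?R")
  proof -
    assume "?p = 0"
    moreover have "?L = ?R - 2 * Am2 * x * ?p"
      using assms(1) by (auto simp: flux_sign_def algebra_simps power2_eq_square power3_eq_cube)
    ultimately show ?thesis by simp
  qed
  ultimately show ?thesis by (simp add: k)
qed

text \<open>The condition for \<open>exp (\<i> * k * x + s * t)\<close> to solve the equation, in
  the form without division in which the global relation takes it.\<close>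

definition dispersion :: "real \<Rightarrow> real \<Rightarrow> real \<Rightarrow> real \<Rightarrow> real \<Rightarrow> complex \<Rightarrow> complex \<Rightarrow> bool" where
  "dispersion Am2 A0 A1 A2 A3 k s \<longleftrightarrow> s * (1 + of_real Am2 * k\<^sup>2) =
      - \<i> * (symbol A0 A1 A2 A3 k)"

text \<open>Factoring \<open>exp (\<i> * \<nu> * t)\<close> out of a solution changes
  \<open>A0\<close> and \<open>A2\<close> in this way. The equation for \<open>k0\<close> is thus
  the shifted relation at \<open>\<mu> = 0\<close>.\<close>

lemma dispersion_shift:
  "dispersion Am2 A0 A1 A2 A3 k (\<mu> + \<i> * of_real \<nu>) \<longleftrightarrow> \<mu> * (1 + of_real Am2 * k\<^sup>2) =
      - \<i> * (symbol (A0 - \<nu>) A1 (A2 + \<nu> * Am2) A3 k)"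
proof -
  have "(\<mu> + \<i> * of_real \<nu>) * (1 + of_real Am2 * k\<^sup>2)
      - - \<i> * (symbol A0 A1 A2 A3 k) =
    \<mu> * (1 + of_real Am2 * k\<^sup>2)
      - - \<i> * (symbol (A0 - \<nu>) A1 (A2 + \<nu> * Am2) A3 k)"
    by (simp add: algebra_simps)
  then show ?thesis unfolding dispersion_def by (metis right_minus_eq)
qed

section \<open>Selection of \<open>k0\<close> among the roots\<close>

lemma is_k0_iff:
  assumes A: "(Am2 = 0 \<and> A3 < 0) \<or> (Am2 > 0 \<and> A3 = 0 \<and> Dplus Am2 A0 A1 A2 A3 \<noteq> {})" and \<nu>: "\<nu> = of_int n * \<omega>"
  shows "is_k0 Am2 A0 A1 A2 A3 \<omega> n k \<longleftrightarrow>
    symbol (A0 - \<nu>) A1 (A2 + \<nu> * Am2) A3 k = 0 \<and>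
    on_frontier Am2 A0 A1 A2 A3 k"
  unfolding is_k0_def frontier_Dplus[OF A] \<nu> by (simp add: algebra_simps)

text \<open>The leading coefficients agree already, so comparison at 0, 1 and -1 determines the
  others. The third claim is the product rule for the factorisation, checked algebraically.\<close>

lemma cubic_vieta:
  fixes a b c d p q r :: complex
  assumes fact: "\<And>k. a * k ^ 3 + b * k\<^sup>2 - c * k - d = a * ((k - p) * (k - q) * (k - r))"
  shows "b = - a * (p + q + r)" and "c = - a * (p * q + p * r + q * r)"
    and "3 * a * k\<^sup>2 + 2 * b * k - c = a * ((k - p) * (k - q) + (k - p) * (k - r) + (k - q) * (k - r))"
proof -
  note f = fact[of 0] fact[of 1] fact[of "-1"]
  have "2 * b = 2 * (- a * (p + q + r))"
    using f by (simp add: algebra_simps) algebra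
  then show b: "b = - a * (p + q + r)" by (simp only: mult_cancel_left) simp
  have "2 * c = 2 * (- a * (p * q + p * r + q * r))"
    using f by (simp add: algebra_simps) algebra
  then show c: "c = - a * (p * q + p * r + q * r)" by (simp only: mult_cancel_left) simp
  show "3 * a * k\<^sup>2 + 2 * b * k - c = a * ((k - p) * (k - q) + (k - p) * (k - r) + (k - q) * (k - r))"
    unfolding b c by (simp add: algebra_simps power2_eq_square)
qed

text \<open>At a real root \<open>flux_sign\<close> is the derivative of the cubic, that is
  \<open>A3\<close> times the product of the differences to the other two roots. It is nonnegative
  at the middle root and negative at an outer root different from it. For a conjugate pair the upper
  root is on the frontier by \<open>flux_sign_root_upper\<close>, the lower one is out of the half
  plane, and the derivative at the real root is negative.\<close>

lemma cubic_root_selection: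
  fixes A0 A1 A2 A3 \<nu> :: real
  assumes A3: "A3 < 0"
    and fact: "\<And>k. symbol (A0 - \<nu>) A1 A2 A3 k =
        of_real A3 * ((k - p) * (k - q) * (k - r))"
    and alt: "cubic_roots p q r"
  shows "symbol (A0 - \<nu>) A1 A2 A3 k = 0 \<and>
    on_frontier 0 A0 A1 A2 A3 k \<longleftrightarrow> k = p"
    (is "?root k \<and> _ \<longleftrightarrow> _")
proof -
  let ?F = "flux_sign 0 A0 A1 A2 A3"
  have root_iff: "?root k \<longleftrightarrow> k = p \<or> k = q \<or> k = r" for k
    unfolding fact using A3 by auto
  have real: "complex_of_real (?F k) = of_real A3 * ((k - p) * (k - q) + (k - p) * (k - r) + (k - q) * (k - r))"
    if "?root k" "Im k = 0" for k
  proof -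
    have "?F k = 3 * A3 * (Re k)\<^sup>2 + 2 * A2 * Re k - A1"
      using flux_sign_root_real[of 0 A3 k A2 \<nu> A1 A0] that by simp
    moreover have "k = of_real (Re k)" using that by (simp add: complex_eq_iff)
    then have "complex_of_real (3 * A3 * (Re k)\<^sup>2 + 2 * A2 * Re k - A1) =
        3 * of_real A3 * k\<^sup>2 + 2 * of_real A2 * k - of_real A1"
      by (elim ssubst) simp
    ultimately have "complex_of_real (?F k) = 3 * of_real A3 * k\<^sup>2 + 2 * of_real A2 * k - of_real A1"
      by simp
    then show ?thesis unfolding cubic_vieta(3)[OF fact] .
  qed
  from alt show ?thesis
  proof
    assume c: "Im p > 0 \<and> q = cnj p \<and> Im r = 0"
    have "?F p = 0" using flux_sign_root_upper[of 0 A3 p A2 \<nu> A1 A0] root_iff[of p] c by simp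
    moreover have "?F r < 0"
    proof -
      have "(r - p) * (r - q) = of_real ((cmod (r - p))\<^sup>2)"
      proof -
        have "r - q = cnj (r - p)" using c by (simp add: complex_eq_iff)
        then show ?thesis by (simp only: complex_norm_square)
      qed
      then have "complex_of_real (?F r) = of_real (A3 * (cmod (r - p))\<^sup>2)"
        using real[of r] root_iff[of r] c by simp
      then have "?F r = A3 * (cmod (r - p))\<^sup>2" unfolding of_real_eq_iff .
      moreover have "r \<noteq> p" using c by auto
      ultimately show ?thesis using A3 by (simp add: mult_neg_pos)
    qed
    moreover have "Im q < 0" using c by simp
    ultimately show ?thesis using root_iff[of k] c by auto
  next
    assume c: "Im p = 0 \<and> Im q = 0 \<and> Im r = 0 \<and> Re q \<le> Re p \<and> Re p \<le> Re r"
    define P Q R where "P = Re p" "Q = Re q" "R = Re r"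
    have pqr: "p = of_real P" "q = of_real Q" "r = of_real R"
      using c by (simp_all add: P_Q_R_def complex_eq_iff)
    have ord: "Q \<le> P" "P \<le> R" using c by (simp_all add: P_Q_R_def)
    have "complex_of_real (?F p) = of_real (A3 * ((P - Q) * (P - R)))"
      "complex_of_real (?F q) = of_real (A3 * ((Q - P) * (Q - R)))"
      "complex_of_real (?F r) = of_real (A3 * ((R - P) * (R - Q)))"
      using real[of p] real[of q] real[of r] root_iff[of p] root_iff[of q] root_iff[of r] c
      by (simp_all add: pqr)
    then have F: "?F p = A3 * ((P - Q) * (P - R))" "?F q = A3 * ((Q - P) * (Q - R))" "?F r = A3 * ((R - P) * (R - Q))"
      unfolding of_real_eq_iff by blast+
    have "?F p \<ge> 0" unfolding F using A3 ord by (simp add: mult_nonpos_nonpos mult_nonneg_nonpos)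
    moreover have "q = p" if "?F q \<ge> 0"
    proof (rule ccontr)
      assume "q \<noteq> p"
      then have "Q < P" using ord pqr by auto
      then have "(Q - P) * (Q - R) > 0" using ord by (intro mult_neg_neg) auto
      then show False using that A3 unfolding F by (simp add: zero_le_mult_iff)
    qed
    moreover have "r = p" if "?F r \<ge> 0"
    proof (rule ccontr)
      assume "r \<noteq> p"
      then have "P < R" using ord pqr by auto
      then have "(R - P) * (R - Q) > 0" using ord by (intro mult_pos_pos) auto
      then show False using that A3 unfolding F by (simp add: zero_le_mult_iff)
    qed
    ultimately show ?thesis using root_iff[of k] c by auto
  qed
qed

text \<open>At the real roots p and q, \<open>flux_sign\<close> is a positive factor times the
  leading coefficient times \<open>Re p - Re q\<close> and \<open>Re q - Re p\<close> respectively.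
  Hence p is the larger root for a positive and the smaller one for a negative leading coefficient;
  the product in \<open>alt\<close> treats both signs at once.\<close>

lemma quadratic_root_selection:
  fixes A0 A1 A2 Am2 \<nu> :: real
  assumes C: "A2 + \<nu> * Am2 \<noteq> 0" and Am2: "Am2 > 0"
    and fact: "\<And>k. of_real (A2 + \<nu> * Am2) * k\<^sup>2 - of_real A1 * k - of_real (A0 - \<nu>) =
        of_real (A2 + \<nu> * Am2) * ((k - p) * (k - q))"
    and alt: "Im p > 0 \<and> q = cnj p \<or> Im p = 0 \<and> Im q = 0 \<and> (A2 + \<nu> * Am2) * (Re p - Re q) \<ge> 0"
  shows "symbol (A0 - \<nu>) A1 (A2 + \<nu> * Am2) 0 k = 0 \<and>
    on_frontier Am2 A0 A1 A2 0 k \<longleftrightarrow> k = p"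
    (is "?root k \<and> _ \<longleftrightarrow> _")
proof -
  let ?F = "flux_sign Am2 A0 A1 A2 0" and ?C = "A2 + \<nu> * Am2"
  have fact': "of_real 0 * k ^ 3 + of_real ?C * k\<^sup>2 - of_real A1 * k - of_real (A0 - \<nu>) =
      of_real ?C * ((k - p) * (k - q))" for k
    using fact[of k] by simp
  have root_iff: "?root k \<longleftrightarrow> k = p \<or> k = q" for k
    unfolding fact' using C by (simp only: mult_eq_0_iff of_real_eq_0_iff right_minus_eq simp_thms)
  from alt show ?thesis
  proof
    assume c: "Im p > 0 \<and> q = cnj p"
    have "?F p = 0" using flux_sign_root_upper[of Am2 0 p A2 \<nu> A1 A0] root_iff[of p] c by simp
    moreover have "Im q < 0" using c by simp
    ultimately show ?thesis using root_iff[of k] c by auto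
  next
    assume c: "Im p = 0 \<and> Im q = 0 \<and> ?C * (Re p - Re q) \<ge> 0"
    define P Q where "P = Re p" "Q = Re q"
    have pq: "p = of_real P" "q = of_real Q" using c by (simp_all add: P_Q_def complex_eq_iff)
    have "complex_of_real (?C * x\<^sup>2 - A1 * x - (A0 - \<nu>)) = of_real (?C * ((x - P) * (x - Q)))" for x
      using fact[of "of_real x"] unfolding pq by simp
    then have f: "?C * x\<^sup>2 - A1 * x - (A0 - \<nu>) = ?C * ((x - P) * (x - Q))" for x
      unfolding of_real_eq_iff .
    have A1: "A1 = ?C * (P + Q)"
      using f[of 1] f[of "-1"] by (simp add: algebra_simps)
    have F: "?F k = (1 + Am2 * (Re k)\<^sup>2) * (2 * ?C * Re k - A1)" if "k = p \<or> k = q" for k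
      using flux_sign_root_real[of Am2 0 k A2 \<nu> A1 A0] root_iff[of k] that c by auto
    have Fpq: "?F p = (1 + Am2 * P\<^sup>2) * (?C * (P - Q))" "?F q = - ((1 + Am2 * Q\<^sup>2) * (?C * (P - Q)))"
      using F[of p] F[of q] unfolding A1 by (simp_all add: pq algebra_simps)
    have pos: "1 + Am2 * x\<^sup>2 > 0" for x using Am2 by (simp add: add_pos_nonneg)
    have CPQ: "?C * (P - Q) \<ge> 0" using c by (simp add: P_Q_def)
    have Fp: "?F p \<ge> 0" unfolding Fpq by (rule mult_nonneg_nonneg[OF less_imp_le[OF pos] CPQ])
    have Fq: "q = p" if "?F q \<ge> 0"
    proof -
      have "?C * (P - Q) = 0"
      proof (rule ccontr)
        assume "?C * (P - Q) \<noteq> 0"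
        then have "(1 + Am2 * Q\<^sup>2) * (?C * (P - Q)) > 0" using CPQ by (intro mult_pos_pos[OF pos]) linarith
        then show False using that unfolding Fpq by linarith
      qed
      then show ?thesis using C pq by simp
    qed
    show ?thesis
    proof
      assume k: "?root k \<and> Im k \<ge> 0 \<and> ?F k \<ge> 0 \<and> (Im k = 0 \<or> ?F k = 0)"
      then have "k = p \<or> k = q" using root_iff by blast
      then show "k = p" using Fq k by blast
    next
      assume "k = p"
      then show "?root k \<and> Im k \<ge> 0 \<and> ?F k \<ge> 0 \<and> (Im k = 0 \<or> ?F k = 0)"
        using root_iff[of p] Fp c by simp
    qed
  qed
qed

text \<open>Says that l is a limit of points at which the bound on the boundary transform is
  available, with frequencies tending to \<open>\<i> * of_real \<nu>\<close> inside the cone, as an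
  Abelian mean demands.\<close>

definition approachable :: "real \<Rightarrow> real \<Rightarrow> real \<Rightarrow> real \<Rightarrow> real \<Rightarrow> real \<Rightarrow> complex \<Rightarrow> bool" where
  "approachable Am2 A0 A1 A2 A3 \<nu> l \<longleftrightarrow> (\<exists>\<kappa> \<mu> :: real \<Rightarrow> complex.
     (\<kappa> \<longlongrightarrow> l) (at_right 0) \<and> filterlim \<mu> (at 0 within cone) (at_right 0) \<and>
     (\<forall>\<^sub>F \<delta> in at_right 0. Im (\<kappa> \<delta>) < 0 \<and> dispersion Am2 A0 A1 A2 A3 (\<kappa> \<delta>) (\<mu> \<delta> + \<i> * of_real \<nu>)))"

text \<open>Near a root of multiplicity m the dispersion relation reads
  \<open>\<mu> = - \<i> * ((k - l) ^ m * h k)\<close>. Along \<open>k = l + \<delta> * d\<close>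
  this is asymptotic to \<open>\<delta> ^ m * \<rho>\<close>, so a direction d with positive
  \<open>\<rho>\<close> brings \<open>\<mu>\<close> into the cone. For real l the direction also has
  to point downwards.\<close>

lemma approachableI:
  fixes d l :: complex and h :: "complex \<Rightarrow> complex"
  assumes h: "isCont h l" and m: "m > 0" and \<rho>: "- \<i> * d ^ m * h l = of_real \<rho>" "\<rho> > 0"
    and low: "Im l < 0 \<or> Im l = 0 \<and> Im d < 0"
    and disp: "\<forall>\<^sub>F k in nhds l. dispersion Am2 A0 A1 A2 A3 k (- \<i> * ((k - l) ^ m * h k) + \<i> * of_real \<nu>)"
  shows "approachable Am2 A0 A1 A2 A3 \<nu> l"
proof -
  define \<kappa> where "\<kappa> \<delta> = l + of_real \<delta> * d" for \<delta> :: real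
  define w where "w \<delta> = - \<i> * d ^ m * h (\<kappa> \<delta>)" for \<delta>
  define \<mu> where "\<mu> \<delta> = of_real (\<delta> ^ m) * w \<delta>" for \<delta> :: real
  have "(\<kappa> \<longlongrightarrow> l + of_real 0 * d) (at_right 0)"
    unfolding \<kappa>_def by (intro tendsto_intros)
  then have \<kappa>: "(\<kappa> \<longlongrightarrow> l) (at_right 0)" by simp
  have "(w \<longlongrightarrow> - \<i> * d ^ m * h l) (at_right 0)"
    unfolding w_def by (intro tendsto_intros isCont_tendsto_compose[OF h \<kappa>])
  then have w: "(w \<longlongrightarrow> of_real \<rho>) (at_right 0)" unfolding \<rho> .
  have "(\<mu> \<longlongrightarrow> of_real (0 ^ m) * of_real \<rho>) (at_right 0)"
    unfolding \<mu>_def by (intro tendsto_intros w)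
  then have \<mu>0: "(\<mu> \<longlongrightarrow> 0) (at_right 0)" using m by (simp add: zero_power)
  have pos: "\<forall>\<^sub>F \<delta> in at_right 0. \<delta> > (0::real)" by (rule eventually_at_right_less)
  have "\<forall>\<^sub>F \<delta> in at_right 0. dist (w \<delta>) (of_real \<rho>) < \<rho> / 4"
    using tendstoD[OF w, of "\<rho> / 4"] \<rho> by simp
  then have "\<forall>\<^sub>F \<delta> in at_right 0. \<mu> \<delta> \<in> cone \<and> \<mu> \<delta> \<noteq> 0"
    using pos
  proof eventually_elim
    case (elim \<delta>)
    have n: "norm (w \<delta> - of_real \<rho>) < \<rho> / 4" using elim by (simp add: dist_norm)
    have "\<bar>Re (w \<delta> - of_real \<rho>)\<bar> < \<rho> / 4" using abs_Re_le_cmod[of "w \<delta> - of_real \<rho>"] n by linarith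
    then have "\<bar>Re (w \<delta>) - \<rho>\<bar> < \<rho> / 4" by simp
    then have re: "Re (w \<delta>) > 3 * \<rho> / 4" by linarith
    have "norm (w \<delta>) \<le> norm (w \<delta> - of_real \<rho>) + norm (complex_of_real \<rho>)"
      by (metis diff_add_cancel norm_triangle_ineq)
    then have "norm (w \<delta>) \<le> 2 * Re (w \<delta>)" using n re \<rho>(2) by simp
    then have "\<delta> ^ m * norm (w \<delta>) \<le> \<delta> ^ m * (2 * Re (w \<delta>))" using elim by (intro mult_left_mono) auto
    then have "\<mu> \<delta> \<in> cone" using elim by (simp add: cone_def \<mu>_def norm_mult norm_power)
    moreover have "w \<delta> \<noteq> 0" using re \<rho>(2) by auto
    then have "\<mu> \<delta> \<noteq> 0" using elim by (simp add: \<mu>_def)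
    ultimately show ?case by simp
  qed
  with \<mu>0 have 1: "filterlim \<mu> (at 0 within cone) (at_right 0)"
    unfolding filterlim_at by simp
  have 2: "\<forall>\<^sub>F \<delta> in at_right 0. Im (\<kappa> \<delta>) < 0"
    using low
  proof
    assume "Im l < 0"
    moreover have "((\<lambda>\<delta>. Im (\<kappa> \<delta>)) \<longlongrightarrow> Im l) (at_right 0)" by (intro tendsto_intros \<kappa>)
    ultimately show ?thesis by (rule order_tendstoD(2)[rotated])
  next
    assume "Im l = 0 \<and> Im d < 0"
    then show ?thesis
      by (intro eventually_mono[OF pos]) (simp add: \<kappa>_def mult_pos_neg)
  qed
  have 3: "\<forall>\<^sub>F \<delta> in at_right 0. dispersion Am2 A0 A1 A2 A3 (\<kappa> \<delta>) (\<mu> \<delta> + \<i> * of_real \<nu>)"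
  proof (rule eventually_mono[OF eventually_compose_filterlim[OF disp \<kappa>]])
    fix \<delta>
    have "- \<i> * ((\<kappa> \<delta> - l) ^ m * h (\<kappa> \<delta>)) = \<mu> \<delta>"
      by (simp add: \<kappa>_def \<mu>_def w_def power_mult_distrib)
    then show "dispersion Am2 A0 A1 A2 A3 (\<kappa> \<delta>) (- \<i> * ((\<kappa> \<delta> - l) ^ m * h (\<kappa> \<delta>)) + \<i> * of_real \<nu>) \<Longrightarrow>
        dispersion Am2 A0 A1 A2 A3 (\<kappa> \<delta>) (\<mu> \<delta> + \<i> * of_real \<nu>)" by (simp only:)
  qed
  show ?thesis unfolding approachable_def
    by (intro exI conjI) (rule \<kappa>, rule 1, rule eventually_conj[OF 2 3])
qed

text \<open>The direction \<open>\<i> / h l\<close> makes \<open>\<rho> = 1\<close>. At a real root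
  it points downwards exactly when \<open>Re (h l) < 0\<close>, which in the applications means
  negative group velocity.\<close>

lemma approachable_simple:
  assumes h: "isCont h l" and low: "Im l < 0 \<and> h l \<noteq> 0 \<or> Im l = 0 \<and> Re (h l) < 0"
    and disp: "\<forall>\<^sub>F k in nhds l. dispersion Am2 A0 A1 A2 A3 k (- \<i> * ((k - l) * h k) + \<i> * of_real \<nu>)"
  shows "approachable Am2 A0 A1 A2 A3 \<nu> l"
proof (rule approachableI[where m = 1 and \<rho> = 1 and d = "\<i> / h l", OF h])
  have nz: "h l \<noteq> 0" using low by auto
  then show "- \<i> * (\<i> / h l) ^ 1 * h l = of_real 1" by simp
  show "Im l < 0 \<or> Im l = 0 \<and> Im (\<i> / h l) < 0"
    using low nz by (auto simp: Im_divide divide_less_0_iff sum_power2_gt_zero_iff complex_eq_iff)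
qed (use disp in simp_all)

text \<open>At a double root d and \<open>- d\<close> serve equally well, and one of them points
  downwards whatever the sign of \<open>\<eta>\<close>. The witnesses are the square roots of
  \<open>2 * \<i>\<close> and \<open>- 2 * \<i>\<close> in the lower half plane.\<close>

lemma approachable_double:
  assumes h: "isCont h l" and l: "Im l = 0" and real: "h l = of_real \<eta>" "\<eta> \<noteq> 0"
    and disp: "\<forall>\<^sub>F k in nhds l. dispersion Am2 A0 A1 A2 A3 k (- \<i> * ((k - l)\<^sup>2 * h k) + \<i> * of_real \<nu>)"
  shows "approachable Am2 A0 A1 A2 A3 \<nu> l"
proof (cases "\<eta> > 0")
  case True
  show ?thesis
  proof (rule approachableI[where m = 2 and \<rho> = "2 * \<eta>" and d = "Complex (- 1) (- 1)", OF h])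
    show "- \<i> * (Complex (- 1) (- 1))\<^sup>2 * h l = of_real (2 * \<eta>)"
      unfolding real by (simp add: complex_eq_iff power2_eq_square)
  qed (use True l disp in simp_all)
next
  case False
  show ?thesis
  proof (rule approachableI[where m = 2 and \<rho> = "- 2 * \<eta>" and d = "Complex 1 (- 1)", OF h])
    show "- \<i> * (Complex 1 (- 1))\<^sup>2 * h l = of_real (- 2 * \<eta>)"
      unfolding real by (simp add: complex_eq_iff power2_eq_square)
  qed (use False real l disp in simp_all)
qed

lemma filterlim_cone_simps:
  assumes "filterlim \<mu> (at 0 within cone) F"
  shows "(\<mu> \<longlongrightarrow> 0) F" and "\<forall>\<^sub>F x in F. Re (\<mu> x) > 0" and "\<forall>\<^sub>F x in F. \<mu> x \<noteq> 0"
proof -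
  show "(\<mu> \<longlongrightarrow> 0) F" using assms filterlim_at by blast
  show re: "\<forall>\<^sub>F x in F. Re (\<mu> x) > 0"
    by (rule eventually_mono[OF eventually_compose_filterlim[OF eventually_cone assms]]) simp
  show "\<forall>\<^sub>F x in F. \<mu> x \<noteq> 0" by (rule eventually_mono[OF re]) auto
qed

lemma amplitude_compose:
  assumes "amplitude \<nu> f L" "filterlim \<mu> (at 0 within cone) F"
  shows "((\<lambda>x. \<mu> x * laplace f (\<mu> x + \<i> * of_real \<nu>)) \<longlongrightarrow> L) F"
  by (rule filterlim_compose[OF _ assms(2)]) (use assms(1) in \<open>simp add: amplitude_def\<close>)

lemma laplace_flux:
  assumes "bdd_cont g0" "bdd_cont g1" "bdd_cont g2" "Re z > 0"
  shows "laplace (\<lambda>t. flux Am2 A1 A2 A3 k s (g0 t) (g1 t) (g2 t)) z =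
    flux Am2 A1 A2 A3 k s (laplace g0 z) (laplace g1 z) (laplace g2 z)"
  unfolding flux_def using assms
  by (simp add: laplace_add laplace_cmult bdd_cont_add bdd_cont_cmult)

lemma flux_mult:
  "c * flux Am2 A1 A2 A3 k s w0 w1 w2 = flux Am2 A1 A2 A3 k s (c * w0) (c * w1) (c * w2)"
  by (simp add: flux_def algebra_simps)

text \<open>Multiplied by \<open>\<mu>\<close>, the transforms of \<open>g0\<close>,
  \<open>g1\<close> and \<open>g2\<close> tend to their amplitudes, whereas the transform of the
  flux, bounded by the same M along the whole approach, tends to zero. Linearity of the flux
  identifies the two limits.\<close>

lemma boundary_relation:
  assumes g: "amplitude \<nu> g0 B0" "amplitude \<nu> g1 B1" "amplitude \<nu> g2 B2"
    and bd: "\<And>k s. Im k < 0 \<Longrightarrow> Re s > 0 \<Longrightarrow> dispersion Am2 A0 A1 A2 A3 k s \<Longrightarrow>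
      norm (laplace (\<lambda>t. flux Am2 A1 A2 A3 k s (g0 t) (g1 t) (g2 t)) s) \<le> M"
    and l: "approachable Am2 A0 A1 A2 A3 \<nu> l"
  shows "flux Am2 A1 A2 A3 l (\<i> * of_real \<nu>) B0 B1 B2 = 0"
proof -
  obtain \<kappa> \<mu> :: "real \<Rightarrow> complex" where \<kappa>: "(\<kappa> \<longlongrightarrow> l) (at_right 0)"
    and \<mu>: "filterlim \<mu> (at 0 within cone) (at_right 0)"
    and ev: "\<forall>\<^sub>F \<delta> in at_right 0. Im (\<kappa> \<delta>) < 0 \<and> dispersion Am2 A0 A1 A2 A3 (\<kappa> \<delta>) (\<mu> \<delta> + \<i> * of_real \<nu>)"
    using l unfolding approachable_def by (elim exE conjE)
  have bc: "bdd_cont g0" "bdd_cont g1" "bdd_cont g2"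
    using g by (simp_all add: amplitude_def)
  note \<mu>' = filterlim_cone_simps[OF \<mu>]
  let ?s = "\<lambda>\<delta>. \<mu> \<delta> + \<i> * of_real \<nu>"
  let ?b = "\<lambda>\<delta>. flux Am2 A1 A2 A3 (\<kappa> \<delta>) (?s \<delta>) (\<mu> \<delta> * laplace g0 (?s \<delta>))
     (\<mu> \<delta> * laplace g1 (?s \<delta>)) (\<mu> \<delta> * laplace g2 (?s \<delta>))"
  have "(?b \<longlongrightarrow> flux Am2 A1 A2 A3 l (0 + \<i> * of_real \<nu>) B0 B1 B2) (at_right 0)"
    unfolding flux_def by (intro tendsto_intros \<kappa> \<mu>'(1) amplitude_compose[OF _ \<mu>] g)
  moreover have "(?b \<longlongrightarrow> 0) (at_right 0)"
  proof (rule Lim_null_comparison)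
    show "\<forall>\<^sub>F \<delta> in at_right 0. norm (?b \<delta>) \<le> norm (\<mu> \<delta>) * M"
      using ev \<mu>'(2)
    proof eventually_elim
      case (elim \<delta>)
      have "?b \<delta> = \<mu> \<delta> * laplace (\<lambda>t. flux Am2 A1 A2 A3 (\<kappa> \<delta>) (?s \<delta>) (g0 t) (g1 t) (g2 t)) (?s \<delta>)"
        using elim by (subst laplace_flux[OF bc]) (simp_all add: flux_mult)
      then show ?case using bd[of "\<kappa> \<delta>" "?s \<delta>"] elim by (simp add: norm_mult mult_left_mono)
    qed
    show "((\<lambda>\<delta>. norm (\<mu> \<delta>) * M) \<longlongrightarrow> 0) (at_right 0)"
      using tendsto_mult_left_zero[OF tendsto_norm_zero[OF \<mu>'(1)]] .
  qed
  ultimately have "flux Am2 A1 A2 A3 l (0 + \<i> * of_real \<nu>) B0 B1 B2 = 0"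
    by (rule tendsto_unique[OF trivial_limit_at_right_real])
  then show ?thesis by simp
qed

section \<open>Fourier coefficients of the boundary values\<close>

lemma bdd_cont_flux:
  assumes "bdd_cont g0" "bdd_cont g1" "bdd_cont g2"
  shows "bdd_cont (\<lambda>t. flux Am2 A1 A2 A3 k s (g0 t) (g1 t) (g2 t))"
  unfolding flux_def using assms by (intro bdd_cont_add bdd_cont_cmult)

text \<open>Bounded boundary values feed the energy estimate of the case at hand; the limit in T
  then turns the bound for finite times into one for the transform.\<close>

lemma laplace_flux_bounded:
  assumes A: "Am2 = 0 \<or> Am2 > 0 \<and> A3 = 0"
    and u: "smooth u" and dec: "decaying u" and pde: "satisfies_pde Am2 A0 A1 A2 A3 u"
    and bc: "\<And>j. bdd_cont (\<lambda>t. (dx ^^ j) u 0 t)"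
  shows "\<exists>M. \<forall>k s. Im k < 0 \<longrightarrow> Re s > 0 \<longrightarrow> dispersion Am2 A0 A1 A2 A3 k s \<longrightarrow>
    norm (laplace (\<lambda>t. flux_at Am2 A1 A2 A3 k s u 0 t) s) \<le> M"
proof -
  have Am2: "Am2 \<ge> 0" using A by auto
  have bc': "bdd_cont (u 0)" "bdd_cont (dx u 0)" "bdd_cont (dx (dx u) 0)"
    using bc[of 0] bc[of 1] bc[of 2] by (simp_all add: numeral_2_eq_2)
  obtain G0 where G0: "\<And>t. t \<ge> 1 \<Longrightarrow> norm (u 0 t) \<le> G0" using bdd_contE[OF bc'(1)] by metis
  obtain G1 where G1: "\<And>t. t \<ge> 1 \<Longrightarrow> norm (dx u 0 t) \<le> G1" using bdd_contE[OF bc'(2)] by metis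
  obtain G2 where G2: "\<And>t. t \<ge> 1 \<Longrightarrow> norm (dx (dx u) 0 t) \<le> G2" using bdd_contE[OF bc'(3)] by metis
  have energy: "energy_bound Am2 u (dx u) \<eta>"
    if \<eta>: "\<eta> > 0" for \<eta>
    using A
  proof
    assume Am2: "Am2 = 0"
    have "norm ((dx ^^ j) u 0 t) \<le> max G0 (max G1 G2)" if "t \<ge> 1" "j \<le> 2" for t j
    proof -
      have "j = 0 \<or> j = 1 \<or> j = 2" using that(2) by linarith
      then show ?thesis using G0[OF that(1)] G1[OF that(1)] G2[OF that(1)] by (auto simp: numeral_2_eq_2)
    qed
    from energy_growth_local[OF u dec pde[unfolded Am2] this \<eta>] show ?thesis unfolding Am2 .
  next
    assume "Am2 > 0 \<and> A3 = 0"
    then have Am2: "Am2 > 0" and A3: "A3 = 0" by auto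
    from energy_growth_nonlocal[OF u dec pde[unfolded A3] Am2 G0 \<eta>] show ?thesis .
  qed
  have "\<exists>M. \<forall>k s. Im k < 0 \<longrightarrow> Re s > 0 \<longrightarrow> dispersion Am2 A0 A1 A2 A3 k s \<longrightarrow>
     (\<exists>K. \<exists>r>0. \<forall>T\<ge>1. norm (integral {1..T} (\<lambda>t. exp (- s * of_real t) *
        flux_at Am2 A1 A2 A3 k s u 0 t)) \<le> M + K * exp (- (r * T)))"
    unfolding dispersion_def by (rule boundary_transform_bound[OF u dec pde Am2 energy G1])
  then obtain M where M: "\<forall>k s. Im k < 0 \<longrightarrow> Re s > 0 \<longrightarrow> dispersion Am2 A0 A1 A2 A3 k s \<longrightarrow>
     (\<exists>K. \<exists>r>0. \<forall>T\<ge>1. norm (integral {1..T} (\<lambda>t. exp (- s * of_real t) *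
        flux_at Am2 A1 A2 A3 k s u 0 t)) \<le> M + K * exp (- (r * T)))"
    by (elim exE)
  have "norm (laplace (\<lambda>t. flux_at Am2 A1 A2 A3 k s u 0 t) s) \<le> M"
    if k: "Im k < 0" and s: "Re s > 0" and d: "dispersion Am2 A0 A1 A2 A3 k s" for k s
  proof -
    obtain K r where r: "r > 0" and K: "\<forall>T\<ge>1. norm (integral {1..T} (\<lambda>t. exp (- s * of_real t) *
        flux_at Am2 A1 A2 A3 k s u 0 t)) \<le> M + K * exp (- (r * T))"
      using M[rule_format, OF k s d] by (elim exE conjE)
    show ?thesis
      by (rule norm_laplace_le[OF bdd_cont_flux[OF bc'] s K[rule_format] r])
  qed
  then show ?thesis by (intro exI[of _ M] allI impI)
qed

text \<open>At a triple root the two lower branches of the cube root tend to the same limit, so the second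
  relation is the limit of their divided difference.\<close>

lemma triple_root_relation:
  assumes A3: "A3 < 0"
    and fact: "\<And>k. symbol (A0 - \<nu>) A1 A2 A3 k =
        of_real A3 * (k - p) ^ 3"
    and p: "Im p = 0"
    and g: "amplitude \<nu> g0 B0" "amplitude \<nu> g1 B1" "amplitude \<nu> g2 B2"
    and bd: "\<And>k s. Im k < 0 \<Longrightarrow> Re s > 0 \<Longrightarrow> dispersion 0 A0 A1 A2 A3 k s \<Longrightarrow>
      norm (laplace (\<lambda>t. flux 0 A1 A2 A3 k s (g0 t) (g1 t) (g2 t)) s) \<le> M"
  shows "flux 0 A1 A2 A3 p (\<i> * of_real \<nu>) B0 B1 B2 = 0"
    and "\<i> * of_real A3 * B1 - (of_real A2 + of_real A3 * (p + p)) * B0 = 0"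
proof -
  \<comment> \<open>The two cube roots of \<open>- \<i>\<close> in the lower half plane,
    \<open>exp (- \<i> * pi / 6)\<close> and \<open>exp (- 5 * \<i> * pi / 6)\<close>; the third one
    is \<open>\<i>\<close>.\<close>
  define d where "d = Complex (sqrt 3 / 2) (- 1 / 2)"
  define d' where "d' = Complex (- sqrt 3 / 2) (- 1 / 2)"
  have s3: "sqrt 3 * sqrt 3 = 3" "sqrt 3 * (sqrt 3 * x) = 3 * x" for x :: real
    by (simp_all flip: mult.assoc)
  have d3: "d ^ 3 = - \<i>" "d' ^ 3 = - \<i>"
    by (simp_all add: d_def d'_def complex_eq_iff power3_eq_cube s3 algebra_simps)
  have disp: "dispersion 0 A0 A1 A2 A3 k (- \<i> * (of_real A3 * (k - p) ^ 3) + \<i> * of_real \<nu>)" for k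
    unfolding dispersion_shift using fact[of k] by simp
  have "approachable 0 A0 A1 A2 A3 \<nu> p"
  proof (rule approachableI[where m = 3 and d = d and h = "\<lambda>_. of_real A3" and \<rho> = "- A3"])
    show "\<forall>\<^sub>F k in nhds p. dispersion 0 A0 A1 A2 A3 k (- \<i> * ((k - p) ^ 3 * of_real A3) + \<i> * of_real \<nu>)"
      using disp by (simp add: mult.commute)
  qed (use d3 A3 p in \<open>simp_all add: d_def\<close>)
  from boundary_relation[OF g bd this] show "flux 0 A1 A2 A3 p (\<i> * of_real \<nu>) B0 B1 B2 = 0" .
  \<comment> \<open>Both branches belong to this one positive \<open>\<mu>\<close>, so the same
    transforms of \<open>g0\<close>, \<open>g1\<close> and \<open>g2\<close> occur in the two fluxes
    that are subtracted.\<close>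
  define \<mu> where "\<mu> \<delta> = complex_of_real (- A3 * \<delta> ^ 3)" for \<delta> :: real
  define \<kappa> where "\<kappa> c \<delta> = p + of_real \<delta> * c" for c and \<delta> :: real
  have \<kappa>: "(\<kappa> c \<longlongrightarrow> p) (at_right 0)" for c
  proof -
    have "(\<kappa> c \<longlongrightarrow> p + of_real 0 * c) (at_right 0)" unfolding \<kappa>_def by (intro tendsto_intros)
    then show ?thesis by simp
  qed
  have pos: "\<forall>\<^sub>F \<delta> in at_right 0. \<delta> > (0::real)" by (rule eventually_at_right_less)
  have \<mu>: "filterlim \<mu> (at 0 within cone) (at_right 0)"
    unfolding filterlim_at
  proof
    have "(\<mu> \<longlongrightarrow> of_real (- A3 * 0 ^ 3)) (at_right 0)" unfolding \<mu>_def by (intro tendsto_intros)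
    then show "(\<mu> \<longlongrightarrow> 0) (at_right 0)" by simp
    show "\<forall>\<^sub>F \<delta> in at_right 0. \<mu> \<delta> \<in> cone \<and> \<mu> \<delta> \<noteq> 0"
      by (rule eventually_mono[OF pos])
         (use A3 in \<open>simp add: \<mu>_def cone_def norm_mult norm_power mult_nonpos_nonneg del: of_real_mult of_real_minus\<close>)
  qed
  have bc: "bdd_cont g0" "bdd_cont g1" "bdd_cont g2"
    using g by (simp_all add: amplitude_def)
  let ?s = "\<lambda>\<delta>. \<mu> \<delta> + \<i> * of_real \<nu>"
  let ?L = "\<lambda>g \<delta>. \<mu> \<delta> * laplace g (?s \<delta>)"
  let ?R = "\<lambda>\<delta>. \<i> * of_real A3 * ?L g1 \<delta> - (of_real A2 + of_real A3 * (\<kappa> d \<delta> + \<kappa> d' \<delta>)) * ?L g0 \<delta>"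
  have "(?R \<longlongrightarrow> \<i> * of_real A3 * B1 - (of_real A2 + of_real A3 * (p + p)) * B0) (at_right 0)"
    by (intro tendsto_intros \<kappa> amplitude_compose[OF _ \<mu>] g)
  moreover have "(?R \<longlongrightarrow> 0) (at_right 0)"
  proof (rule Lim_null_comparison)
    show "\<forall>\<^sub>F \<delta> in at_right 0. norm (?R \<delta>) \<le> - A3 * \<delta>\<^sup>2 * (2 * M)"
      using pos filterlim_cone_simps(2)[OF \<mu>]
    proof eventually_elim
      case (elim \<delta>)
      have b: "norm (flux 0 A1 A2 A3 (\<kappa> c \<delta>) (?s \<delta>) (?L g0 \<delta>) (?L g1 \<delta>) (?L g2 \<delta>)) \<le> norm (\<mu> \<delta>) * M"
        if c: "c ^ 3 = - \<i>" "Im c < 0" for c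
      proof -
        have "- \<i> * (of_real A3 * (\<kappa> c \<delta> - p) ^ 3) = - \<i> * c ^ 3 * of_real (A3 * \<delta> ^ 3)"
          by (simp add: \<kappa>_def power_mult_distrib)
        also have "\<dots> = \<mu> \<delta>" unfolding c(1) by (simp add: \<mu>_def)
        finally have "- \<i> * (of_real A3 * (\<kappa> c \<delta> - p) ^ 3) = \<mu> \<delta>" .
        then have "dispersion 0 A0 A1 A2 A3 (\<kappa> c \<delta>) (?s \<delta>)" using disp[of "\<kappa> c \<delta>"] by (simp only:)
        moreover have "Im (\<kappa> c \<delta>) < 0" using p c elim by (simp add: \<kappa>_def mult_pos_neg)
        ultimately have "norm (laplace (\<lambda>t. flux 0 A1 A2 A3 (\<kappa> c \<delta>) (?s \<delta>) (g0 t) (g1 t) (g2 t)) (?s \<delta>)) \<le> M"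
          using elim by (intro bd) auto
        then show ?thesis
          using elim by (subst (asm) laplace_flux[OF bc])
            (simp_all add: norm_mult mult_left_mono flip: flux_mult)
      qed
      \<comment> \<open>The flux is quadratic in k, so the difference factors. Each flux is of order
        \<open>\<delta> ^ 3\<close> and the divisor is \<open>\<delta> * sqrt 3\<close>, which
        leaves order \<open>\<delta>\<^sup>2\<close> for \<open>?R\<close>.\<close>
      have eq: "flux 0 A1 A2 A3 (\<kappa> d \<delta>) (?s \<delta>) (?L g0 \<delta>) (?L g1 \<delta>) (?L g2 \<delta>) -
          flux 0 A1 A2 A3 (\<kappa> d' \<delta>) (?s \<delta>) (?L g0 \<delta>) (?L g1 \<delta>) (?L g2 \<delta>) =
          (\<kappa> d \<delta> - \<kappa> d' \<delta>) * ?R \<delta>"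
        unfolding flux_def by (simp add: algebra_simps power2_eq_square)
      have dd: "\<kappa> d \<delta> - \<kappa> d' \<delta> = of_real (\<delta> * sqrt 3)"
        by (simp add: \<kappa>_def d_def d'_def complex_eq_iff)
      have "\<delta> * norm (?R \<delta>) \<le> (\<delta> * sqrt 3) * norm (?R \<delta>)"
        using elim by (intro mult_right_mono) auto
      also have "\<dots> = norm ((\<kappa> d \<delta> - \<kappa> d' \<delta>) * ?R \<delta>)"
        unfolding dd norm_mult using elim by (simp add: norm_mult)
      also have "\<dots> \<le> norm (\<mu> \<delta>) * M + norm (\<mu> \<delta>) * M"
        unfolding eq[symmetric]
        by (rule order_trans[OF norm_triangle_ineq4]) (intro add_mono b d3; simp add: d_def d'_def)
      also have "norm (\<mu> \<delta>) = - A3 * \<delta> ^ 3"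
        using elim A3 unfolding \<mu>_def norm_of_real by (simp add: abs_mult)
      also have "- A3 * \<delta> ^ 3 * M + - A3 * \<delta> ^ 3 * M = \<delta> * (- A3 * \<delta>\<^sup>2 * (2 * M))"
        by (simp add: power2_eq_square power3_eq_cube)
      finally show ?case using elim by (simp only: mult_le_cancel_left_pos)
    qed
    have "((\<lambda>\<delta>. - A3 * \<delta>\<^sup>2 * (2 * M)) \<longlongrightarrow> - A3 * 0\<^sup>2 * (2 * M)) (at_right 0)"
      by (intro tendsto_intros)
    then show "((\<lambda>\<delta>. - A3 * \<delta>\<^sup>2 * (2 * M)) \<longlongrightarrow> 0) (at_right 0)" by simp
  qed
  ultimately show "\<i> * of_real A3 * B1 - (of_real A2 + of_real A3 * (p + p)) * B0 = 0"
    by (rule tendsto_unique[OF trivial_limit_at_right_real])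
qed

text \<open>A simple root in the lower half plane can be reached along any direction, a simple real
  one needs a negative derivative of the cubic, and \<open>q = p\<close> makes q the second copy of
  a double real root.\<close>

lemma cubic_other_root_approachable:
  fixes p q r :: complex
  assumes A3: "A3 < 0"
    and fact: "\<And>k. symbol (A0 - \<nu>) A1 A2 A3 k =
        of_real A3 * ((k - p) * (k - q) * (k - r))"
    and alt: "Im q < 0 \<or> Im q = 0 \<and> q \<noteq> p \<and> Re ((q - p) * (q - r)) > 0 \<or> Im q = 0 \<and> Im r = 0 \<and> q = p"
    and ne: "q \<noteq> r" "Im q < 0 \<longrightarrow> q \<noteq> p"
  shows "approachable 0 A0 A1 A2 A3 \<nu> q"
proof (cases "q = p")
  case False
  show ?thesis
  proof (rule approachable_simple[where h = "\<lambda>k. of_real A3 * ((k - p) * (k - r))"])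
    show "Im q < 0 \<and> of_real A3 * ((q - p) * (q - r)) \<noteq> 0 \<or> Im q = 0 \<and> Re (of_real A3 * ((q - p) * (q - r))) < 0"
    proof (cases "Im q < 0")
      case True
      then show ?thesis using A3 ne False by simp
    next
      case 2: False
      then have "Im q = 0" "Re ((q - p) * (q - r)) > 0" using alt False by auto
      moreover have "Re (of_real A3 * ((q - p) * (q - r))) = A3 * Re ((q - p) * (q - r))"
        by (simp only: times_complex.sel Re_complex_of_real Im_complex_of_real mult_zero_left diff_zero)
      ultimately show ?thesis using A3 by (simp only: mult_neg_pos simp_thms)
    qed
    show "\<forall>\<^sub>F k in nhds q. dispersion 0 A0 A1 A2 A3 k (- \<i> * ((k - q) * (of_real A3 * ((k - p) * (k - r)))) + \<i> * of_real \<nu>)"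
      unfolding dispersion_shift using fact by (intro always_eventually allI) (simp add: mult_ac)
  qed (intro continuous_intros)
next
  case True
  then have im: "Im q = 0" "Im r = 0" using alt ne by auto
  show ?thesis
  proof (rule approachable_double[where h = "\<lambda>k. of_real A3 * (k - r)" and \<eta> = "A3 * (Re q - Re r)"])
    show "of_real A3 * (q - r) = of_real (A3 * (Re q - Re r))" using im by (simp add: complex_eq_iff)
    show "A3 * (Re q - Re r) \<noteq> 0" using im ne A3 by (simp add: complex_eq_iff)
    show "\<forall>\<^sub>F k in nhds q. dispersion 0 A0 A1 A2 A3 k (- \<i> * ((k - q)\<^sup>2 * (of_real A3 * (k - r))) + \<i> * of_real \<nu>)"
      unfolding dispersion_shift using fact True
      by (intro always_eventually allI) (simp add: mult_ac power2_eq_square)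
  qed (use im in \<open>auto intro!: continuous_intros\<close>)
qed

text \<open>Two relations for three amplitudes: the flux vanishes at q and at r, and one of the two
  is replaced by their divided difference, which survives the coincidence \<open>q = r\<close>.
  Vieta's formulas for \<open>A2\<close> and \<open>A1\<close> eliminate q and r in favour of
  p.\<close>

lemma cubic_amplitudes:
  assumes A3: "A3 < 0"
    and fact: "\<And>k. symbol (A0 - \<nu>) A1 A2 A3 k =
        of_real A3 * ((k - p) * (k - q) * (k - r))"
    and alt: "cubic_roots p q r"
    and g: "amplitude \<nu> g0 B0" "amplitude \<nu> g1 B1" "amplitude \<nu> g2 B2"
    and bd: "\<And>k s. Im k < 0 \<Longrightarrow> Re s > 0 \<Longrightarrow> dispersion 0 A0 A1 A2 A3 k s \<Longrightarrow>
      norm (laplace (\<lambda>t. flux 0 A1 A2 A3 k s (g0 t) (g1 t) (g2 t)) s) \<le> M"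
  shows "B1 = \<i> * p * B0" "B2 = - p\<^sup>2 * B0"
proof -
  have A3': "complex_of_real A3 \<noteq> 0" using A3 by simp
  have "flux 0 A1 A2 A3 q (\<i> * of_real \<nu>) B0 B1 B2 = 0 \<and>
      \<i> * of_real A3 * B1 - (of_real A2 + of_real A3 * (q + r)) * B0 = 0"
  proof (cases "q = r")
    case True
    \<comment> \<open>Since p lies between the real roots q and r, their coincidence forces a triple
      root.\<close>
    then have eq: "q = p" "r = p" and im: "Im p = 0" using alt by (auto simp: complex_eq_iff)
    have "(k - p) * (k - q) * (k - r) = (k - p) ^ 3" for k
      by (simp add: eq power3_eq_cube)
    note fact' = fact[unfolded this]
    show ?thesis using triple_root_relation[OF A3 fact' im g bd] by (simp add: eq)
  next
    case False
    have ip: "Im p \<ge> 0" and iq: "Im p > 0 \<Longrightarrow> Im q < 0" and ir: "Im r = 0" using alt by auto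
    have "approachable 0 A0 A1 A2 A3 \<nu> q"
    proof (rule cubic_other_root_approachable[OF A3 fact _ False])
      show "Im q < 0 \<longrightarrow> q \<noteq> p" using ip by auto
      show "Im q < 0 \<or> Im q = 0 \<and> q \<noteq> p \<and> Re ((q - p) * (q - r)) > 0 \<or> Im q = 0 \<and> Im r = 0 \<and> q = p"
      proof (cases "Im p > 0 \<or> q = p")
        case True
        then show ?thesis
        proof
          assume "q = p"
          then have "Im q = 0" using ip iq by (cases "Im p > 0") auto
          then show ?thesis using \<open>q = p\<close> ir by simp
        qed (simp add: iq)
      next
        case 2: False
        then have c: "Im p = 0" "Im q = 0" "Im r = 0" "Re q \<le> Re p" "Re p \<le> Re r" "q \<noteq> p" using alt by auto
        then have "Re q < Re p" by (auto simp: complex_eq_iff)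
        then have "(Re q - Re p) * (Re q - Re r) > 0" using c by (intro mult_neg_neg) auto
        then show ?thesis using c by simp
      qed
    qed
    from boundary_relation[OF g bd this]
    have q: "flux 0 A1 A2 A3 q (\<i> * of_real \<nu>) B0 B1 B2 = 0" .
    have fact': "symbol (A0 - \<nu>) A1 A2 A3 k =
        of_real A3 * ((k - p) * (k - r) * (k - q))" for k
      unfolding fact by (simp only: mult_ac)
    have "approachable 0 A0 A1 A2 A3 \<nu> r"
    proof (rule cubic_other_root_approachable[OF A3 fact' _ False[symmetric]])
      show "Im r < 0 \<longrightarrow> r \<noteq> p" using ir by simp
      show "Im r < 0 \<or> Im r = 0 \<and> r \<noteq> p \<and> Re ((r - p) * (r - q)) > 0 \<or> Im r = 0 \<and> Im q = 0 \<and> r = p"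
      proof (cases "Im p > 0")
        case True
        then have c: "q = cnj p" "Im r = 0" using alt by auto
        have "r \<noteq> p" using c True by auto
        moreover have "Re ((r - p) * (r - q)) = (cmod (r - p))\<^sup>2"
          unfolding cmod_power2 using c by (simp add: power2_eq_square)
        ultimately show ?thesis using c by simp
      next
        case 2: False
        then have c: "Im p = 0" "Im q = 0" "Im r = 0" "Re q \<le> Re p" "Re p \<le> Re r" using alt by auto
        show ?thesis
        proof (cases "r = p")
          case True
          then show ?thesis using c by simp
        next
          case 3: False
          then have "Re p < Re r" using c by (auto simp: complex_eq_iff)
          then have "(Re r - Re p) * (Re r - Re q) > 0" using c by (intro mult_pos_pos) auto
          then show ?thesis using c 3 by simp
        qed
      qed
    qed
    from boundary_relation[OF g bd this]
    have r: "flux 0 A1 A2 A3 r (\<i> * of_real \<nu>) B0 B1 B2 = 0" .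
    have "(q - r) * (\<i> * of_real A3 * B1 - (of_real A2 + of_real A3 * (q + r)) * B0) =
        flux 0 A1 A2 A3 q (\<i> * of_real \<nu>) B0 B1 B2 - flux 0 A1 A2 A3 r (\<i> * of_real \<nu>) B0 B1 B2"
      unfolding flux_def by (simp add: algebra_simps power2_eq_square)
    then have "(q - r) * (\<i> * of_real A3 * B1 - (of_real A2 + of_real A3 * (q + r)) * B0) = 0"
      unfolding q r by simp
    then show ?thesis using q False by simp
  qed
  then have 1: "flux 0 A1 A2 A3 q (\<i> * of_real \<nu>) B0 B1 B2 = 0"
    and 2: "\<i> * of_real A3 * B1 - (of_real A2 + of_real A3 * (q + r)) * B0 = 0" by auto
  note V = cubic_vieta(1,2)[OF fact]
  have "of_real A3 * (\<i> * B1 + p * B0) = 0"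
    using 2 unfolding V(1) by (simp add: algebra_simps)
  then have "\<i> * B1 + p * B0 = 0" using A3' by simp
  then have "\<i> * (\<i> * B1 + p * B0) = 0" by simp
  then show B1: "B1 = \<i> * p * B0" by (simp add: algebra_simps)
  have "of_real A3 * (B2 + p\<^sup>2 * B0) = 0"
    using 1 unfolding flux_def V B1 by (simp add: algebra_simps power2_eq_square)
  then have "B2 + p\<^sup>2 * B0 = 0" using A3' by simp
  then show "B2 = - p\<^sup>2 * B0" by (simp add: add_eq_0_iff)
qed

text \<open>One relation, at the other root q, suffices: without \<open>A3\<close> the second
  x-derivative is absent from the flux, and Vieta's formula for \<open>A1\<close> turns the relation
  into \<open>\<i> * B1 + p * B0 = 0\<close>.\<close>

lemma quadratic_amplitude:
  assumes Am2: "Am2 > 0" and C: "A2 + \<nu> * Am2 \<noteq> 0" and D: "Dplus Am2 A0 A1 A2 0 \<noteq> {}"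
    and fact: "\<And>k. of_real (A2 + \<nu> * Am2) * k\<^sup>2 - of_real A1 * k - of_real (A0 - \<nu>) =
        of_real (A2 + \<nu> * Am2) * ((k - p) * (k - q))"
    and alt: "Im p > 0 \<and> q = cnj p \<or> Im p = 0 \<and> Im q = 0 \<and> (A2 + \<nu> * Am2) * (Re p - Re q) \<ge> 0"
    and g: "amplitude \<nu> g0 B0" "amplitude \<nu> g1 B1" "amplitude \<nu> g2 B2"
    and bd: "\<And>k s. Im k < 0 \<Longrightarrow> Re s > 0 \<Longrightarrow> dispersion Am2 A0 A1 A2 0 k s \<Longrightarrow>
      norm (laplace (\<lambda>t. flux Am2 A1 A2 0 k s (g0 t) (g1 t) (g2 t)) s) \<le> M"
  shows "B1 = \<i> * p * B0"
proof -
  define c where "c = A2 + \<nu> * Am2"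
  have c: "c \<noteq> 0" using C by (simp add: c_def)
  note fact' = fact[folded c_def]
  \<comment> \<open>A root at a zero of the denominator would be purely imaginary and force
    \<open>A1 = 0\<close> and \<open>A2 + A0 * Am2 = 0\<close>. Then \<open>flux_sign\<close>
    vanishes identically and \<open>Dplus\<close> is empty.\<close>
  have nz: "1 + of_real Am2 * q\<^sup>2 \<noteq> 0"
  proof
    assume eq: "1 + of_real Am2 * q\<^sup>2 = 0"
    have re: "1 + Am2 * ((Re q)\<^sup>2 - (Im q)\<^sup>2) = 0" and im: "Re q = 0 \<or> Im q = 0"
      using arg_cong[OF eq, of Re] arg_cong[OF eq, of Im] Am2 by (simp_all add: Re_power2 Im_power2)
    have "Im q \<noteq> 0"
    proof
      assume "Im q = 0"
      then have "1 + Am2 * (Re q)\<^sup>2 = 0" using re by simp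
      moreover have "Am2 * (Re q)\<^sup>2 \<ge> 0" using Am2 by simp
      ultimately show False by linarith
    qed
    then have x: "Re q = 0" using im by simp
    have root: "of_real c * q\<^sup>2 - of_real A1 * q - of_real (A0 - \<nu>) = 0" using fact'[of q] by simp
    have "A1 = 0" using arg_cong[OF root, of Im] \<open>Im q \<noteq> 0\<close> x by (simp add: Im_power2)
    have 1: "Am2 * (Im q)\<^sup>2 = 1" using re x by simp
    have 2: "c * (Im q)\<^sup>2 = - (A0 - \<nu>)" using arg_cong[OF root, of Re] x by (simp add: Re_power2)
    have "c * (Am2 * (Im q)\<^sup>2) = - (A0 - \<nu>) * Am2"
      using arg_cong[OF 2, of "\<lambda>z. z * Am2"] by (simp add: mult_ac)
    then have "c = - (A0 - \<nu>) * Am2" unfolding 1 by simp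
    then have "A2 + A0 * Am2 = 0" by (simp add: c_def algebra_simps)
    then have "flux_sign Am2 A0 A1 A2 0 k = 0" for k using \<open>A1 = 0\<close> by (simp add: flux_sign_def)
    then show False using D Dplus_iff[of Am2 0 _ A0 A1 A2] Am2 by auto
  qed
  define h where "h k = of_real c * (k - p) / (1 + of_real Am2 * k\<^sup>2)" for k
  have "open {k. 1 + of_real Am2 * k\<^sup>2 \<noteq> (0::complex)}"
    by (intro open_Collect_neq continuous_intros)
  from eventually_nhds_in_open[OF this] nz
  have "\<forall>\<^sub>F k in nhds q. 1 + of_real Am2 * k\<^sup>2 \<noteq> (0::complex)" by simp
  then have ev: "\<forall>\<^sub>F k in nhds q. dispersion Am2 A0 A1 A2 0 k (- \<i> * ((k - q) * h k) + \<i> * of_real \<nu>)"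
  proof eventually_elim
    case (elim k)
    then have "(k - q) * h k * (1 + of_real Am2 * k\<^sup>2) = of_real c * ((k - p) * (k - q))"
      by (simp add: h_def)
    then have "- \<i> * ((k - q) * h k) * (1 + of_real Am2 * k\<^sup>2) =
        - \<i> * (of_real c * k\<^sup>2 - of_real A1 * k - of_real (A0 - \<nu>))"
      unfolding fact' by (simp only: mult.assoc)
    then show ?case unfolding dispersion_shift c_def[symmetric] by simp
  qed
  have h: "isCont h q" unfolding h_def using nz by (intro continuous_intros) auto
  have "approachable Am2 A0 A1 A2 0 \<nu> q"
  proof (cases "q = p")
    case False
    show ?thesis
    proof (rule approachable_simple[OF h _ ev])
      have "h q \<noteq> 0" using False c nz by (simp add: h_def)
      moreover have "Re (h q) < 0" if "Im p = 0" "Im q = 0" "c * (Re p - Re q) \<ge> 0"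
      proof -
        have hq: "h q = of_real (c * (Re q - Re p) / (1 + Am2 * (Re q)\<^sup>2))"
          using that by (simp add: h_def complex_eq_iff Re_divide Im_divide Re_power2 Im_power2 power2_eq_square)
        have "Re p \<noteq> Re q" using False that by (auto simp: complex_eq_iff)
        then have "c * (Re q - Re p) < 0"
          using that c by (smt (verit) mult_eq_0_iff mult_minus_right)
        moreover have "1 + Am2 * (Re q)\<^sup>2 > 0" using Am2 by (simp add: add_pos_nonneg)
        ultimately show ?thesis unfolding hq by (simp add: divide_neg_pos)
      qed
      ultimately show "Im q < 0 \<and> h q \<noteq> 0 \<or> Im q = 0 \<and> Re (h q) < 0"
        using alt[folded c_def] by auto
    qed
  next
    case True
    then have im: "Im q = 0" "Im p = 0" using alt by (auto simp: complex_eq_iff)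
    define h2 where "h2 k = of_real c / (1 + of_real Am2 * k\<^sup>2)" for k :: complex
    show ?thesis
    proof (rule approachable_double[where h = h2 and \<eta> = "c / (1 + Am2 * (Re q)\<^sup>2)"])
      show "isCont h2 q" unfolding h2_def using nz by (intro continuous_intros) auto
      have q: "q = of_real (Re q)" using im by (simp add: complex_eq_iff)
      show "h2 q = of_real (c / (1 + Am2 * (Re q)\<^sup>2))" unfolding h2_def by (subst q) simp
      have "1 + Am2 * (Re q)\<^sup>2 > 0" using Am2 by (simp add: add_pos_nonneg)
      then show "c / (1 + Am2 * (Re q)\<^sup>2) \<noteq> 0" using c by simp
      have "(k - q) * h k = (k - q)\<^sup>2 * h2 k" for k
        by (simp add: h_def h2_def True power2_eq_square)
      then show "\<forall>\<^sub>F k in nhds q. dispersion Am2 A0 A1 A2 0 k (- \<i> * ((k - q)\<^sup>2 * h2 k) + \<i> * of_real \<nu>)"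
        using ev by simp
    qed (rule im)
  qed
  from boundary_relation[OF g bd this]
  have 1: "flux Am2 A1 A2 0 q (\<i> * of_real \<nu>) B0 B1 B2 = 0" .
  have "of_real A1 = of_real c * (p + q)"
    using fact'[of 1] fact'[of 0] by (simp add: algebra_simps)
  then have "\<i> * of_real c * B1 + of_real c * p * B0 = flux Am2 A1 A2 0 q (\<i> * of_real \<nu>) B0 B1 B2"
    unfolding flux_def by (simp add: c_def algebra_simps)
  then have "of_real c * (\<i> * B1 + p * B0) = 0" unfolding 1 by (simp add: algebra_simps)
  then have "\<i> * (\<i> * B1 + p * B0) = 0" using c by simp
  then show ?thesis by (simp add: algebra_simps)
qed

text \<open>Time derivatives of the boundary values are not assumed to have amplitudes or even to be
  bounded. The equation at \<open>x = 0\<close> expresses the time derivative of the j-th boundary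
  value minus \<open>Am2\<close> times the one of index \<open>j + 2\<close> through boundary values
  alone, so it is bounded and its amplitude is known; \<open>amplitude_deriv\<close> computes the
  same amplitude a second time.\<close>

lemma boundary_recursion:
  assumes u: "smooth u" and pde: "satisfies_pde Am2 A0 A1 A2 A3 u"
    and B: "\<And>j. amplitude \<nu> (\<lambda>t. (dx ^^ j) u 0 t) (B j)"
  shows "\<i> * of_real \<nu> * (B j - of_real Am2 * B (j + 2)) =
    \<i> * of_real A0 * B j + of_real A1 * B (j + 1) + \<i> * of_real A2 * B (j + 2) + of_real A3 * B (j + 3)"
proof -
  let ?w = "\<lambda>j t. (dx ^^ j) u 0 t"
  let ?R = "\<lambda>t. \<i> * of_real A0 * ?w j t + of_real A1 * ?w (j + 1) t + \<i> * of_real A2 * ?w (j + 2) t + of_real A3 * ?w (j + 3) t"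
  note sm = smooth_dx_iter[OF u]
  have R: "amplitude \<nu> ?R (\<i> * of_real A0 * B j + of_real A1 * B (j + 1) + \<i> * of_real A2 * B (j + 2) + of_real A3 * B (j + 3))"
    by (intro amplitude_add amplitude_cmult B)
  have "amplitude \<nu> ?R (\<i> * of_real \<nu> * (B j - of_real Am2 * B (j + 2)))"
  proof (rule amplitude_deriv[where f = "\<lambda>t. ?w j t - of_real Am2 * ?w (j + 2) t"])
    show "amplitude \<nu> (\<lambda>t. ?w j t - of_real Am2 * ?w (j + 2) t) (B j - of_real Am2 * B (j + 2))"
      by (intro amplitude_diff amplitude_cmult B)
    show "bdd_cont ?R" using R by (simp add: amplitude_def)
    fix t :: real assume t: "t \<ge> 1"
    have "((\<lambda>t. ?w j t - of_real Am2 * ?w (j + 2) t) has_vector_derivative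
        dt ((dx ^^ j) u) 0 t - of_real Am2 * dt ((dx ^^ (j + 2)) u) 0 t) (at t)"
      using t by (intro has_vector_derivative_diff has_vector_derivative_mult_right smooth_has_dt[OF sm]) auto
    then show "((\<lambda>t. ?w j t - of_real Am2 * ?w (j + 2) t) has_vector_derivative ?R t) (at t)"
      using pde_all_orders[OF u pde order_refl, of t j] t by (simp only: zero_less_one less_le_trans)
  qed
  from amplitude_unique[OF this R] show ?thesis .
qed

text \<open>A linear recursion with constant coefficients whose characteristic polynomial vanishes
  at \<open>x = \<i> * p\<close>. The powers of x solve it and agree with B at the initial indices,
  three of them in the local and two in the nonlocal case.\<close>

lemma amplitudes_of_root:
  fixes B :: "nat \<Rightarrow> complex"
  assumes root: "symbol (A0 - \<nu>) A1 (A2 + \<nu> * Am2) A3 p = 0"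
    and rec: "\<And>j. \<i> * of_real \<nu> * (B j - of_real Am2 * B (j + 2)) =
      \<i> * of_real A0 * B j + of_real A1 * B (j + 1) + \<i> * of_real A2 * B (j + 2) + of_real A3 * B (j + 3)"
    and B1: "B 1 = \<i> * p * B 0"
    and A: "Am2 = 0 \<and> A3 \<noteq> 0 \<and> B 2 = - p\<^sup>2 * B 0 \<or> A3 = 0 \<and> A2 + \<nu> * Am2 \<noteq> 0"
  shows "B j = (\<i> * p) ^ j * B 0"
proof -
  define C D where "C = \<i> * complex_of_real (A2 + \<nu> * Am2)" and "D = \<i> * complex_of_real (A0 - \<nu>)"
  have lin: "of_real A3 * B (j + 3) + C * B (j + 2) + of_real A1 * B (j + 1) + D * B j = 0" for j
    using rec[of j] by (simp add: C_def D_def algebra_simps)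
  define x where "x = \<i> * p"
  have char: "of_real A3 * x ^ 3 + C * x\<^sup>2 + of_real A1 * x + D = 0"
  proof -
    have "of_real A3 * x ^ 3 + C * x\<^sup>2 + of_real A1 * x + D =
      - \<i> * (symbol (A0 - \<nu>) A1 (A2 + \<nu> * Am2) A3 p)"
      by (simp add: C_def D_def x_def power_mult_distrib power2_i power3_eq_cube algebra_simps)
    then show ?thesis unfolding root by simp
  qed
  have A': "A3 \<noteq> 0 \<and> B 2 = x\<^sup>2 * B 0 \<or> A3 = 0 \<and> C \<noteq> 0"
    using A by (auto simp: x_def C_def power_mult_distrib simp flip: of_real_mult of_real_add)
  have B1': "B 1 = x * B 0" using B1 by (simp add: x_def)
  have B2: "B 2 = x\<^sup>2 * B 0"
    using A'
  proof
    assume c: "A3 = 0 \<and> C \<noteq> 0"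
    have "C * (B 2 - x\<^sup>2 * B 0) = (of_real A3 * B 3 + C * B 2 + of_real A1 * B 1 + D * B 0) -
        (of_real A3 * x ^ 3 + C * x\<^sup>2 + of_real A1 * x + D) * B 0"
      using c unfolding B1' by (simp add: algebra_simps)
    also have "\<dots> = 0" unfolding lin[of 0, unfolded add_0] char by simp
    finally show ?thesis using c by simp
  qed simp
  have "B j = x ^ j * B 0"
  proof (induction j rule: less_induct)
    case (less j)
    show ?case
    proof (cases "j < 3")
      case True
      then consider "j = 0" | "j = 1" | "j = 2" by linarith
      then show ?thesis by cases (use B1' B2 in simp_all)
    next
      case False
      define i where "i = j - 3"
      have j: "j = i + 3" using False by (simp add: i_def)
      have IH: "B i = x ^ i * B 0" "B (i + 1) = x ^ (i + 1) * B 0" "B (i + 2) = x ^ (i + 2) * B 0"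
        by (rule less.IH, simp add: j)+
      show ?thesis
        using A'
      proof
        assume c: "A3 \<noteq> 0 \<and> B 2 = x\<^sup>2 * B 0"
        have "of_real A3 * (B (i + 3) - x ^ (i + 3) * B 0) =
            (of_real A3 * B (i + 3) + C * B (i + 2) + of_real A1 * B (i + 1) + D * B i) -
            (of_real A3 * x ^ 3 + C * x\<^sup>2 + of_real A1 * x + D) * (x ^ i * B 0)"
          unfolding IH power_add by (simp add: algebra_simps)
        also have "\<dots> = 0" unfolding lin char by simp
        finally show ?thesis using c by (simp add: j)
      next
        assume c: "A3 = 0 \<and> C \<noteq> 0"
        \<comment> \<open>Without \<open>A3\<close> the recursion has order two, so
          \<open>B (i + 3)\<close> comes from its instance at \<open>i + 1\<close>.\<close>
        have i: "i + 1 + 3 = i + 4" "i + 1 + 2 = i + 3" "i + 1 + 1 = i + 2" by simp_all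
        have "C * (B (i + 3) - x ^ (i + 3) * B 0) =
            (of_real A3 * B (i + 4) + C * B (i + 3) + of_real A1 * B (i + 2) + D * B (i + 1)) -
            (of_real A3 * x ^ 3 + C * x\<^sup>2 + of_real A1 * x + D) * (x ^ (i + 1) * B 0)"
          using c unfolding IH power_add by (simp add: algebra_simps power2_eq_square power3_eq_cube)
        also have "of_real A3 * B (i + 4) + C * B (i + 3) + of_real A1 * B (i + 2) + D * B (i + 1) = 0"
          using lin[of "i + 1"] unfolding i .
        finally show ?thesis using c unfolding char by (simp add: j)
      qed
    qed
  qed
  then show ?thesis by (simp add: x_def)
qed

text \<open>One witness p both characterises \<open>k0\<close> and governs the amplitudes. As B is
  arbitrary, the statement can be applied at frequency zero to limits of the boundary values in
  place of coefficients.\<close>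

lemma boundary_amplitudes:
  assumes A: "(Am2 = 0 \<and> A3 < 0) \<or>
      (Am2 > 0 \<and> A3 = 0 \<and> A2 + \<nu> * Am2 \<noteq> 0 \<and> Dplus Am2 A0 A1 A2 A3 \<noteq> {})"
    and u: "smooth u" and dec: "decaying u" and pde: "satisfies_pde Am2 A0 A1 A2 A3 u"
  shows "\<exists>p. (\<forall>k. symbol (A0 - \<nu>) A1 (A2 + \<nu> * Am2) A3 k = 0 \<and>
      on_frontier Am2 A0 A1 A2 A3 k \<longleftrightarrow> k = p) \<and>
    (\<forall>B. (\<forall>j. amplitude \<nu> (\<lambda>t. (dx ^^ j) u 0 t) (B j)) \<longrightarrow> (\<forall>j. B j = (\<i> * p) ^ j * B 0))"
  using A
proof
  assume "Am2 = 0 \<and> A3 < 0"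
  then have Am2: "Am2 = 0" and A3: "A3 < 0" by auto
  obtain p q r :: complex where pqr: "\<forall>k. k ^ 3 + of_real (A2 / A3) * k\<^sup>2 + of_real (- A1 / A3) * k + of_real (- (A0 - \<nu>) / A3)
        = (k - p) * (k - q) * (k - r)"
    and alt: "cubic_roots p q r"
    using real_cubic_factor[of "A2 / A3" "- A1 / A3" "- (A0 - \<nu>) / A3"] by (elim exE conjE)
  have fact: "symbol (A0 - \<nu>) A1 A2 A3 k =
        of_real A3 * ((k - p) * (k - q) * (k - r))" for k
    unfolding pqr[rule_format, symmetric] using A3 by (simp add: field_simps)
  note sel = cubic_root_selection[OF A3 fact alt]
  show ?thesis
  proof (intro exI[of _ p] conjI allI impI)
    fix B :: "nat \<Rightarrow> complex" and j assume B: "\<forall>j. amplitude \<nu> (\<lambda>t. (dx ^^ j) u 0 t) (B j)"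
    have bc: "bdd_cont (\<lambda>t. (dx ^^ j) u 0 t)" for j using B by (simp add: amplitude_def)
    have "\<exists>M. \<forall>k s. Im k < 0 \<longrightarrow> Re s > 0 \<longrightarrow> dispersion 0 A0 A1 A2 A3 k s \<longrightarrow>
      norm (laplace (\<lambda>t. flux_at 0 A1 A2 A3 k s u 0 t) s) \<le> M"
      by (rule laplace_flux_bounded[OF _ u dec pde[unfolded Am2] bc]) simp
    then obtain M where M: "\<forall>k s. Im k < 0 \<longrightarrow> Re s > 0 \<longrightarrow> dispersion 0 A0 A1 A2 A3 k s \<longrightarrow>
      norm (laplace (\<lambda>t. flux_at 0 A1 A2 A3 k s u 0 t) s) \<le> M" by (elim exE)
    have g: "amplitude \<nu> (\<lambda>t. u 0 t) (B 0)" "amplitude \<nu> (\<lambda>t. dx u 0 t) (B 1)" "amplitude \<nu> (\<lambda>t. dx (dx u) 0 t) (B 2)"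
      using B[rule_format, of 0] B[rule_format, of 1] B[rule_format, of 2] by (simp_all add: numeral_2_eq_2)
    note B12 = cubic_amplitudes[OF A3 fact alt g M[rule_format]]
    show "B j = (\<i> * p) ^ j * B 0"
    proof (rule amplitudes_of_root[where ?A3.0 = A3 and ?A2.0 = A2 and \<nu> = \<nu> and ?Am2.0 = Am2 and ?A1.0 = A1 and ?A0.0 = A0])
      show "symbol (A0 - \<nu>) A1 (A2 + \<nu> * Am2) A3 p = 0"
        using fact[of p] Am2 by simp
      show "Am2 = 0 \<and> A3 \<noteq> 0 \<and> B 2 = - p\<^sup>2 * B 0 \<or> A3 = 0 \<and> A2 + \<nu> * Am2 \<noteq> 0"
        using Am2 A3 B12(2) by simp
    qed (rule boundary_recursion[OF u pde B[rule_format]], rule B12(1))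
  qed (use sel Am2 in simp)
next
  assume "Am2 > 0 \<and> A3 = 0 \<and> A2 + \<nu> * Am2 \<noteq> 0 \<and> Dplus Am2 A0 A1 A2 A3 \<noteq> {}"
  then have Am2: "Am2 > 0" and A3: "A3 = 0" and C: "A2 + \<nu> * Am2 \<noteq> 0" and D: "Dplus Am2 A0 A1 A2 0 \<noteq> {}" by auto
  define c where "c = A2 + \<nu> * Am2"
  have c: "c \<noteq> 0" using C by (simp add: c_def)
  obtain p0 q0 :: complex where pq0: "\<forall>k. k\<^sup>2 + of_real (- A1 / c) * k + of_real (- (A0 - \<nu>) / c) = (k - p0) * (k - q0)"
    and alt0: "Im p0 > 0 \<and> q0 = cnj p0 \<or> Im p0 = 0 \<and> Im q0 = 0 \<and> Re p0 \<le> Re q0"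
    using real_quadratic_factor[of "- A1 / c" "- (A0 - \<nu>) / c"] by (elim exE conjE)
  \<comment> \<open>Real roots are renamed so that p is the larger one for \<open>c > 0\<close> and
    the smaller one for \<open>c < 0\<close>; a conjugate pair keeps its order.\<close>
  have "\<exists>p q. (\<forall>k. (k - p0) * (k - q0) = (k - p) * (k - q)) \<and>
     (Im p > 0 \<and> q = cnj p \<or> Im p = 0 \<and> Im q = 0 \<and> c * (Re p - Re q) \<ge> 0)"
  proof (cases "Im p0 > 0 \<or> c < 0")
    case True
    then show ?thesis using alt0
      by (intro exI[of _ p0] exI[of _ q0] conjI allI) (auto simp: mult_nonpos_nonpos)
  next
    case False
    then show ?thesis using alt0
      by (intro exI[of _ q0] exI[of _ p0] conjI allI) (auto simp: mult.commute)
  qed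
  then obtain p q where pq: "\<forall>k. (k - p0) * (k - q0) = (k - p) * (k - q)"
    and alt: "Im p > 0 \<and> q = cnj p \<or> Im p = 0 \<and> Im q = 0 \<and> c * (Re p - Re q) \<ge> 0" by (elim exE conjE)
  have fact: "of_real c * k\<^sup>2 - of_real A1 * k - of_real (A0 - \<nu>) = of_real c * ((k - p) * (k - q))" for k
    unfolding pq[rule_format, symmetric] pq0[rule_format, symmetric] using c by (simp add: field_simps)
  note sel = quadratic_root_selection[OF C Am2 fact[unfolded c_def] alt[unfolded c_def]]
  show ?thesis
  proof (intro exI[of _ p] conjI allI impI)
    fix B :: "nat \<Rightarrow> complex" and j assume B: "\<forall>j. amplitude \<nu> (\<lambda>t. (dx ^^ j) u 0 t) (B j)"
    have bc: "bdd_cont (\<lambda>t. (dx ^^ j) u 0 t)" for j using B by (simp add: amplitude_def)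
    have "\<exists>M. \<forall>k s. Im k < 0 \<longrightarrow> Re s > 0 \<longrightarrow> dispersion Am2 A0 A1 A2 0 k s \<longrightarrow>
      norm (laplace (\<lambda>t. flux_at Am2 A1 A2 0 k s u 0 t) s) \<le> M"
      by (rule laplace_flux_bounded[OF _ u dec pde[unfolded A3] bc]) (simp add: Am2)
    then obtain M where M: "\<forall>k s. Im k < 0 \<longrightarrow> Re s > 0 \<longrightarrow> dispersion Am2 A0 A1 A2 0 k s \<longrightarrow>
      norm (laplace (\<lambda>t. flux_at Am2 A1 A2 0 k s u 0 t) s) \<le> M" by (elim exE)
    have g: "amplitude \<nu> (\<lambda>t. u 0 t) (B 0)" "amplitude \<nu> (\<lambda>t. dx u 0 t) (B 1)" "amplitude \<nu> (\<lambda>t. dx (dx u) 0 t) (B 2)"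
      using B[rule_format, of 0] B[rule_format, of 1] B[rule_format, of 2] by (simp_all add: numeral_2_eq_2)
    note B1 = quadratic_amplitude[OF Am2 C D fact[unfolded c_def] alt[unfolded c_def] g M[rule_format]]
    show "B j = (\<i> * p) ^ j * B 0"
    proof (rule amplitudes_of_root[where ?A3.0 = A3 and ?A2.0 = A2 and \<nu> = \<nu> and ?Am2.0 = Am2 and ?A1.0 = A1 and ?A0.0 = A0])
      show "symbol (A0 - \<nu>) A1 (A2 + \<nu> * Am2) A3 p = 0"
        using fact[of p] A3 by (simp add: c_def)
      show "Am2 = 0 \<and> A3 \<noteq> 0 \<and> B 2 = - p\<^sup>2 * B 0 \<or> A3 = 0 \<and> A2 + \<nu> * Am2 \<noteq> 0"
        using A3 C by simp
    qed (rule boundary_recursion[OF u pde B[rule_format]], rule B1)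
  qed (use sel A3 in simp)
qed

text \<open>With \<open>\<omega>0 = 0\<close> all exponentials are 1, so f determines the sum of the
  coefficients and nothing more.\<close>

lemma asymp_periodic_zero_frequency:
  "asymp_periodic 0 f c \<longleftrightarrow> (\<lambda>n. norm (c n)) summable_on UNIV \<and> (f \<longlongrightarrow> (\<Sum>\<^sub>\<infinity>n\<in>UNIV. c n)) at_top"
  unfolding asymp_periodic_def using Lim_null[of f "\<Sum>\<^sub>\<infinity>n\<in>UNIV. c n" at_top] by simp

text \<open>A convergent function is asymptotically periodic at any positive frequency, here 1, with
  all coefficients zero except possibly at \<open>n = 0\<close>; so the result for positive
  frequencies applies.\<close>

lemma tendsto_amplitude_zero:
  assumes f: "(f \<longlongrightarrow> L) at_top" and cont: "continuous_on {1..} f"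
  shows "amplitude 0 f L"
proof -
  define c where "c n = (if n = 0 then L else 0)" for n :: int
  have single: "(\<Sum>\<^sub>\<infinity>n\<in>UNIV. c n * exp (\<i> * of_int n * of_real 1 * of_real t)) = L" for t :: real
  proof -
    have "(\<Sum>\<^sub>\<infinity>n\<in>UNIV. c n * exp (\<i> * of_int n * of_real 1 * of_real t)) =
        (\<Sum>\<^sub>\<infinity>n\<in>{0}. c n * exp (\<i> * of_int n * of_real 1 * of_real t))"
      by (rule infsum_cong_neutral) (auto simp: c_def)
    then show ?thesis by (simp add: c_def)
  qed
  have "(\<lambda>n. norm (c n)) summable_on {0}" by simp
  then have "(\<lambda>n. norm (c n)) summable_on UNIV"
    by (rule summable_on_cong_neutral[THEN iffD1, rotated -1]) (auto simp: c_def)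
  moreover have "((\<lambda>t. f t - L) \<longlongrightarrow> 0) at_top" using f by (rule LIM_zero)
  ultimately have "asymp_periodic 1 f c" unfolding asymp_periodic_def single by simp
  from asymp_periodic_amplitude[OF this cont, of 0] show ?thesis by (simp add: c_def)
qed

theorem theorem1p1:
  fixes Am2 A0 A1 A2 A3 \<omega>0 :: real
    and a :: "int \<Rightarrow> complex"
    and u0 g0 :: "real \<Rightarrow> complex"
    and u :: "real \<Rightarrow> real \<Rightarrow> complex"
  assumes "Am2 \<ge> 0" and "A3 \<le> 0" and "\<omega>0 \<ge> 0"
    and "admissible_initial_datum u0"
    and "smooth_on {0<..} g0" and "asymp_periodic \<omega>0 g0 a"
    and "compatible_at_origin u0 g0"
    and "(Am2 = 0 \<and> A3 < 0) \<or>
         (Am2 > 0 \<and> A3 = 0 \<and> nonresonant Am2 A2 \<omega>0 \<and> Dplus Am2 A0 A1 A2 A3 \<noteq> {})"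
    and "half_line_solution Am2 A0 A1 A2 A3 u0 g0 u"
    and "\<exists>U :: int \<Rightarrow> real \<Rightarrow> complex. \<forall>x>0. asymp_periodic \<omega>0 (\<lambda>t. u x t) (\<lambda>n. U n x)"
    and "\<exists>b :: nat \<Rightarrow> int \<Rightarrow> complex. \<forall>j\<ge>1. asymp_periodic \<omega>0 (\<lambda>t. (dx ^^ j) u 0 t) (b j)"
  shows "(\<forall>n. \<exists>!k. is_k0 Am2 A0 A1 A2 A3 \<omega>0 n k) \<and>
         (\<forall>j. asymp_periodic \<omega>0 (\<lambda>t. (dx ^^ j) u 0 t)
                (\<lambda>n. \<i> ^ j * k0 Am2 A0 A1 A2 A3 \<omega>0 n ^ j * a n))"
proof -
  have u: "smooth u" and dec: "decaying u" and pde: "satisfies_pde Am2 A0 A1 A2 A3 u"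
    and bdry: "\<And>t. t > 0 \<Longrightarrow> u 0 t = g0 t"
    using assms(9) by (simp_all add: half_line_solution_def smooth_def)
  note sm = smooth_dx_iter[OF u]
  let ?w = "\<lambda>j t. (dx ^^ j) u 0 t"
  have cont: "continuous_on {1..} (?w j)" for j
    by (rule smooth_continuous_compose[OF sm]) (auto intro!: continuous_intros)
  \<comment> \<open>A vanishing quadratic coefficient would exhibit
    \<open>A2 / (\<omega>0 * Am2)\<close> as the integer \<open>- n\<close>, or \<open>A2\<close> as
    zero if \<open>\<omega>0 = 0\<close>.\<close>
  have C: "A2 + of_int n * \<omega>0 * Am2 \<noteq> 0" if "Am2 > 0" "nonresonant Am2 A2 \<omega>0" for n :: int
  proof
    assume eq: "A2 + of_int n * \<omega>0 * Am2 = 0"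
    show False
    proof (cases "\<omega>0 = 0")
      case True
      then show ?thesis using that eq by (simp add: nonresonant_def)
    next
      case False
      then have "A2 / (\<omega>0 * Am2) = of_int (- n)" using that eq by (simp add: field_simps add_eq_0_iff)
      then have "A2 / (\<omega>0 * Am2) \<in> \<int>" by (metis Ints_of_int)
      then show ?thesis using that False by (simp add: nonresonant_def)
    qed
  qed
  have A: "(Am2 = 0 \<and> A3 < 0) \<or> (Am2 > 0 \<and> A3 = 0 \<and> Dplus Am2 A0 A1 A2 A3 \<noteq> {})"
    using assms(8) by blast
  have key: "\<exists>p. (\<forall>k. is_k0 Am2 A0 A1 A2 A3 \<omega>0 n k \<longleftrightarrow> k = p) \<and>
    (\<forall>B. (\<forall>j. amplitude (of_int n * \<omega>0) (?w j) (B j)) \<longrightarrow> (\<forall>j. B j = (\<i> * p) ^ j * B 0))" for n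
    unfolding is_k0_iff[OF A refl]
    by (rule boundary_amplitudes[OF _ u dec pde]) (use assms(8) C[of n] in blast)
  have ex1: "\<exists>!k. is_k0 Am2 A0 A1 A2 A3 \<omega>0 n k" for n using key[of n] by auto
  have k0: "B j = (\<i> * k0 Am2 A0 A1 A2 A3 \<omega>0 n) ^ j * B 0"
    if B: "\<And>j. amplitude (of_int n * \<omega>0) (?w j) (B j)" for n j B
  proof -
    obtain p where p: "\<forall>k. is_k0 Am2 A0 A1 A2 A3 \<omega>0 n k \<longleftrightarrow> k = p"
      and pB: "\<forall>B. (\<forall>j. amplitude (of_int n * \<omega>0) (?w j) (B j)) \<longrightarrow> (\<forall>j. B j = (\<i> * p) ^ j * B 0)"
      using key[of n] by (elim exE conjE)
    have k0: "k0 Am2 A0 A1 A2 A3 \<omega>0 n = p" unfolding k0_def using p by (intro the_equality) auto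
    have "\<forall>j. amplitude (of_int n * \<omega>0) (?w j) (B j)" by (intro allI B)
    from pB[THEN spec, THEN mp, OF this, THEN spec, of j] show ?thesis unfolding k0 .
  qed
  obtain b where b: "\<forall>j\<ge>1. asymp_periodic \<omega>0 (?w j) (b j)" using assms(11) by (elim exE)
  define c where "c j = (if j = 0 then a else b j)" for j
  have c: "asymp_periodic \<omega>0 (?w j) (c j)" for j
  proof (cases "j = 0")
    case True
    let ?S = "\<lambda>t. \<Sum>\<^sub>\<infinity>n\<in>UNIV. a n * exp (\<i> * of_int n * of_real \<omega>0 * of_real t)"
    have a: "(\<lambda>n. norm (a n)) summable_on UNIV" "((\<lambda>t. g0 t - ?S t) \<longlongrightarrow> 0) at_top"
      using assms(6) by (simp_all add: asymp_periodic_def)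
    have "((\<lambda>t. u 0 t - ?S t) \<longlongrightarrow> 0) at_top"
      by (rule Lim_transform_eventually[OF a(2)])
         (rule eventually_mono[OF eventually_gt_at_top[of 0]], simp add: bdry)
    then show ?thesis using a(1) True by (simp add: asymp_periodic_def c_def)
  next
    case False
    then show ?thesis using b by (simp add: c_def)
  qed
  have "asymp_periodic \<omega>0 (?w j) (\<lambda>n. \<i> ^ j * k0 Am2 A0 A1 A2 A3 \<omega>0 n ^ j * a n)" for j
  proof (cases "\<omega>0 = 0")
    case False
    then have \<omega>: "\<omega>0 > 0" using assms(3) by simp
    \<comment> \<open>At positive frequency the coefficients are recovered from the function as
      amplitudes, so the assumed ones must be those claimed.\<close>
    have "c j n = \<i> ^ j * k0 Am2 A0 A1 A2 A3 \<omega>0 n ^ j * a n" for n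
      using k0[of n "\<lambda>j. c j n" j, OF asymp_periodic_amplitude[OF c cont \<omega>]]
      by (simp add: c_def[of 0] power_mult_distrib)
    then have "c j = (\<lambda>n. \<i> ^ j * k0 Am2 A0 A1 A2 A3 \<omega>0 n ^ j * a n)" by (rule ext)
    then show ?thesis using c[of j] by simp
  next
    case True
    \<comment> \<open>At frequency zero all \<open>k0\<close> coincide and individual coefficients
      are not determined. The relation is obtained between the sums of the coefficients, that is the
      limits of the boundary values, and then distributed over the terms
      \<open>z * a n\<close>.\<close>
    define z where "z = (\<i> * k0 Am2 A0 A1 A2 A3 0 0) ^ j"
    have k0_const: "k0 Am2 A0 A1 A2 A3 0 n = k0 Am2 A0 A1 A2 A3 0 0" for n
      by (simp add: k0_def is_k0_def)
    have lim: "(?w i \<longlongrightarrow> (\<Sum>\<^sub>\<infinity>n\<in>UNIV. c i n)) at_top" for i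
      using c[of i] unfolding True asymp_periodic_zero_frequency by simp
    have "(\<Sum>\<^sub>\<infinity>n\<in>UNIV. c j n) = z * (\<Sum>\<^sub>\<infinity>n\<in>UNIV. a n)"
      using k0[of 0 "\<lambda>i. \<Sum>\<^sub>\<infinity>n\<in>UNIV. c i n" j] tendsto_amplitude_zero[OF lim cont] True
      by (simp add: z_def c_def[of 0])
    then have "(?w j \<longlongrightarrow> (\<Sum>\<^sub>\<infinity>n\<in>UNIV. z * a n)) at_top"
      using lim[of j] by (simp add: infsum_cmult_right')
    moreover have "(\<lambda>n. norm (z * a n)) summable_on UNIV"
      unfolding norm_mult using assms(6) by (intro summable_on_cmult_right) (simp add: asymp_periodic_def)
    ultimately have "asymp_periodic 0 (?w j) (\<lambda>n. z * a n)"
      unfolding asymp_periodic_zero_frequency by simp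
    moreover have "\<i> ^ j * k0 Am2 A0 A1 A2 A3 0 n ^ j * a n = z * a n" for n
      by (subst k0_const) (simp add: z_def power_mult_distrib)
    ultimately show ?thesis unfolding True by (simp only:)
  qed
  with ex1 show ?thesis by blast
qed

end
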